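(* Let $A=\{A_\alpha\}_{\alpha\in\pi}$ be a Hopf $\pi$-coalgebra, let $R$ be a right ideal of $A_1$ contained in $\ker\varepsilon$, and let $\Gamma=(\{\Gamma_\alpha\}_{\alpha\in\pi},\{d_\alpha\}_{\alpha\in\pi})$ be the left covariant $\pi$-graded first order differential calculus over $A$ determined by $R$, i.e. $\Gamma_\alpha=A_\alpha^2/N_\alpha$ with $N_\alpha=r_\alpha^{-1}(A_\alpha\otimes R)$, and $d_\alpha=\Pi_\alpha\circ D_\alpha$ where $\Pi_\alpha:A_\alpha^2\to\Gamma_\alpha$ is the canonical epimorphism. Then $\Gamma$ is bicovariant if and only if $R$ is $\pi$-ad invariant, i.e. $ad_\alpha(R)\subset R\otimes A_\alpha$ for every $\alpha\in\pi$.
   Context: Let $k$ be a field and $\pi$ a group with identity $1$; $\otimes=\otimes_k$. A Hopf $\pi$-coalgebra (Hopf group coalgebra) is a family $A=\{A_\alpha\}_{\alpha\in\pi}$ of unital associative $k$-algebras (multiplication $m_\alpha$, unit $1_\alpha$) with algebra maps $\Delta_{\alpha,\beta}:A_{\alpha\beta}\to A_\alpha\otimes A_\beta$, $\varepsilon:A_1\to k$ and linear maps $S_\alpha:A_\alpha\to A_{\alpha^{-1}}$ such that $(\Delta_{\alpha,\beta}\otimes id)\Delta_{\alpha\beta,\gamma}=(id\otimes\Delta_{\beta,\gamma})\Delta_{\alpha,\beta\gamma}$, $(id\otimes\varepsilon)\Delta_{\alpha,1}=id=(\varepsilon\otimes id)\Delta_{1,\alpha}$, and $m_\alpha(S_{\alpha^{-1}}\otimes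 id)\Delta_{\alpha^{-1},\alpha}=\varepsilon(\cdot)1_\alpha=m_\alpha(id\otimes S_{\alpha^{-1}})\Delta_{\alpha,\alpha^{-1}}$. A $\pi$-graded first order differential calculus over $A$ is a family $\Gamma=\{\Gamma_\alpha\}$ of (unital) $A_\alpha$-bimodules with linear maps $d_\alpha:A_\alpha\to\Gamma_\alpha$ such that $d_\alpha(ab)=d_\alpha(a)b+a\,d_\alpha(b)$ and every element of $\Gamma_\alpha$ is a finite sum $\sum_k a_k d_\alpha b_k$. It is left covariant (resp. right covariant) if for all $\alpha,\beta\in\pi$ and $a_k,b_k\in A_{\alpha\beta}$, $\sum_k a_k d_{\alpha\beta}b_k=0$ implies $\sum_k\Delta_{\alpha,\beta}(a_k)(id\otimes d_\beta)\Delta_{\alpha,\beta}(b_k)=0$ in $A_\alpha\otimes\Gamma_\beta$ (resp. $\sum_k\Delta_{\alpha,\beta}(a_k)(d_\alpha\otimes id)\Delta_{\alpha,\beta}(b_k)=0$ in $\Gamma_\alpha\otimes A_\beta$). It is bicovariant if it is both left and right covariant. $A^2_\alpha=\{q\in A_\alpha\otimes A_\alpha: m_\alpha(q)=0\}$ is an $A_\alpha$-bimodule via $c(a\otimes b)=ca\otimes b$, $(a\otimes b)c=a\otimes bc$, and $D_\alpha:A_\alpha\to A_\alpha^2$ is $D_\alpha(b)=1_\alpha\otimes b-b\otimes 1_\alpha$. The map $r_\alpha:A_\alpha\otimes A_\alpha\to A_\alpha\otimes A_1$, $r_\alpha(a\otimes b)=(a\otimes 1_1)\Delta_{\alpha,1}(b)$,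 is a bijection with inverse $r_\alpha^{-1}(a\otimes b)=(a\otimes1_\alpha)(S_{\alpha^{-1}}\otimes id)\Delta_{\alpha^{-1},\alpha}(b)$, and $r_\alpha(A_\alpha^2)=A_\alpha\otimes\ker\varepsilon$. Put $t_\alpha:A_\alpha\otimes A_\alpha\to A_1\otimes A_\alpha$, $t_\alpha(a\otimes b)=(1_1\otimes a)\Delta_{1,\alpha}(b)$. The map $ad_\alpha:A_1\to A_1\otimes A_\alpha$ is $ad_\alpha(a)=t_\alpha(r_\alpha^{-1}(1_\alpha\otimes a))=a_{(2,1)}\otimes S_{\alpha^{-1}}(a_{(1,\alpha^{-1})})a_{(3,\alpha)}$, where $(id\otimes\Delta_{1,\alpha})\Delta_{\alpha^{-1},\alpha}(a)=a_{(1,\alpha^{-1})}\otimes a_{(2,1)}\otimes a_{(3,\alpha)}$ (summation implicit). *)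

theory Defs
  imports "HOL-Algebra.AbelCoset" "HOL-Algebra.Module"
begin

section \<open>Linear algebra over a field with carriers\<close>

text \<open>
  Vector spaces are records of type \<^typ>\<open>('k, 'v) module\<close> satisfying the library locale
  \<^locale>\<open>module\<close> over a field.  The \<open>mult\<close> and \<open>one\<close> fields of such a record are significant only
  when the record is used as an algebra; in all other constructions below they are
  \<^const>\<open>undefined\<close>.
\<close>

definition linear_maps ::
  "('k, 'm) ring_scheme \<Rightarrow> ('k, 'v, 'x) module_scheme \<Rightarrow> ('k, 'w, 'y) module_scheme \<Rightarrow> ('v \<Rightarrow> 'w) set"
  where "linear_maps K V W = {f. f \<in> carrier V \<rightarrow> carrier W
    \<and> (\<forall>x\<in>carrier V. \<forall>y\<in>carrier V. f (x \<oplus>\<^bsub>V\<^esub> y) = f x \<oplus>\<^bsub>W\<^esub> f y)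
    \<and> (\<forall>c\<in>carrier K. \<forall>x\<in>carrier V. f (c \<odot>\<^bsub>V\<^esub> x) = c \<odot>\<^bsub>W\<^esub> f x)}"

definition lin_span ::
  "('k, 'm) ring_scheme \<Rightarrow> ('k, 'v, 'x) module_scheme \<Rightarrow> 'v set \<Rightarrow> 'v set"
  where "lin_span K V S = \<Inter>{H. submodule H K V \<and> S \<subseteq> H}"

definition quot_module :: "('k, 'v, 'x) module_scheme \<Rightarrow> 'v set \<Rightarrow> ('k, 'v set) module"
  where "quot_module V N =
    \<lparr>carrier = a_rcosets\<^bsub>V\<^esub> N, mult = undefined, one = undefined,
     zero = N, add = set_add V,
     smult = (\<lambda>c X. \<Union>x\<in>X. N +>\<^bsub>V\<^esub> (c \<odot>\<^bsub>V\<^esub> x))\<rparr>"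

text \<open>The free vector space on a set \<open>X\<close>: finitely supported functions, vanishing outside \<open>X\<close>.\<close>

definition free_module :: "('k, 'm) ring_scheme \<Rightarrow> 'x set \<Rightarrow> ('k, 'x \<Rightarrow> 'k) module"
  where "free_module K X =
    \<lparr>carrier = {f. f \<in> UNIV \<rightarrow> carrier K \<and> finite {x. f x \<noteq> \<zero>\<^bsub>K\<^esub>} \<and> {x. f x \<noteq> \<zero>\<^bsub>K\<^esub>} \<subseteq> X},
     mult = undefined, one = undefined,
     zero = (\<lambda>x. \<zero>\<^bsub>K\<^esub>), add = (\<lambda>f g x. f x \<oplus>\<^bsub>K\<^esub> g x),
     smult = (\<lambda>c f x. c \<otimes>\<^bsub>K\<^esub> f x)\<rparr>"

definition free_gen :: "('k, 'm) ring_scheme \<Rightarrow> 'x \<Rightarrow> 'x \<Rightarrow> 'k"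
  where "free_gen K x = (\<lambda>y. if y = x then \<one>\<^bsub>K\<^esub> else \<zero>\<^bsub>K\<^esub>)"


section \<open>Tensor products\<close>

type_synonym ('k, 'v, 'w) tens = "('v \<times> 'w \<Rightarrow> 'k) set"

definition tensor_rels ::
  "('k, 'm) ring_scheme \<Rightarrow> ('k, 'v, 'x) module_scheme \<Rightarrow> ('k, 'w, 'y) module_scheme
    \<Rightarrow> ('v \<times> 'w \<Rightarrow> 'k) set"
  where "tensor_rels K V W = (let F = free_module K (carrier V \<times> carrier W) in
      {free_gen K (v \<oplus>\<^bsub>V\<^esub> v', w) \<ominus>\<^bsub>F\<^esub> (free_gen K (v, w) \<oplus>\<^bsub>F\<^esub> free_gen K (v', w)) | v v' w.
        v \<in> carrier V \<and> v' \<in> carrier V \<and> w \<in> carrier W}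
    \<union> {free_gen K (v, w \<oplus>\<^bsub>W\<^esub> w') \<ominus>\<^bsub>F\<^esub> (free_gen K (v, w) \<oplus>\<^bsub>F\<^esub> free_gen K (v, w')) | v w w'.
        v \<in> carrier V \<and> w \<in> carrier W \<and> w' \<in> carrier W}
    \<union> {free_gen K (c \<odot>\<^bsub>V\<^esub> v, w) \<ominus>\<^bsub>F\<^esub> (c \<odot>\<^bsub>F\<^esub> free_gen K (v, w)) | c v w.
        c \<in> carrier K \<and> v \<in> carrier V \<and> w \<in> carrier W}
    \<union> {free_gen K (v, c \<odot>\<^bsub>W\<^esub> w) \<ominus>\<^bsub>F\<^esub> (c \<odot>\<^bsub>F\<^esub> free_gen K (v, w)) | c v w.
        c \<in> carrier K \<and> v \<in> carrier V \<and> w \<in> carrier W})"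

definition tensor_null ::
  "('k, 'm) ring_scheme \<Rightarrow> ('k, 'v, 'x) module_scheme \<Rightarrow> ('k, 'w, 'y) module_scheme
    \<Rightarrow> ('v \<times> 'w \<Rightarrow> 'k) set"
  where "tensor_null K V W =
    lin_span K (free_module K (carrier V \<times> carrier W)) (tensor_rels K V W)"

definition tensor ::
  "('k, 'm) ring_scheme \<Rightarrow> ('k, 'v, 'x) module_scheme \<Rightarrow> ('k, 'w, 'y) module_scheme
    \<Rightarrow> ('k, ('k, 'v, 'w) tens) module"
  where "tensor K V W =
    quot_module (free_module K (carrier V \<times> carrier W)) (tensor_null K V W)"

definition pure_tensor ::
  "('k, 'm) ring_scheme \<Rightarrow> ('k, 'v, 'x) module_scheme \<Rightarrow> ('k, 'w, 'y) module_scheme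
    \<Rightarrow> 'v \<Rightarrow> 'w \<Rightarrow> ('k, 'v, 'w) tens"
  where "pure_tensor K V W v w =
    tensor_null K V W +>\<^bsub>free_module K (carrier V \<times> carrier W)\<^esub> free_gen K (v, w)"

text \<open>
  The linear map \<open>V \<otimes> W \<rightarrow> P\<close>, \<open>v \<otimes> w \<mapsto> h v w\<close>, induced by a bilinear map \<open>h\<close>: on a coset it is the
  common value of the linear extension of \<open>h\<close> on all representatives.
\<close>

definition tensor_lift ::
  "('k, 'm) ring_scheme \<Rightarrow> ('k, 'p, 'z) module_scheme \<Rightarrow> ('v \<Rightarrow> 'w \<Rightarrow> 'p)
    \<Rightarrow> ('k, 'v, 'w) tens \<Rightarrow> 'p"
  where "tensor_lift K P h X =
    the_elem ((\<lambda>f. \<Oplus>\<^bsub>P\<^esub>p\<in>{p. f p \<noteq> \<zero>\<^bsub>K\<^esub>}. f p \<odot>\<^bsub>P\<^esub> h (fst p) (snd p)) ` X)"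

text \<open>\<open>f \<otimes> g : V \<otimes> W \<rightarrow> P \<otimes> Q\<close> for linear \<open>f : V \<rightarrow> P\<close> and \<open>g : W \<rightarrow> Q\<close>.\<close>

definition tensor_map ::
  "('k, 'm) ring_scheme \<Rightarrow> ('k, 'p, 'x) module_scheme \<Rightarrow> ('k, 'q, 'y) module_scheme
    \<Rightarrow> ('v \<Rightarrow> 'p) \<Rightarrow> ('w \<Rightarrow> 'q) \<Rightarrow> ('k, 'v, 'w) tens \<Rightarrow> ('k, 'p, 'q) tens"
  where "tensor_map K P Q f g =
    tensor_lift K (tensor K P Q) (\<lambda>v w. pure_tensor K P Q (f v) (g w))"

text \<open>
  The bilinear map \<open>(V \<otimes> W) \<times> (V' \<otimes> W') \<rightarrow> P \<otimes> Q\<close>, \<open>(v \<otimes> w, v' \<otimes> w') \<mapsto> f v v' \<otimes> g w w'\<close>, for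
  bilinear \<open>f : V \<times> V' \<rightarrow> P\<close> and \<open>g : W \<times> W' \<rightarrow> Q\<close>.
\<close>

definition tensor_map2 ::
  "('k, 'm) ring_scheme \<Rightarrow> ('k, 'p, 'x) module_scheme \<Rightarrow> ('k, 'q, 'y) module_scheme
    \<Rightarrow> ('v \<Rightarrow> 'v' \<Rightarrow> 'p) \<Rightarrow> ('w \<Rightarrow> 'w' \<Rightarrow> 'q)
    \<Rightarrow> ('k, 'v, 'w) tens \<Rightarrow> ('k, 'v', 'w') tens \<Rightarrow> ('k, 'p, 'q) tens"
  where "tensor_map2 K P Q f g X Y =
    tensor_lift K (tensor K P Q) (\<lambda>v w.
      tensor_lift K (tensor K P Q) (\<lambda>v' w'. pure_tensor K P Q (f v v') (g w w')) Y) X"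

text \<open>The canonical isomorphism \<open>(U \<otimes> V) \<otimes> W \<rightarrow> U \<otimes> (V \<otimes> W)\<close>.\<close>

definition tensor_assoc ::
  "('k, 'm) ring_scheme \<Rightarrow> ('k, 'u, 'x) module_scheme \<Rightarrow> ('k, 'v, 'y) module_scheme
    \<Rightarrow> ('k, 'w, 'z) module_scheme
    \<Rightarrow> ('k, ('k, 'u, 'v) tens, 'w) tens \<Rightarrow> ('k, 'u, ('k, 'v, 'w) tens) tens"
  where "tensor_assoc K U V W =
    tensor_lift K (tensor K U (tensor K V W)) (\<lambda>X w.
      tensor_lift K (tensor K U (tensor K V W)) (\<lambda>u v.
        pure_tensor K U (tensor K V W) u (pure_tensor K V W v w)) X)"

text \<open>
  For subspaces \<open>S \<subseteq> V\<close>, \<open>T \<subseteq> W\<close>, the space \<open>S \<otimes> T\<close> regarded, as usual over a field, as a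
  subspace of \<open>V \<otimes> W\<close>.
\<close>

definition tensor_sub ::
  "('k, 'm) ring_scheme \<Rightarrow> ('k, 'v, 'x) module_scheme \<Rightarrow> ('k, 'w, 'y) module_scheme
    \<Rightarrow> 'v set \<Rightarrow> 'w set \<Rightarrow> ('k, 'v, 'w) tens set"
  where "tensor_sub K V W S T =
    lin_span K (tensor K V W) {pure_tensor K V W s t | s t. s \<in> S \<and> t \<in> T}"


section \<open>Algebras, right ideals, bimodules\<close>

text \<open>The library locale \<^locale>\<open>algebra\<close> demands commutativity, hence:\<close>

locale assoc_algebra = module K A + ring A for K (structure) and A (structure) +
  assumes smult_mult_left:
      "\<lbrakk>c \<in> carrier K; x \<in> carrier A; y \<in> carrier A\<rbrakk> \<Longrightarrow>
        (c \<odot>\<^bsub>A\<^esub> x) \<otimes>\<^bsub>A\<^esub> y = c \<odot>\<^bsub>A\<^esub> (x \<otimes>\<^bsub>A\<^esub> y)"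
    and smult_mult_right:
      "\<lbrakk>c \<in> carrier K; x \<in> carrier A; y \<in> carrier A\<rbrakk> \<Longrightarrow>
        x \<otimes>\<^bsub>A\<^esub> (c \<odot>\<^bsub>A\<^esub> y) = c \<odot>\<^bsub>A\<^esub> (x \<otimes>\<^bsub>A\<^esub> y)"

definition tensor_alg ::
  "('k, 'm) ring_scheme \<Rightarrow> ('k, 'a, 'x) module_scheme \<Rightarrow> ('k, 'b, 'y) module_scheme
    \<Rightarrow> ('k, ('k, 'a, 'b) tens) module"
  where "tensor_alg K A B = (tensor K A B)
    \<lparr>mult := tensor_map2 K A B (mult A) (mult B), one := pure_tensor K A B \<one>\<^bsub>A\<^esub> \<one>\<^bsub>B\<^esub>\<rparr>"

definition mult_map ::
  "('k, 'm) ring_scheme \<Rightarrow> ('k, 'a, 'x) module_scheme \<Rightarrow> ('k, 'a, 'a) tens \<Rightarrow> 'a"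
  where "mult_map K A = tensor_lift K A (mult A)"

locale right_ideal = additive_subgroup R A for R and A (structure) +
  assumes right_closed: "\<lbrakk>x \<in> R; a \<in> carrier A\<rbrakk> \<Longrightarrow> x \<otimes>\<^bsub>A\<^esub> a \<in> R"

record ('k, 'a, 'v) bimod = "('k, 'v) module" +
  lact :: "'a \<Rightarrow> 'v \<Rightarrow> 'v"
  ract :: "'v \<Rightarrow> 'a \<Rightarrow> 'v"

text \<open>Unital bimodules over the \<open>K\<close>-algebra \<open>A\<close>, with \<open>K\<close> acting centrally.\<close>

locale bimodule = alg: assoc_algebra K A + V: module K V
  for K (structure) and A (structure) and V :: "('k, 'a, 'v, 'z) bimod_scheme" (structure) +
  assumes lact_closed: "\<lbrakk>a \<in> carrier A; x \<in> carrier V\<rbrakk> \<Longrightarrow> lact V a x \<in> carrier V"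
    and ract_closed: "\<lbrakk>a \<in> carrier A; x \<in> carrier V\<rbrakk> \<Longrightarrow> ract V x a \<in> carrier V"
    and lact_add_left: "\<lbrakk>a \<in> carrier A; b \<in> carrier A; x \<in> carrier V\<rbrakk> \<Longrightarrow>
      lact V (a \<oplus>\<^bsub>A\<^esub> b) x = lact V a x \<oplus>\<^bsub>V\<^esub> lact V b x"
    and lact_add_right: "\<lbrakk>a \<in> carrier A; x \<in> carrier V; y \<in> carrier V\<rbrakk> \<Longrightarrow>
      lact V a (x \<oplus>\<^bsub>V\<^esub> y) = lact V a x \<oplus>\<^bsub>V\<^esub> lact V a y"
    and lact_smult_left: "\<lbrakk>c \<in> carrier K; a \<in> carrier A; x \<in> carrier V\<rbrakk> \<Longrightarrow>
      lact V (c \<odot>\<^bsub>A\<^esub> a) x = c \<odot>\<^bsub>V\<^esub> lact V a x"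
    and lact_smult_right: "\<lbrakk>c \<in> carrier K; a \<in> carrier A; x \<in> carrier V\<rbrakk> \<Longrightarrow>
      lact V a (c \<odot>\<^bsub>V\<^esub> x) = c \<odot>\<^bsub>V\<^esub> lact V a x"
    and ract_add_left: "\<lbrakk>a \<in> carrier A; x \<in> carrier V; y \<in> carrier V\<rbrakk> \<Longrightarrow>
      ract V (x \<oplus>\<^bsub>V\<^esub> y) a = ract V x a \<oplus>\<^bsub>V\<^esub> ract V y a"
    and ract_add_right: "\<lbrakk>a \<in> carrier A; b \<in> carrier A; x \<in> carrier V\<rbrakk> \<Longrightarrow>
      ract V x (a \<oplus>\<^bsub>A\<^esub> b) = ract V x a \<oplus>\<^bsub>V\<^esub> ract V x b"
    and ract_smult_left: "\<lbrakk>c \<in> carrier K; a \<in> carrier A; x \<in> carrier V\<rbrakk> \<Longrightarrow>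
      ract V (c \<odot>\<^bsub>V\<^esub> x) a = c \<odot>\<^bsub>V\<^esub> ract V x a"
    and ract_smult_right: "\<lbrakk>c \<in> carrier K; a \<in> carrier A; x \<in> carrier V\<rbrakk> \<Longrightarrow>
      ract V x (c \<odot>\<^bsub>A\<^esub> a) = c \<odot>\<^bsub>V\<^esub> ract V x a"
    and lact_one: "x \<in> carrier V \<Longrightarrow> lact V \<one>\<^bsub>A\<^esub> x = x"
    and ract_one: "x \<in> carrier V \<Longrightarrow> ract V x \<one>\<^bsub>A\<^esub> = x"
    and lact_mult: "\<lbrakk>a \<in> carrier A; b \<in> carrier A; x \<in> carrier V\<rbrakk> \<Longrightarrow>
      lact V (a \<otimes>\<^bsub>A\<^esub> b) x = lact V a (lact V b x)"
    and ract_mult: "\<lbrakk>a \<in> carrier A; b \<in> carrier A; x \<in> carrier V\<rbrakk> \<Longrightarrow>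
      ract V x (a \<otimes>\<^bsub>A\<^esub> b) = ract V (ract V x a) b"
    and lact_ract: "\<lbrakk>a \<in> carrier A; b \<in> carrier A; x \<in> carrier V\<rbrakk> \<Longrightarrow>
      ract V (lact V a x) b = lact V a (ract V x b)"

definition quot_bimodule ::
  "('k, 'a, 'v, 'z) bimod_scheme \<Rightarrow> 'v set \<Rightarrow> ('k, 'a, 'v set) bimod"
  where "quot_bimodule V N =
    \<lparr>carrier = a_rcosets\<^bsub>V\<^esub> N, mult = undefined, one = undefined,
     zero = N, add = set_add V,
     smult = (\<lambda>c X. \<Union>x\<in>X. N +>\<^bsub>V\<^esub> (c \<odot>\<^bsub>V\<^esub> x)),
     lact = (\<lambda>a X. \<Union>x\<in>X. N +>\<^bsub>V\<^esub> lact V a x),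
     ract = (\<lambda>X a. \<Union>x\<in>X. N +>\<^bsub>V\<^esub> ract V x a)\<rparr>"


section \<open>Hopf group coalgebras\<close>

text \<open>
  All algebras \<open>A \<alpha>\<close> have their carriers in one type, which is no restriction (pass to the disjoint
  union of the carriers) and makes \<open>A (\<alpha> \<otimes> \<one>)\<close> and \<open>A \<alpha>\<close> literally equal.  Only the values
  on indices in \<open>carrier G\<close> and on elements of the respective carriers matter.
\<close>

locale hopf_group_coalgebra = field K + G: group G
  for K :: "('k, 'm) ring_scheme" (structure) and G :: "('g, 'n) monoid_scheme" (structure) +
  fixes A :: "'g \<Rightarrow> ('k, 'a) module"
    and \<Delta> :: "'g \<Rightarrow> 'g \<Rightarrow> 'a \<Rightarrow> ('k, 'a, 'a) tens"
    and \<epsilon> :: "'a \<Rightarrow> 'k"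
    and S :: "'g \<Rightarrow> 'a \<Rightarrow> 'a"
  assumes algebra_A: "\<alpha> \<in> carrier G \<Longrightarrow> assoc_algebra K (A \<alpha>)"
    and comult_linear: "\<lbrakk>\<alpha> \<in> carrier G; \<beta> \<in> carrier G\<rbrakk> \<Longrightarrow>
      \<Delta> \<alpha> \<beta> \<in> linear_maps K (A (\<alpha> \<otimes>\<^bsub>G\<^esub> \<beta>)) (tensor K (A \<alpha>) (A \<beta>))"
    and comult_hom: "\<lbrakk>\<alpha> \<in> carrier G; \<beta> \<in> carrier G\<rbrakk> \<Longrightarrow>
      \<Delta> \<alpha> \<beta> \<in> ring_hom (A (\<alpha> \<otimes>\<^bsub>G\<^esub> \<beta>)) (tensor_alg K (A \<alpha>) (A \<beta>))"
    and counit_hom: "\<epsilon> \<in> ring_hom (A \<one>\<^bsub>G\<^esub>) K"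
    and counit_linear: "\<lbrakk>c \<in> carrier K; x \<in> carrier (A \<one>\<^bsub>G\<^esub>)\<rbrakk> \<Longrightarrow>
      \<epsilon> (c \<odot>\<^bsub>A \<one>\<^bsub>G\<^esub>\<^esub> x) = c \<otimes>\<^bsub>K\<^esub> \<epsilon> x"
    and antipode_linear: "\<alpha> \<in> carrier G \<Longrightarrow>
      S \<alpha> \<in> linear_maps K (A \<alpha>) (A (inv\<^bsub>G\<^esub> \<alpha>))"
    and coassoc:
      "\<lbrakk>\<alpha> \<in> carrier G; \<beta> \<in> carrier G; \<gamma> \<in> carrier G; x \<in> carrier (A (\<alpha> \<otimes>\<^bsub>G\<^esub> \<beta> \<otimes>\<^bsub>G\<^esub> \<gamma>))\<rbrakk> \<Longrightarrow>
        tensor_assoc K (A \<alpha>) (A \<beta>) (A \<gamma>)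
          (tensor_map K (tensor K (A \<alpha>) (A \<beta>)) (A \<gamma>) (\<Delta> \<alpha> \<beta>) id (\<Delta> (\<alpha> \<otimes>\<^bsub>G\<^esub> \<beta>) \<gamma> x))
        = tensor_map K (A \<alpha>) (tensor K (A \<beta>) (A \<gamma>)) id (\<Delta> \<beta> \<gamma>) (\<Delta> \<alpha> (\<beta> \<otimes>\<^bsub>G\<^esub> \<gamma>) x)"
    and counit_right: "\<lbrakk>\<alpha> \<in> carrier G; x \<in> carrier (A \<alpha>)\<rbrakk> \<Longrightarrow>
      tensor_lift K (A \<alpha>) (\<lambda>a b. \<epsilon> b \<odot>\<^bsub>A \<alpha>\<^esub> a) (\<Delta> \<alpha> \<one>\<^bsub>G\<^esub> x) = x"
    and counit_left: "\<lbrakk>\<alpha> \<in> carrier G; x \<in> carrier (A \<alpha>)\<rbrakk> \<Longrightarrow>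
      tensor_lift K (A \<alpha>) (\<lambda>a b. \<epsilon> a \<odot>\<^bsub>A \<alpha>\<^esub> b) (\<Delta> \<one>\<^bsub>G\<^esub> \<alpha> x) = x"
    and antipode_left: "\<lbrakk>\<alpha> \<in> carrier G; x \<in> carrier (A \<one>\<^bsub>G\<^esub>)\<rbrakk> \<Longrightarrow>
      mult_map K (A \<alpha>) (tensor_map K (A \<alpha>) (A \<alpha>) (S (inv\<^bsub>G\<^esub> \<alpha>)) id (\<Delta> (inv\<^bsub>G\<^esub> \<alpha>) \<alpha> x))
        = \<epsilon> x \<odot>\<^bsub>A \<alpha>\<^esub> \<one>\<^bsub>A \<alpha>\<^esub>"
    and antipode_right: "\<lbrakk>\<alpha> \<in> carrier G; x \<in> carrier (A \<one>\<^bsub>G\<^esub>)\<rbrakk> \<Longrightarrow>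
      mult_map K (A \<alpha>) (tensor_map K (A \<alpha>) (A \<alpha>) id (S (inv\<^bsub>G\<^esub> \<alpha>)) (\<Delta> \<alpha> (inv\<^bsub>G\<^esub> \<alpha>) x))
        = \<epsilon> x \<odot>\<^bsub>A \<alpha>\<^esub> \<one>\<^bsub>A \<alpha>\<^esub>"


section \<open>Graded first order differential calculi\<close>

locale graded_fodc =
  fixes K :: "('k, 'm) ring_scheme" and G :: "('g, 'n) monoid_scheme"
    and A :: "'g \<Rightarrow> ('k, 'a) module"
    and \<Gamma> :: "'g \<Rightarrow> ('k, 'a, 'v) bimod"
    and d :: "'g \<Rightarrow> 'a \<Rightarrow> 'v"
  assumes bimodule_\<Gamma>: "\<alpha> \<in> carrier G \<Longrightarrow> bimodule K (A \<alpha>) (\<Gamma> \<alpha>)"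
    and d_linear: "\<alpha> \<in> carrier G \<Longrightarrow> d \<alpha> \<in> linear_maps K (A \<alpha>) (\<Gamma> \<alpha>)"
    and d_leibniz: "\<lbrakk>\<alpha> \<in> carrier G; a \<in> carrier (A \<alpha>); b \<in> carrier (A \<alpha>)\<rbrakk> \<Longrightarrow>
      d \<alpha> (a \<otimes>\<^bsub>A \<alpha>\<^esub> b) = ract (\<Gamma> \<alpha>) (d \<alpha> a) b \<oplus>\<^bsub>\<Gamma> \<alpha>\<^esub> lact (\<Gamma> \<alpha>) a (d \<alpha> b)"
    and d_generates: "\<lbrakk>\<alpha> \<in> carrier G; \<omega> \<in> carrier (\<Gamma> \<alpha>)\<rbrakk> \<Longrightarrow>
      \<exists>(n::nat) a b. a \<in> {..<n} \<rightarrow> carrier (A \<alpha>) \<and> b \<in> {..<n} \<rightarrow> carrier (A \<alpha>)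
        \<and> \<omega> = (\<Oplus>\<^bsub>\<Gamma> \<alpha>\<^esub>k\<in>{..<n}. lact (\<Gamma> \<alpha>) (a k) (d \<alpha> (b k)))"

text \<open>
  In the next two locales the products are those of the \<open>A \<alpha> \<otimes> A \<beta>\<close>-module structures
  \<open>(a \<otimes> b)(c \<otimes> \<omega>) = ac \<otimes> b\<omega>\<close> on \<open>A \<alpha> \<otimes> \<Gamma> \<beta>\<close> and \<open>(a \<otimes> b)(\<omega> \<otimes> c) = a\<omega> \<otimes> bc\<close> on \<open>\<Gamma> \<alpha> \<otimes> A \<beta>\<close>.
\<close>

locale left_covariant_fodc = graded_fodc K G A \<Gamma> d
  for K :: "('k, 'm) ring_scheme" and G :: "('g, 'n) monoid_scheme"
    and A :: "'g \<Rightarrow> ('k, 'a) module"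
    and \<Delta> :: "'g \<Rightarrow> 'g \<Rightarrow> 'a \<Rightarrow> ('k, 'a, 'a) tens"
    and \<Gamma> :: "'g \<Rightarrow> ('k, 'a, 'v) bimod"
    and d :: "'g \<Rightarrow> 'a \<Rightarrow> 'v" +
  assumes left_covariant: "\<And>\<alpha> \<beta> (n::nat) a b.
    \<lbrakk>\<alpha> \<in> carrier G; \<beta> \<in> carrier G;
     a \<in> {..<n} \<rightarrow> carrier (A (\<alpha> \<otimes>\<^bsub>G\<^esub> \<beta>)); b \<in> {..<n} \<rightarrow> carrier (A (\<alpha> \<otimes>\<^bsub>G\<^esub> \<beta>));
     (\<Oplus>\<^bsub>\<Gamma> (\<alpha> \<otimes>\<^bsub>G\<^esub> \<beta>)\<^esub>k\<in>{..<n}. lact (\<Gamma> (\<alpha> \<otimes>\<^bsub>G\<^esub> \<beta>)) (a k) (d (\<alpha> \<otimes>\<^bsub>G\<^esub> \<beta>) (b k)))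
       = \<zero>\<^bsub>\<Gamma> (\<alpha> \<otimes>\<^bsub>G\<^esub> \<beta>)\<^esub>\<rbrakk> \<Longrightarrow>
    (\<Oplus>\<^bsub>tensor K (A \<alpha>) (\<Gamma> \<beta>)\<^esub>k\<in>{..<n}.
        tensor_map2 K (A \<alpha>) (\<Gamma> \<beta>) (mult (A \<alpha>)) (lact (\<Gamma> \<beta>))
          (\<Delta> \<alpha> \<beta> (a k)) (tensor_map K (A \<alpha>) (\<Gamma> \<beta>) id (d \<beta>) (\<Delta> \<alpha> \<beta> (b k))))
      = \<zero>\<^bsub>tensor K (A \<alpha>) (\<Gamma> \<beta>)\<^esub>"

locale right_covariant_fodc = graded_fodc K G A \<Gamma> d
  for K :: "('k, 'm) ring_scheme" and G :: "('g, 'n) monoid_scheme"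
    and A :: "'g \<Rightarrow> ('k, 'a) module"
    and \<Delta> :: "'g \<Rightarrow> 'g \<Rightarrow> 'a \<Rightarrow> ('k, 'a, 'a) tens"
    and \<Gamma> :: "'g \<Rightarrow> ('k, 'a, 'v) bimod"
    and d :: "'g \<Rightarrow> 'a \<Rightarrow> 'v" +
  assumes right_covariant: "\<And>\<alpha> \<beta> (n::nat) a b.
    \<lbrakk>\<alpha> \<in> carrier G; \<beta> \<in> carrier G;
     a \<in> {..<n} \<rightarrow> carrier (A (\<alpha> \<otimes>\<^bsub>G\<^esub> \<beta>)); b \<in> {..<n} \<rightarrow> carrier (A (\<alpha> \<otimes>\<^bsub>G\<^esub> \<beta>));
     (\<Oplus>\<^bsub>\<Gamma> (\<alpha> \<otimes>\<^bsub>G\<^esub> \<beta>)\<^esub>k\<in>{..<n}. lact (\<Gamma> (\<alpha> \<otimes>\<^bsub>G\<^esub> \<beta>)) (a k) (d (\<alpha> \<otimes>\<^bsub>G\<^esub> \<beta>) (b k)))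
       = \<zero>\<^bsub>\<Gamma> (\<alpha> \<otimes>\<^bsub>G\<^esub> \<beta>)\<^esub>\<rbrakk> \<Longrightarrow>
    (\<Oplus>\<^bsub>tensor K (\<Gamma> \<alpha>) (A \<beta>)\<^esub>k\<in>{..<n}.
        tensor_map2 K (\<Gamma> \<alpha>) (A \<beta>) (lact (\<Gamma> \<alpha>)) (mult (A \<beta>))
          (\<Delta> \<alpha> \<beta> (a k)) (tensor_map K (\<Gamma> \<alpha>) (A \<beta>) (d \<alpha>) id (\<Delta> \<alpha> \<beta> (b k))))
      = \<zero>\<^bsub>tensor K (\<Gamma> \<alpha>) (A \<beta>)\<^esub>"

locale bicovariant_fodc = left_covariant_fodc K G A \<Delta> \<Gamma> d + right_covariant_fodc K G A \<Delta> \<Gamma> d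
  for K :: "('k, 'm) ring_scheme" and G :: "('g, 'n) monoid_scheme"
    and A :: "'g \<Rightarrow> ('k, 'a) module"
    and \<Delta> :: "'g \<Rightarrow> 'g \<Rightarrow> 'a \<Rightarrow> ('k, 'a, 'a) tens"
    and \<Gamma> :: "'g \<Rightarrow> ('k, 'a, 'v) bimod"
    and d :: "'g \<Rightarrow> 'a \<Rightarrow> 'v"


section \<open>The calculus determined by a right ideal\<close>

text \<open>The bimodule \<open>B\<^sup>2 = ker (m : B \<otimes> B \<rightarrow> B)\<close> and the universal differential \<open>D : B \<rightarrow> B\<^sup>2\<close>.\<close>

definition universal_bimod ::
  "('k, 'm) ring_scheme \<Rightarrow> ('k, 'a) module \<Rightarrow> ('k, 'a, ('k, 'a, 'a) tens) bimod"
  where "universal_bimod K B =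
    \<lparr>carrier = {q \<in> carrier (tensor K B B). mult_map K B q = \<zero>\<^bsub>B\<^esub>},
     mult = undefined, one = undefined,
     zero = \<zero>\<^bsub>tensor K B B\<^esub>, add = add (tensor K B B), smult = smult (tensor K B B),
     lact = (\<lambda>c. tensor_map K B B (\<lambda>a. c \<otimes>\<^bsub>B\<^esub> a) id),
     ract = (\<lambda>q c. tensor_map K B B id (\<lambda>b. b \<otimes>\<^bsub>B\<^esub> c) q)\<rparr>"

definition universal_diff ::
  "('k, 'm) ring_scheme \<Rightarrow> ('k, 'a) module \<Rightarrow> 'a \<Rightarrow> ('k, 'a, 'a) tens"
  where "universal_diff K B b =
    pure_tensor K B B \<one>\<^bsub>B\<^esub> b \<ominus>\<^bsub>tensor K B B\<^esub> pure_tensor K B B b \<one>\<^bsub>B\<^esub>"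

context
  fixes K :: "('k, 'm) ring_scheme" and G :: "('g, 'n) monoid_scheme"
    and A :: "'g \<Rightarrow> ('k, 'a) module"
    and \<Delta> :: "'g \<Rightarrow> 'g \<Rightarrow> 'a \<Rightarrow> ('k, 'a, 'a) tens"
begin

definition r_map :: "'g \<Rightarrow> ('k, 'a, 'a) tens \<Rightarrow> ('k, 'a, 'a) tens"
  where "r_map \<alpha> = tensor_lift K (tensor K (A \<alpha>) (A \<one>\<^bsub>G\<^esub>)) (\<lambda>a b.
    pure_tensor K (A \<alpha>) (A \<one>\<^bsub>G\<^esub>) a \<one>\<^bsub>A \<one>\<^bsub>G\<^esub>\<^esub> \<otimes>\<^bsub>tensor_alg K (A \<alpha>) (A \<one>\<^bsub>G\<^esub>)\<^esub> \<Delta> \<alpha> \<one>\<^bsub>G\<^esub> b)"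

definition t_map :: "'g \<Rightarrow> ('k, 'a, 'a) tens \<Rightarrow> ('k, 'a, 'a) tens"
  where "t_map \<alpha> = tensor_lift K (tensor K (A \<one>\<^bsub>G\<^esub>) (A \<alpha>)) (\<lambda>a b.
    pure_tensor K (A \<one>\<^bsub>G\<^esub>) (A \<alpha>) \<one>\<^bsub>A \<one>\<^bsub>G\<^esub>\<^esub> a \<otimes>\<^bsub>tensor_alg K (A \<one>\<^bsub>G\<^esub>) (A \<alpha>)\<^esub> \<Delta> \<one>\<^bsub>G\<^esub> \<alpha> b)"

text \<open>In a Hopf group coalgebra \<open>r_map \<alpha>\<close> is a bijection from \<open>A \<alpha> \<otimes> A \<alpha>\<close> onto \<open>A \<alpha> \<otimes> A \<one>\<close>.\<close>

definition r_inv :: "'g \<Rightarrow> ('k, 'a, 'a) tens \<Rightarrow> ('k, 'a, 'a) tens"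
  where "r_inv \<alpha> = inv_into (carrier (tensor K (A \<alpha>) (A \<alpha>))) (r_map \<alpha>)"

definition ad :: "'g \<Rightarrow> 'a \<Rightarrow> ('k, 'a, 'a) tens"
  where "ad \<alpha> a = t_map \<alpha> (r_inv \<alpha> (pure_tensor K (A \<alpha>) (A \<one>\<^bsub>G\<^esub>) \<one>\<^bsub>A \<alpha>\<^esub> a))"

definition calculus_N :: "'a set \<Rightarrow> 'g \<Rightarrow> ('k, 'a, 'a) tens set"
  where "calculus_N R \<alpha> = r_inv \<alpha> ` tensor_sub K (A \<alpha>) (A \<one>\<^bsub>G\<^esub>) (carrier (A \<alpha>)) R"

definition calculus_bimod :: "'a set \<Rightarrow> 'g \<Rightarrow> ('k, 'a, ('k, 'a, 'a) tens set) bimod"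
  where "calculus_bimod R \<alpha> = quot_bimodule (universal_bimod K (A \<alpha>)) (calculus_N R \<alpha>)"

definition calculus_diff :: "'a set \<Rightarrow> 'g \<Rightarrow> 'a \<Rightarrow> ('k, 'a, 'a) tens set"
  where "calculus_diff R \<alpha> b =
    calculus_N R \<alpha> +>\<^bsub>universal_bimod K (A \<alpha>)\<^esub> universal_diff K (A \<alpha>) b"

text \<open>Invariance of \<open>R\<close> under the maps \<open>ad \<alpha> : A \<one> \<rightarrow> A \<one> \<otimes> A \<alpha>\<close>.\<close>

definition ad_invariant :: "'a set \<Rightarrow> bool"
  where "ad_invariant R \<longleftrightarrow> (\<forall>\<alpha>\<in>carrier G.
    ad \<alpha> ` R \<subseteq> tensor_sub K (A \<one>\<^bsub>G\<^esub>) (A \<alpha>) R (carrier (A \<alpha>)))"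

end

end

theory Submission
  imports Defs
begin

text \<open>
  Let \<open>\<omega>\<^sub>\<alpha> : A\<^sub>\<alpha> \<otimes> A\<^sub>\<alpha> \<rightarrow> \<Gamma>\<^sub>\<alpha>\<close>, \<open>a \<otimes> b \<mapsto> a d b\<close>; its kernel is
  \<open>N\<^sub>\<alpha> + A\<^sub>\<alpha> \<otimes> 1\<close>.  Coassociativity and multiplicativity of \<open>\<Delta>\<close> show that
  \<open>E (a \<otimes> b) = a\<^sub>1 b\<^sub>1 \<otimes> (a\<^sub>2 \<otimes> b\<^sub>2)\<close> satisfies \<open>(id \<otimes> r\<^sub>\<beta>) E = (\<Delta>\<^sub>\<alpha>\<^sub>,\<^sub>\<beta> \<otimes> id) r\<^sub>\<alpha>\<^sub>\<beta>\<close>, so that \<open>E\<close> maps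
  \<open>N\<^sub>\<alpha>\<^sub>\<beta>\<close> into \<open>A\<^sub>\<alpha> \<otimes> N\<^sub>\<beta>\<close>.  The map tested by left covariance is \<open>(id \<otimes> \<omega>\<^sub>\<beta>) E\<close>.  The one tested
  by right covariance factors through \<open>(id \<otimes> t\<^sub>\<beta>) E\<close>, followed by
  \<open>a \<otimes> (x \<otimes> c) \<mapsto> \<omega>\<^sub>\<alpha> (r\<^sub>\<alpha>\<inverse> (a \<otimes> x)) \<otimes> c\<close>; since \<open>t\<^sub>\<beta> (r\<^sub>\<beta>\<inverse> (a \<otimes> x)) = (1 \<otimes> a) ad\<^sub>\<beta> x\<close>, it vanishes
  on \<open>N\<^sub>\<alpha>\<^sub>\<beta>\<close> when \<open>ad\<^sub>\<beta> R \<subseteq> R \<otimes> A\<^sub>\<beta>\<close>.  Conversely, take \<open>\<alpha> = 1\<close>: applying \<open>a d b \<mapsto> \<epsilon> a (b - \<epsilon> b 1) + R\<close>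
  to the first factor in \<open>\<Gamma>\<^sub>1 \<otimes> A\<^sub>\<beta>\<close> turns the tested map into \<open>t\<^sub>\<beta> - 1 \<otimes> m\<^sub>\<beta>\<close> modulo \<open>R \<otimes> A\<^sub>\<beta>\<close>, whose
  value at \<open>r\<^sub>\<beta>\<inverse> (1 \<otimes> x)\<close> with \<open>x \<in> R\<close> is \<open>ad\<^sub>\<beta> x\<close>.  The antipode is needed only for the
  bijectivity of the maps \<open>r\<^sub>\<alpha>\<close>.
\<close>

section \<open>Linear and bilinear maps\<close>

text \<open>With tensors encoded as cosets there is no Sweedler notation:
  \<open>\<Delta> \<alpha> \<beta> b\<close> is not a pure tensor and has no canonical
  decomposition. Each Sweedler computation is therefore cut where coassociativity, multiplicativity,
  a counit or an antipode axiom enters. The pieces between the cuts are identities of linear or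
  bilinear maps in arbitrary tensors standing for the coproducts; they are checked on pure tensors
  and then instantiated. For right covariance the obstacle is that \<open>E\<close> has already
  multiplied \<open>a_1\<close> and \<open>b_1\<close>, while \<open>a_1 d b_1\<close> is needed.
  The extra leg produced by \<open>t\<close> repairs this, because
  \<open>a_1 b_1 \<otimes> b_2\<close> is \<open>r (a_1 \<otimes> b_1)\<close>. In the converse the
  first factor is evaluated with the counit, which exists on \<open>A_1\<close> only; hence the
  specialised index. The term \<open>\<epsilon> b 1\<close> comes from projecting
  \<open>a \<otimes> b\<close> to \<open>a D b\<close> first, and the result descends modulo
  \<open>R\<close> because composing \<open>\<epsilon> \<otimes> id\<close> with \<open>r\<close>
  does not change it.\<close>

lemma linear_mapsI:
  assumes "\<And>x. x \<in> carrier V \<Longrightarrow> f x \<in> carrier W"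
    and "\<And>x y. \<lbrakk>x \<in> carrier V; y \<in> carrier V\<rbrakk> \<Longrightarrow> f (x \<oplus>\<^bsub>V\<^esub> y) = f x \<oplus>\<^bsub>W\<^esub> f y"
    and "\<And>c x. \<lbrakk>c \<in> carrier K; x \<in> carrier V\<rbrakk> \<Longrightarrow> f (c \<odot>\<^bsub>V\<^esub> x) = c \<odot>\<^bsub>W\<^esub> f x"
  shows "f \<in> linear_maps K V W"
  using assms unfolding linear_maps_def by auto

lemma linear_mapsD:
  assumes "f \<in> linear_maps K V W"
  shows lin_closed: "x \<in> carrier V \<Longrightarrow> f x \<in> carrier W"
    and lin_add: "\<lbrakk>x \<in> carrier V; y \<in> carrier V\<rbrakk> \<Longrightarrow> f (x \<oplus>\<^bsub>V\<^esub> y) = f x \<oplus>\<^bsub>W\<^esub> f y"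
    and lin_smult: "\<lbrakk>c \<in> carrier K; x \<in> carrier V\<rbrakk> \<Longrightarrow> f (c \<odot>\<^bsub>V\<^esub> x) = c \<odot>\<^bsub>W\<^esub> f x"
  using assms unfolding linear_maps_def by auto

lemma lin_id: "id \<in> linear_maps K V V"
  by (simp add: linear_mapsI)

lemma lin_comp:
  assumes "f \<in> linear_maps K U V" "g \<in> linear_maps K V W"
  shows "(\<lambda>x. g (f x)) \<in> linear_maps K U W"
  by (rule linear_mapsI) (simp_all add: linear_mapsD[OF assms(1)] linear_mapsD[OF assms(2)])

text \<open>Maps given by \<open>inv_into\<close> or \<open>the_elem\<close> are controlled on the
  carrier only; this suffices for linearity because sums and multiples stay in the carrier.\<close>

lemma lin_cong:
  assumes "module K V" "f \<in> linear_maps K V W" "\<And>x. x \<in> carrier V \<Longrightarrow> g x = f x"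
  shows "g \<in> linear_maps K V W"
proof -
  interpret V: module K V by fact
  show ?thesis
    by (rule linear_mapsI) (simp_all add: assms(3) linear_mapsD[OF assms(2)])
qed

lemma abelian_group_hom_linear:
  assumes "module K V" "module K W" "f \<in> linear_maps K V W"
  shows "abelian_group_hom V W f"
proof -
  interpret V: module K V by fact
  interpret W: module K W by fact
  show ?thesis
    by (intro abelian_group_homI V.abelian_group_axioms W.abelian_group_axioms
        group_hom.intro group_hom_axioms.intro V.a_group W.a_group)
      (simp add: hom_def linear_mapsD[OF assms(3)])
qed

context
  fixes K V W f
  assumes V: "module K V" and W: "module K W" and f: "f \<in> linear_maps K V W"
begin

interpretation V: module K V by (rule V)
interpretation W: module K W by (rule W)
interpretation abelian_group_hom V W f by (rule abelian_group_hom_linear[OF V W f])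

lemma lin_zero: "f \<zero>\<^bsub>V\<^esub> = \<zero>\<^bsub>W\<^esub>"
  by (rule hom_zero)

lemma lin_uminus: "x \<in> carrier V \<Longrightarrow> f (\<ominus>\<^bsub>V\<^esub> x) = \<ominus>\<^bsub>W\<^esub> f x"
  by (rule hom_a_inv)

lemma lin_minus: "\<lbrakk>x \<in> carrier V; y \<in> carrier V\<rbrakk> \<Longrightarrow> f (x \<ominus>\<^bsub>V\<^esub> y) = f x \<ominus>\<^bsub>W\<^esub> f y"
  by (simp add: a_minus_def lin_uminus linear_mapsD[OF f])

lemma lin_finsum:
  assumes "finite I" "g \<in> I \<rightarrow> carrier V"
  shows "f (\<Oplus>\<^bsub>V\<^esub>i\<in>I. g i) = (\<Oplus>\<^bsub>W\<^esub>i\<in>I. f (g i))"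
  using assms
proof (induction I rule: finite_induct)
  case empty
  show ?case by (simp add: lin_zero)
next
  case (insert i I)
  then have "g i \<in> carrier V" "g \<in> I \<rightarrow> carrier V" by auto
  moreover have "(\<lambda>i. f (g i)) \<in> I \<rightarrow> carrier W" "f (g i) \<in> carrier W"
    using calculation lin_closed[OF f] by (auto simp: Pi_def)
  ultimately show ?case
    using insert by (simp add: linear_mapsD[OF f] V.finsum_closed)
qed

lemma submodule_preimage:
  assumes "submodule H K W"
  shows "submodule {x \<in> carrier V. f x \<in> H} K V"
  using W.submoduleE[OF assms] submodule.axioms(1)[OF assms]
  by (intro V.submoduleI)
    (auto simp: lin_uminus linear_mapsD[OF f] lin_zero dest: subgroup.one_closed)

text \<open>The span is an intersection of submodules, and the preimage of \<open>H\<close> is one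
  of those being intersected. This takes the place of an induction over linear combinations.\<close>

lemma lin_span_image:
  assumes "submodule H K W" "S \<subseteq> carrier V" "\<And>s. s \<in> S \<Longrightarrow> f s \<in> H" "x \<in> lin_span K V S"
  shows "f x \<in> H"
proof -
  have "S \<subseteq> {x \<in> carrier V. f x \<in> H}" using assms by auto
  then show ?thesis
    using assms(4) submodule_preimage[OF assms(1)] unfolding lin_span_def by blast
qed

lemma lin_add_fun:
  assumes g: "g \<in> linear_maps K V W"
  shows "(\<lambda>x. f x \<oplus>\<^bsub>W\<^esub> g x) \<in> linear_maps K V W"
  by (rule linear_mapsI)
    (simp_all add: linear_mapsD[OF f] linear_mapsD[OF g] W.a_ac W.smult_r_distr)

lemma lin_uminus_fun: "(\<lambda>x. \<ominus>\<^bsub>W\<^esub> f x) \<in> linear_maps K V W"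
  by (rule linear_mapsI)
    (simp_all add: linear_mapsD[OF f] W.minus_add W.smult_r_minus)

lemma lin_smult_fun: 
  assumes "c \<in> carrier K"
  shows "(\<lambda>x. c \<odot>\<^bsub>W\<^esub> f x) \<in> linear_maps K V W"
  using assms by (intro linear_mapsI)
    (simp_all add: linear_mapsD[OF f] W.smult_r_distr W.smult_assoc1[symmetric] V.R.m_comm)

end

lemma lin_minus_fun:
  assumes "module K V" "module K W" "f \<in> linear_maps K V W" "g \<in> linear_maps K V W"
  shows "(\<lambda>x. f x \<ominus>\<^bsub>W\<^esub> g x) \<in> linear_maps K V W"
  unfolding a_minus_def
  by (rule lin_add_fun[OF assms(1-3) lin_uminus_fun[OF assms(1,2,4)]])

lemma lin_zero_fun:
  assumes "module K W"
  shows "(\<lambda>x. \<zero>\<^bsub>W\<^esub>) \<in> linear_maps K V W"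
proof -
  interpret W: module K W by fact
  show ?thesis by (rule linear_mapsI) auto
qed

lemma submodule_zero:
  assumes "module K V"
  shows "submodule {\<zero>\<^bsub>V\<^esub>} K V"
proof -
  interpret V: module K V by fact
  show ?thesis by (rule V.submoduleI) auto
qed

lemma lin_span_submodule:
  assumes "module K V" "S \<subseteq> carrier V"
  shows "submodule (lin_span K V S) K V"
proof -
  interpret V: module K V by fact
  note E = V.submoduleE
  have z: "\<zero>\<^bsub>V\<^esub> \<in> H" if "submodule H K V" for H
    using submodule.axioms(1)[OF that] by (auto dest: subgroup.one_closed)
  show ?thesis
  proof (rule V.submoduleI)
    show "lin_span K V S \<subseteq> carrier V"
      unfolding lin_span_def using V.carrier_is_submodule assms(2) by blast
  qed (auto simp: lin_span_def z E)
qed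

lemma lin_span_incl: "S \<subseteq> lin_span K V S"
  unfolding lin_span_def by auto

lemma (in module) submodule_closedI:
  assumes "H \<subseteq> carrier M" "\<zero>\<^bsub>M\<^esub> \<in> H"
    and "\<And>x y. \<lbrakk>x \<in> H; y \<in> H\<rbrakk> \<Longrightarrow> x \<oplus>\<^bsub>M\<^esub> y \<in> H"
    and "\<And>c x. \<lbrakk>c \<in> carrier R; x \<in> H\<rbrakk> \<Longrightarrow> c \<odot>\<^bsub>M\<^esub> x \<in> H"
  shows "submodule H R M"
proof (rule submoduleI)
  fix x assume x: "x \<in> H"
  then have "\<ominus>\<^bsub>M\<^esub> x = (\<ominus> \<one>) \<odot>\<^bsub>M\<^esub> x"
    using assms(1) by (subst smult_l_minus) auto
  then show "\<ominus>\<^bsub>M\<^esub> x \<in> H" using assms(4)[of "\<ominus> \<one>" x] x by simp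
qed (use assms in auto)

text \<open>Bilinearity is expressed through the two families of partial maps, so that each of them
  can be passed directly to the composition rules for \<open>linear_maps\<close>.\<close>

definition bilinear_maps ::
  "('k, 'm) ring_scheme \<Rightarrow> ('k, 'v, 'x) module_scheme \<Rightarrow> ('k, 'w, 'y) module_scheme
    \<Rightarrow> ('k, 'p, 'z) module_scheme \<Rightarrow> ('v \<Rightarrow> 'w \<Rightarrow> 'p) set"
  where "bilinear_maps K V W P = {h. (\<forall>v\<in>carrier V. h v \<in> linear_maps K W P)
    \<and> (\<forall>w\<in>carrier W. (\<lambda>v. h v w) \<in> linear_maps K V P)}"

lemma bilinear_mapsI:
  assumes "\<And>v. v \<in> carrier V \<Longrightarrow> h v \<in> linear_maps K W P"
    and "\<And>w. w \<in> carrier W \<Longrightarrow> (\<lambda>v. h v w) \<in> linear_maps K V P"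
  shows "h \<in> bilinear_maps K V W P"
  using assms unfolding bilinear_maps_def by auto

lemma bilinear_mapsD:
  assumes "h \<in> bilinear_maps K V W P"
  shows bil_right: "v \<in> carrier V \<Longrightarrow> h v \<in> linear_maps K W P"
    and bil_left: "w \<in> carrier W \<Longrightarrow> (\<lambda>v. h v w) \<in> linear_maps K V P"
  using assms unfolding bilinear_maps_def by auto

lemma bil_closed:
  "\<lbrakk>h \<in> bilinear_maps K V W P; v \<in> carrier V; w \<in> carrier W\<rbrakk> \<Longrightarrow> h v w \<in> carrier P"
  by (meson bil_right lin_closed)

text \<open>The general closure rule: most bilinearity claims below arise from a multiplication, an
  action or \<open>pure_tensor\<close> by composing with linear maps in both arguments and in the
  value.\<close>

lemma bil_comp:
  assumes "h \<in> bilinear_maps K V W P"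
    and "f \<in> linear_maps K V' V" "g \<in> linear_maps K W' W" "k \<in> linear_maps K P P'"
  shows "(\<lambda>v w. k (h (f v) (g w))) \<in> bilinear_maps K V' W' P'"
proof (rule bilinear_mapsI)
  fix v assume "v \<in> carrier V'"
  then have "f v \<in> carrier V" by (rule lin_closed[OF assms(2)])
  from lin_comp[OF lin_comp[OF assms(3) bil_right[OF assms(1) this]] assms(4)]
  show "(\<lambda>w. k (h (f v) (g w))) \<in> linear_maps K W' P'" .
next
  fix w assume "w \<in> carrier W'"
  then have "g w \<in> carrier W" by (rule lin_closed[OF assms(3)])
  from lin_comp[OF lin_comp[OF assms(2) bil_left[OF assms(1) this]] assms(4)]
  show "(\<lambda>v. k (h (f v) (g w))) \<in> linear_maps K V' P'" .
qed

lemma bil_pre: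
  assumes "h \<in> bilinear_maps K V W P" "f \<in> linear_maps K V' V" "g \<in> linear_maps K W' W"
  shows "(\<lambda>v w. h (f v) (g w)) \<in> bilinear_maps K V' W' P"
  using bil_comp[OF assms lin_id] by simp

lemma bil_post:
  assumes "h \<in> bilinear_maps K V W P" "k \<in> linear_maps K P P'"
  shows "(\<lambda>v w. k (h v w)) \<in> bilinear_maps K V W P'"
  using bil_comp[OF assms(1) lin_id lin_id assms(2)] by simp


lemma bil_flip:
  assumes "h \<in> bilinear_maps K V W P"
  shows "(\<lambda>w v. h v w) \<in> bilinear_maps K W V P"
  by (rule bilinear_mapsI) (rule bil_left[OF assms], assumption, rule bil_right[OF assms])


section \<open>Quotient modules\<close>

text \<open>\<open>Q\<close> is a parameter described by four of its fields, so that the same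
  results serve \<open>quot_module\<close> and, with its additional action fields,
  \<open>quot_bimodule\<close>.\<close>

locale quotient_space = V: module K V + submodule N K V
  for K :: "('k, 'm) ring_scheme" and V :: "('k, 'v, 'x) module_scheme" and N +
  fixes Q :: "('k, 'v set, 'y) module_scheme"
  assumes carrier_Q: "carrier Q = a_rcosets\<^bsub>V\<^esub> N"
    and zero_Q: "\<zero>\<^bsub>Q\<^esub> = N"
    and add_Q: "add Q = set_add V"
    and smult_Q: "smult Q = (\<lambda>c X. \<Union>x\<in>X. N +>\<^bsub>V\<^esub> (c \<odot>\<^bsub>V\<^esub> x))"
begin

sublocale sub: abelian_subgroup N V
  by (intro abelian_subgroupI3 additive_subgroup.intro subgroup_axioms V.abelian_group_axioms)

abbreviation proj :: "'v \<Rightarrow> 'v set"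
  where "proj x \<equiv> N +>\<^bsub>V\<^esub> x"

lemma carrier_Q_image: "carrier Q = proj ` carrier V"
  unfolding carrier_Q A_RCOSETS_def' by auto

lemma carrier_QE:
  assumes "X \<in> carrier Q"
  obtains x where "x \<in> carrier V" "X = proj x"
  using assms unfolding carrier_Q_image by auto

lemma proj_closed: "x \<in> carrier V \<Longrightarrow> proj x \<in> carrier Q"
  unfolding carrier_Q_image by auto

lemma proj_add: "\<lbrakk>x \<in> carrier V; y \<in> carrier V\<rbrakk> \<Longrightarrow> proj (x \<oplus>\<^bsub>V\<^esub> y) = proj x \<oplus>\<^bsub>Q\<^esub> proj y"
  by (simp add: add_Q sub.a_rcos_sum)

lemma rep_carrier: "\<lbrakk>x \<in> carrier V; y \<in> proj x\<rbrakk> \<Longrightarrow> y \<in> carrier V"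
  by (rule sub.a_elemrcos_carrier)

lemma rep_proj: "\<lbrakk>x \<in> carrier V; y \<in> proj x\<rbrakk> \<Longrightarrow> proj y = proj x"
  by (rule sub.a_repr_independence'[symmetric])

lemma proj_eq_iff:
  assumes "x \<in> carrier V" "y \<in> carrier V"
  shows "proj x = proj y \<longleftrightarrow> x \<ominus>\<^bsub>V\<^esub> y \<in> N"
proof
  assume "proj x = proj y"
  then have "x \<in> proj y" using sub.a_rcos_self[OF assms(1)] by simp
  then show "x \<ominus>\<^bsub>V\<^esub> y \<in> N"
    unfolding a_minus_def by (rule sub.a_rcos_module_imp[OF assms(2)])
next
  assume "x \<ominus>\<^bsub>V\<^esub> y \<in> N"
  then have "x \<in> proj y"
    unfolding a_minus_def by (rule sub.a_rcos_module_rev[OF assms(2,1)])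
  then show "proj x = proj y" by (rule rep_proj[OF assms(2)])
qed

lemma proj_eq_zero_iff:
  assumes "x \<in> carrier V"
  shows "proj x = \<zero>\<^bsub>Q\<^esub> \<longleftrightarrow> x \<in> N"
  using sub.a_rcos_self[OF assms] sub.a_rcos_const[of x] by (auto simp: zero_Q)

lemma rep_diff: "\<lbrakk>x \<in> carrier V; y \<in> proj x\<rbrakk> \<Longrightarrow> y \<ominus>\<^bsub>V\<^esub> x \<in> N"
  using proj_eq_iff[of y x] rep_carrier[of x y] rep_proj[of x y] by blast

text \<open>The union over all representatives collapses to a single coset, since
  \<open>c y - c x = c (y - x)\<close> stays in \<open>N\<close>.\<close>

lemma proj_smult:
  assumes c: "c \<in> carrier K" and x: "x \<in> carrier V"
  shows "proj (c \<odot>\<^bsub>V\<^esub> x) = c \<odot>\<^bsub>Q\<^esub> proj x"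
proof -
  have "proj (c \<odot>\<^bsub>V\<^esub> y) = proj (c \<odot>\<^bsub>V\<^esub> x)" if "y \<in> proj x" for y
  proof -
    have y: "y \<in> carrier V" "y \<ominus>\<^bsub>V\<^esub> x \<in> N"
      using rep_carrier[OF x that] rep_diff[OF x that] by auto
    have "c \<odot>\<^bsub>V\<^esub> y \<ominus>\<^bsub>V\<^esub> c \<odot>\<^bsub>V\<^esub> x = c \<odot>\<^bsub>V\<^esub> (y \<ominus>\<^bsub>V\<^esub> x)"
      using c x y(1) by (simp add: a_minus_def V.smult_r_distr V.smult_r_minus)
    then have "c \<odot>\<^bsub>V\<^esub> y \<ominus>\<^bsub>V\<^esub> c \<odot>\<^bsub>V\<^esub> x \<in> N"
      using smult_closed[OF c y(2)] by simp
    then show ?thesis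
      using proj_eq_iff c x y(1) V.smult_closed by blast
  qed
  moreover have "x \<in> proj x" by (rule sub.a_rcos_self[OF x])
  ultimately show ?thesis unfolding smult_Q by blast
qed

lemma module_Q: "module K Q"
proof (rule moduleI)
  show "abelian_group Q"
  proof (rule abelian_groupI)
    have "proj \<zero>\<^bsub>V\<^esub> = \<zero>\<^bsub>Q\<^esub>" by (simp add: proj_eq_zero_iff)
    then show "\<zero>\<^bsub>Q\<^esub> \<in> carrier Q"
      using proj_closed[OF V.zero_closed] by simp
    show "\<exists>Y\<in>carrier Q. Y \<oplus>\<^bsub>Q\<^esub> X = \<zero>\<^bsub>Q\<^esub>" if "X \<in> carrier Q" for X
    proof -
      obtain x where x: "x \<in> carrier V" "X = proj x" using \<open>X \<in> carrier Q\<close> by (rule carrier_QE)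
      have "proj (\<ominus>\<^bsub>V\<^esub> x) \<oplus>\<^bsub>Q\<^esub> X = \<zero>\<^bsub>Q\<^esub>"
        using x by (simp add: proj_add[symmetric] V.l_neg zero_Q V.a_coset_add_zero[OF sub.a_subset])
      then show ?thesis using x proj_closed by blast
    qed
    show "\<zero>\<^bsub>Q\<^esub> \<oplus>\<^bsub>Q\<^esub> X = X" if "X \<in> carrier Q" for X
    proof -
      obtain x where x: "x \<in> carrier V" "X = proj x" using \<open>X \<in> carrier Q\<close> by (rule carrier_QE)
      have "\<zero>\<^bsub>Q\<^esub> = proj \<zero>\<^bsub>V\<^esub>" by (simp add: zero_Q V.a_coset_add_zero[OF sub.a_subset])
      then show ?thesis using x by (simp add: proj_add[symmetric])
    qed
  qed (auto elim!: carrier_QE simp: proj_closed proj_add[symmetric] V.a_ac)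
  show "cring K" by (rule V.R.cring_axioms)
qed (auto elim!: carrier_QE simp: proj_closed proj_add[symmetric] proj_smult[symmetric]
      V.smult_l_distr V.smult_r_distr V.smult_assoc1)

lemma proj_linear: "proj \<in> linear_maps K V Q"
  by (rule linear_mapsI) (simp_all add: proj_closed proj_add proj_smult)

text \<open>A linear map that vanishes on \<open>N\<close> is constant on cosets, so the image of a
  coset is a singleton and \<open>the_elem\<close> returns its value.\<close>

lemma lift_proj:
  assumes "module K P" "f \<in> linear_maps K V P" "\<And>n. n \<in> N \<Longrightarrow> f n = \<zero>\<^bsub>P\<^esub>" "x \<in> carrier V"
  shows "the_elem (f ` proj x) = f x"
proof -
  interpret P: module K P by fact
  have "f y = f x" if "y \<in> proj x" for y
  proof -
    have y: "y \<in> carrier V" "y \<ominus>\<^bsub>V\<^esub> x \<in> N"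
      using rep_carrier[OF assms(4) that] rep_diff[OF assms(4) that] by auto
    have "f y \<ominus>\<^bsub>P\<^esub> f x = \<zero>\<^bsub>P\<^esub>"
      using lin_minus[OF V.module_axioms assms(1,2) y(1) assms(4)] assms(3)[OF y(2)] by simp
    then show ?thesis
      using lin_closed[OF assms(2)] y(1) assms(4) P.add.inv_closed P.minus_equality
      by (metis a_minus_def P.minus_minus)
  qed
  moreover have "x \<in> proj x" using assms sub.a_rcos_self by simp
  ultimately have "f ` proj x = {f x}" by blast
  then show ?thesis by simp
qed

lemma lift_linear:
  assumes "module K P" "f \<in> linear_maps K V P" "\<And>n. n \<in> N \<Longrightarrow> f n = \<zero>\<^bsub>P\<^esub>"
  shows "(\<lambda>X. the_elem (f ` X)) \<in> linear_maps K Q P"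
  by (rule linear_mapsI)
    (auto elim!: carrier_QE simp: proj_add[symmetric] proj_smult[symmetric] lift_proj[OF assms]
      linear_mapsD[OF assms(2)])

end

lemma quotient_space_quot_module:
  assumes "module K V" "submodule N K V"
  shows "quotient_space K V N (quot_module V N)"
  using assms
  by (auto simp: quotient_space_def quotient_space_axioms_def quot_module_def)

text \<open>The actions on \<open>quot_bimodule\<close> are unions over representatives; for an
  action that preserves \<open>N\<close> all members of the union are the same coset.\<close>

lemma (in quotient_space) proj_union:
  assumes f: "f \<in> linear_maps K V V" and N: "\<And>n. n \<in> N \<Longrightarrow> f n \<in> N" and x: "x \<in> carrier V"
  shows "(\<Union>y\<in>proj x. proj (f y)) = proj (f x)"
proof -
  have "proj (f y) = proj (f x)" if "y \<in> proj x" for y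
  proof -
    have y: "y \<in> carrier V" "y \<ominus>\<^bsub>V\<^esub> x \<in> N"
      using rep_carrier[OF x that] rep_diff[OF x that] by auto
    have "f y \<ominus>\<^bsub>V\<^esub> f x \<in> N"
      using N[OF y(2)] lin_minus[OF V.module_axioms V.module_axioms f y(1) x] by simp
    then show ?thesis
      using proj_eq_iff lin_closed[OF f] y(1) x by blast
  qed
  moreover have "x \<in> proj x" by (rule sub.a_rcos_self[OF x])
  ultimately show ?thesis by blast
qed

lemma quotient_space_quot_bimodule:
  assumes "module K V" "submodule N K V"
  shows "quotient_space K V N (quot_bimodule V N)"
  using assms
  by (auto simp: quotient_space_def quotient_space_axioms_def quot_bimodule_def)

lemma bimodule_quot_bimodule:
  assumes "bimodule K A V" and N: "submodule N K V"
    and lN: "\<And>a n. \<lbrakk>a \<in> carrier A; n \<in> N\<rbrakk> \<Longrightarrow> lact V a n \<in> N"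
    and rN: "\<And>a n. \<lbrakk>a \<in> carrier A; n \<in> N\<rbrakk> \<Longrightarrow> ract V n a \<in> N"
  shows "bimodule K A (quot_bimodule V N)"
    and "\<And>a x. \<lbrakk>a \<in> carrier A; x \<in> carrier V\<rbrakk> \<Longrightarrow>
      lact (quot_bimodule V N) a (N +>\<^bsub>V\<^esub> x) = N +>\<^bsub>V\<^esub> lact V a x"
    and "\<And>a x. \<lbrakk>a \<in> carrier A; x \<in> carrier V\<rbrakk> \<Longrightarrow>
      ract (quot_bimodule V N) (N +>\<^bsub>V\<^esub> x) a = N +>\<^bsub>V\<^esub> ract V x a"
proof -
  interpret V: bimodule K A V by fact
  let ?Q = "quot_bimodule V N"
  interpret Q: quotient_space K V N ?Q
    by (rule quotient_space_quot_bimodule[OF V.V.module_axioms N])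
  have l: "lact ?Q a (Q.proj x) = Q.proj (lact V a x)" if "a \<in> carrier A" "x \<in> carrier V" for a x
  proof -
    have "(\<lambda>x. lact V a x) \<in> linear_maps K V V"
      using that by (intro linear_mapsI) (simp_all add: V.lact_closed V.lact_add_right V.lact_smult_right)
    from Q.proj_union[OF this lN[OF that(1)] that(2)] show ?thesis
      by (simp add: quot_bimodule_def)
  qed
  have r: "ract ?Q (Q.proj x) a = Q.proj (ract V x a)" if "a \<in> carrier A" "x \<in> carrier V" for a x
  proof -
    have "(\<lambda>x. ract V x a) \<in> linear_maps K V V"
      using that by (intro linear_mapsI) (simp_all add: V.ract_closed V.ract_add_left V.ract_smult_left)
    from Q.proj_union[OF this rN[OF that(1)] that(2)] show ?thesis
      by (simp add: quot_bimodule_def)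
  qed
  show "\<And>a x. \<lbrakk>a \<in> carrier A; x \<in> carrier V\<rbrakk> \<Longrightarrow> lact ?Q a (Q.proj x) = Q.proj (lact V a x)"
    by (rule l)
  show "\<And>a x. \<lbrakk>a \<in> carrier A; x \<in> carrier V\<rbrakk> \<Longrightarrow> ract ?Q (Q.proj x) a = Q.proj (ract V x a)"
    by (rule r)
  note closed = V.lact_closed V.ract_closed V.alg.a_closed V.alg.smult_closed V.alg.m_closed
    V.alg.one_closed V.V.a_closed V.V.smult_closed
  note s = l r Q.proj_add[symmetric] Q.proj_smult[symmetric] Q.proj_closed closed
  show "bimodule K A ?Q"
  \<comment> \<open>After choosing representatives, each bimodule axiom is the image under the
    projection of the same axiom for \<open>V\<close>.\<close>
  proof (intro bimodule.intro bimodule_axioms.intro V.alg.assoc_algebra_axioms Q.module_Q; elim Q.carrier_QE; hypsubst)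
  qed (simp_all only: s V.lact_add_left V.lact_add_right V.lact_smult_left V.lact_smult_right
      V.ract_add_left V.ract_add_right V.ract_smult_left V.ract_smult_right
      V.lact_one V.ract_one V.lact_mult V.ract_mult V.lact_ract)
qed


section \<open>Free modules\<close>

context cring
begin

lemma free_carrier_iff:
  "f \<in> carrier (free_module R X) \<longleftrightarrow>
    (\<forall>x. f x \<in> carrier R) \<and> finite {x. f x \<noteq> \<zero>} \<and> {x. f x \<noteq> \<zero>} \<subseteq> X"
  by (auto simp: free_module_def)

lemma free_zero: "\<zero>\<^bsub>free_module R X\<^esub> = (\<lambda>x. \<zero>)"
  and free_add: "f \<oplus>\<^bsub>free_module R X\<^esub> g = (\<lambda>x. f x \<oplus> g x)"
  and free_smult: "c \<odot>\<^bsub>free_module R X\<^esub> f = (\<lambda>x. c \<otimes> f x)"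
  by (simp_all add: free_module_def)

lemma free_carrierI:
  assumes "\<And>x. f x \<in> carrier R" "finite S" "S \<subseteq> X" "\<And>x. x \<notin> S \<Longrightarrow> f x = \<zero>"
  shows "f \<in> carrier (free_module R X)"
proof -
  have "{x. f x \<noteq> \<zero>} \<subseteq> S" using assms(4) by auto
  then show ?thesis
    unfolding free_carrier_iff using assms finite_subset by blast
qed

lemma free_add_closed:
  assumes "f \<in> carrier (free_module R X)" "g \<in> carrier (free_module R X)"
  shows "(\<lambda>x. f x \<oplus> g x) \<in> carrier (free_module R X)"
  using assms unfolding free_carrier_iff[of f] free_carrier_iff[of g]
  by (intro free_carrierI[where S = "{x. f x \<noteq> \<zero>} \<union> {x. g x \<noteq> \<zero>}"]) auto

lemma free_smult_closed:
  assumes "c \<in> carrier R" "f \<in> carrier (free_module R X)"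
  shows "(\<lambda>x. c \<otimes> f x) \<in> carrier (free_module R X)"
  using assms unfolding free_carrier_iff[of f]
  by (intro free_carrierI[where S = "{x. f x \<noteq> \<zero>}"]) auto

lemma module_free: "module R (free_module R X)"
proof (rule moduleI)
  show "abelian_group (free_module R X)"
  proof (rule abelian_groupI, goal_cases)
    case (6 f)
    then have "(\<lambda>x. \<ominus> f x) \<in> carrier (free_module R X)"
      unfolding free_carrier_iff[of f]
      by (intro free_carrierI[where S = "{x. f x \<noteq> \<zero>}"]) auto
    moreover have "(\<lambda>x. \<ominus> f x) \<oplus>\<^bsub>free_module R X\<^esub> f = \<zero>\<^bsub>free_module R X\<^esub>"
      using 6 by (simp add: free_carrier_iff free_add free_zero l_neg)
    ultimately show ?case by blast
  qed (simp_all add: free_add free_zero free_add_closed,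
      simp_all add: free_carrier_iff a_ac)
qed (simp_all add: free_add free_smult free_smult_closed cring_axioms,
    simp_all add: free_carrier_iff l_distr r_distr m_assoc)

lemma free_gen_closed: "x \<in> X \<Longrightarrow> free_gen R x \<in> carrier (free_module R X)"
  by (rule free_carrierI[where S = "{x}"]) (auto simp: free_gen_def)

lemma free_induct [consumes 1, case_names zero add_gen]:
  assumes "f \<in> carrier (free_module R X)"
    and "P (\<lambda>x. \<zero>)"
    and "\<And>g c x. \<lbrakk>g \<in> carrier (free_module R X); P g; c \<in> carrier R; x \<in> X\<rbrakk> \<Longrightarrow>
      P (g \<oplus>\<^bsub>free_module R X\<^esub> c \<odot>\<^bsub>free_module R X\<^esub> free_gen R x)"
  shows "P f"
proof -
  \<comment> \<open>The induction runs over a finite set containing the support rather than over the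
    support itself, because the value at the removed point may be zero.\<close>
  have "P f" if "finite S" "S \<subseteq> X" "\<And>x. f x \<in> carrier R" "\<And>x. x \<notin> S \<Longrightarrow> f x = \<zero>" for S f
    using that
  proof (induction S arbitrary: f rule: finite_induct)
    case empty
    then have "f = (\<lambda>x. \<zero>)" by auto
    then show ?case using assms(2) by simp
  next
    case (insert y S)
    define g where "g = f(y := \<zero>)"
    have "g \<in> carrier (free_module R X)"
      using insert by (intro free_carrierI[where S = S]) (auto simp: g_def)
    moreover have "P g"
      using insert by (intro insert.IH) (auto simp: g_def)
    moreover have "f = g \<oplus>\<^bsub>free_module R X\<^esub> f y \<odot>\<^bsub>free_module R X\<^esub> free_gen R y"
      using insert.prems by (auto simp: g_def free_add free_smult free_gen_def fun_eq_iff)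
    ultimately show ?case
      using assms(3)[of g "f y" y] insert.prems by auto
  qed
  then show ?thesis
    using assms(1) unfolding free_carrier_iff by blast
qed

text \<open>The support of a sum or multiple can be smaller than expected; comparing linear
  extensions over a common finite set avoids distinguishing cases.\<close>

lemma free_lift_superset:
  assumes "module R P" "h \<in> X \<rightarrow> carrier P" "f \<in> carrier (free_module R X)"
    and "finite S" "{x. f x \<noteq> \<zero>} \<subseteq> S" "S \<subseteq> X"
  shows "(\<Oplus>\<^bsub>P\<^esub>x\<in>{x. f x \<noteq> \<zero>}. f x \<odot>\<^bsub>P\<^esub> h x) = (\<Oplus>\<^bsub>P\<^esub>x\<in>S. f x \<odot>\<^bsub>P\<^esub> h x)"
proof -
  interpret P: module R P by fact
  have h: "h x \<in> carrier P" if "x \<in> S" for x using assms that by auto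
  have "f x \<odot>\<^bsub>P\<^esub> h x \<in> carrier P" if "x \<in> S" for x
    using assms(3) h[OF that] by (simp add: free_carrier_iff)
  moreover have "f x \<odot>\<^bsub>P\<^esub> h x = \<zero>\<^bsub>P\<^esub>" if "x \<in> S - {x. f x \<noteq> \<zero>}" for x
    using that h by auto
  ultimately show ?thesis
    using assms by (intro P.add.finprod_mono_neutral_cong_left) auto
qed

lemma free_lift_linear:
  assumes "module R P" "h \<in> X \<rightarrow> carrier P"
  shows "(\<lambda>f. \<Oplus>\<^bsub>P\<^esub>x\<in>{x. f x \<noteq> \<zero>}. f x \<odot>\<^bsub>P\<^esub> h x) \<in> linear_maps R (free_module R X) P"
proof (rule linear_mapsI)
  interpret P: module R P by fact
  let ?l = "\<lambda>f. \<Oplus>\<^bsub>P\<^esub>x\<in>{x. f x \<noteq> \<zero>}. f x \<odot>\<^bsub>P\<^esub> h x"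
  have h: "h x \<in> carrier P" if "x \<in> X" for x using assms(2) that by auto
  have cl: "f x \<odot>\<^bsub>P\<^esub> h x \<in> carrier P" if "x \<in> X" "f \<in> carrier (free_module R X)" for f x
    using h that by (auto simp: free_carrier_iff)
  show "?l f \<in> carrier P" if f: "f \<in> carrier (free_module R X)" for f
    using f by (intro P.finsum_closed) (auto intro!: cl simp: free_carrier_iff)
  show "?l (f \<oplus>\<^bsub>free_module R X\<^esub> g) = ?l f \<oplus>\<^bsub>P\<^esub> ?l g"
    if f: "f \<in> carrier (free_module R X)" and g: "g \<in> carrier (free_module R X)" for f g
  proof -
    let ?S = "{x. f x \<noteq> \<zero>} \<union> {x. g x \<noteq> \<zero>}"
    have S: "finite ?S" "?S \<subseteq> X" "\<And>x. f x \<in> carrier R" "\<And>x. g x \<in> carrier R"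
      using f g by (auto simp: free_carrier_iff)
    have fg: "(\<lambda>x. f x \<oplus> g x) \<in> carrier (free_module R X)"
      by (rule free_add_closed[OF f g])
    have "?l (f \<oplus>\<^bsub>free_module R X\<^esub> g) = (\<Oplus>\<^bsub>P\<^esub>x\<in>?S. (f x \<oplus> g x) \<odot>\<^bsub>P\<^esub> h x)"
      unfolding free_add using S by (intro free_lift_superset[OF assms fg]) auto
    also have "\<dots> = (\<Oplus>\<^bsub>P\<^esub>x\<in>?S. f x \<odot>\<^bsub>P\<^esub> h x \<oplus>\<^bsub>P\<^esub> g x \<odot>\<^bsub>P\<^esub> h x)"
      using S(2) h by (intro P.finsum_cong') (auto simp: P.smult_l_distr S(3,4) subset_iff)
    also have "\<dots> = (\<Oplus>\<^bsub>P\<^esub>x\<in>?S. f x \<odot>\<^bsub>P\<^esub> h x) \<oplus>\<^bsub>P\<^esub> (\<Oplus>\<^bsub>P\<^esub>x\<in>?S. g x \<odot>\<^bsub>P\<^esub> h x)"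
      using S(2) cl f g by (intro P.finsum_addf) blast+
    also have "\<dots> = ?l f \<oplus>\<^bsub>P\<^esub> ?l g"
      using free_lift_superset[OF assms f S(1) _ S(2)] free_lift_superset[OF assms g S(1) _ S(2)]
      by simp
    finally show ?thesis .
  qed
  show "?l (c \<odot>\<^bsub>free_module R X\<^esub> f) = c \<odot>\<^bsub>P\<^esub> ?l f"
    if c: "c \<in> carrier R" and f: "f \<in> carrier (free_module R X)" for c f
  proof -
    let ?S = "{x. f x \<noteq> \<zero>}"
    have S: "finite ?S" "?S \<subseteq> X" "\<And>x. f x \<in> carrier R"
      using f by (auto simp: free_carrier_iff)
    have "?l (c \<odot>\<^bsub>free_module R X\<^esub> f) = (\<Oplus>\<^bsub>P\<^esub>x\<in>?S. (c \<otimes> f x) \<odot>\<^bsub>P\<^esub> h x)"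
      unfolding free_smult using S c
      by (intro free_lift_superset[OF assms free_smult_closed[OF c f]]) auto
    also have "\<dots> = (\<Oplus>\<^bsub>P\<^esub>x\<in>?S. c \<odot>\<^bsub>P\<^esub> (f x \<odot>\<^bsub>P\<^esub> h x))"
      using S(2) h c by (intro P.finsum_cong') (auto simp: P.smult_assoc1 S(3) subset_iff)
    also have "\<dots> = c \<odot>\<^bsub>P\<^esub> ?l f"
      using S(2) cl f by (intro P.finsum_smult_ldistr[symmetric] S(1) c) blast
    finally show ?thesis .
  qed
qed

lemma free_lift_gen:
  assumes "module R P" "h \<in> X \<rightarrow> carrier P" "y \<in> X"
  shows "(\<Oplus>\<^bsub>P\<^esub>x\<in>{x. free_gen R y x \<noteq> \<zero>}. free_gen R y x \<odot>\<^bsub>P\<^esub> h x) = h y"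
proof -
  interpret P: module R P by fact
  have hy: "h y \<in> carrier P" using assms by auto
  have "(\<Oplus>\<^bsub>P\<^esub>x\<in>{x. free_gen R y x \<noteq> \<zero>}. free_gen R y x \<odot>\<^bsub>P\<^esub> h x)
      = (\<Oplus>\<^bsub>P\<^esub>x\<in>{y}. free_gen R y x \<odot>\<^bsub>P\<^esub> h x)"
    using assms(3)
    by (intro free_lift_superset[OF assms(1,2) free_gen_closed]) (auto simp: free_gen_def)
  also have "\<dots> = h y" using hy by (simp add: free_gen_def)
  finally show ?thesis .
qed


section \<open>Tensor products\<close>

context
  fixes V :: "('a, 'v, 'x) module_scheme" and W :: "('a, 'w, 'y) module_scheme"
  assumes V: "module R V" and W: "module R W"
begin

interpretation V: module R V by (rule V)
interpretation W: module R W by (rule W)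

abbreviation (input) "Fr \<equiv> free_module R (carrier V \<times> carrier W)"

interpretation F: module R Fr by (rule module_free)

lemma tensor_rels_subset: "tensor_rels R V W \<subseteq> carrier Fr"
  unfolding tensor_rels_def Let_def by (auto intro!: F.minus_closed free_gen_closed)

lemma quotient_space_tensor: "quotient_space R Fr (tensor_null R V W) (tensor R V W)"
  unfolding tensor_def tensor_null_def
  by (intro quotient_space_quot_module lin_span_submodule module_free tensor_rels_subset)

interpretation Q: quotient_space R Fr "tensor_null R V W" "tensor R V W"
  by (rule quotient_space_tensor)

lemma module_tensor: "module R (tensor R V W)"
  by (rule Q.module_Q)

interpretation T: module R "tensor R V W" by (rule module_tensor)

lemma pure_tensor_closed:
  "\<lbrakk>v \<in> carrier V; w \<in> carrier W\<rbrakk> \<Longrightarrow> pure_tensor R V W v w \<in> carrier (tensor R V W)"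
  unfolding pure_tensor_def by (simp add: Q.proj_closed free_gen_closed)

text \<open>The four families in \<open>tensor_rels\<close> are precisely the differences that have
  to vanish for additivity and homogeneity in each argument.\<close>

lemma pure_tensor_bilinear: "pure_tensor R V W \<in> bilinear_maps R V W (tensor R V W)"
proof -
  note null = subsetD[OF lin_span_incl[of "tensor_rels R V W" R Fr], folded tensor_null_def]
  note gen = free_gen_closed[of _ "carrier V \<times> carrier W"]
  have 1: "pure_tensor R V W (v \<oplus>\<^bsub>V\<^esub> v') w = pure_tensor R V W v w \<oplus>\<^bsub>tensor R V W\<^esub> pure_tensor R V W v' w"
    if "v \<in> carrier V" "v' \<in> carrier V" "w \<in> carrier W" for v v' w
    unfolding pure_tensor_def using that
    by (subst Q.proj_add[symmetric], simp_all add: gen Q.proj_eq_iff)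
      (rule null, unfold tensor_rels_def Let_def, blast)
  have 2: "pure_tensor R V W v (w \<oplus>\<^bsub>W\<^esub> w') = pure_tensor R V W v w \<oplus>\<^bsub>tensor R V W\<^esub> pure_tensor R V W v w'"
    if "v \<in> carrier V" "w' \<in> carrier W" "w \<in> carrier W" for v w w'
    unfolding pure_tensor_def using that
    by (subst Q.proj_add[symmetric], simp_all add: gen Q.proj_eq_iff)
      (rule null, unfold tensor_rels_def Let_def, blast)
  have 3: "pure_tensor R V W (c \<odot>\<^bsub>V\<^esub> v) w = c \<odot>\<^bsub>tensor R V W\<^esub> pure_tensor R V W v w"
    if "v \<in> carrier V" "c \<in> carrier R" "w \<in> carrier W" for v c w
    unfolding pure_tensor_def using that
    by (subst Q.proj_smult[symmetric], simp_all add: gen Q.proj_eq_iff)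
      (rule null, unfold tensor_rels_def Let_def, blast)
  have 4: "pure_tensor R V W v (c \<odot>\<^bsub>W\<^esub> w) = c \<odot>\<^bsub>tensor R V W\<^esub> pure_tensor R V W v w"
    if "v \<in> carrier V" "c \<in> carrier R" "w \<in> carrier W" for v c w
    unfolding pure_tensor_def using that
    by (subst Q.proj_smult[symmetric], simp_all add: gen Q.proj_eq_iff)
      (rule null, unfold tensor_rels_def Let_def, blast)
  show ?thesis
    by (intro bilinear_mapsI linear_mapsI) (simp_all add: 1 2 3 4 pure_tensor_closed)
qed

text \<open>Scalars are absorbed into the left factor,
  \<open>c (v \<otimes> w) = (c v) \<otimes> w\<close>, so pure tensors can be added without
  coefficients.\<close>

lemma tensor_induct [consumes 1, case_names zero add_pure]:
  assumes "z \<in> carrier (tensor R V W)"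
    and "P \<zero>\<^bsub>tensor R V W\<^esub>"
    and "\<And>z v w. \<lbrakk>z \<in> carrier (tensor R V W); P z; v \<in> carrier V; w \<in> carrier W\<rbrakk> \<Longrightarrow>
      P (z \<oplus>\<^bsub>tensor R V W\<^esub> pure_tensor R V W v w)"
  shows "P z"
proof -
  have "P (Q.proj f)" if "f \<in> carrier Fr" for f
    using that
  proof (induction f rule: free_induct)
    case zero
    have "Q.proj \<zero>\<^bsub>Fr\<^esub> = \<zero>\<^bsub>tensor R V W\<^esub>" by (simp add: Q.proj_eq_zero_iff)
    then show ?case using assms(2) by (simp add: free_zero)
  next
    case (add_gen g c x)
    obtain v w where x: "x = (v, w)" "v \<in> carrier V" "w \<in> carrier W"
      using add_gen.hyps by auto
    have "Q.proj (g \<oplus>\<^bsub>Fr\<^esub> c \<odot>\<^bsub>Fr\<^esub> free_gen R x) = Q.proj g \<oplus>\<^bsub>tensor R V W\<^esub> pure_tensor R V W (c \<odot>\<^bsub>V\<^esub> v) w"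
      using add_gen.hyps x lin_smult[OF bil_left[OF pure_tensor_bilinear]]
      by (simp add: Q.proj_add Q.proj_smult free_gen_closed pure_tensor_def)
    then show ?case
      using assms(3)[of "Q.proj g" "c \<odot>\<^bsub>V\<^esub> v" w] add_gen x Q.proj_closed by auto
  qed
  then show ?thesis using assms(1) by (auto elim!: Q.carrier_QE)
qed

text \<open>The rule by which nearly every identity below is verified; \<open>z\<close> is typically
  a coproduct that cannot be decomposed explicitly.\<close>

lemma tensor_eqI:
  assumes "module R P" "f \<in> linear_maps R (tensor R V W) P" "g \<in> linear_maps R (tensor R V W) P"
    and "\<And>v w. \<lbrakk>v \<in> carrier V; w \<in> carrier W\<rbrakk> \<Longrightarrow>
      f (pure_tensor R V W v w) = g (pure_tensor R V W v w)"
    and "z \<in> carrier (tensor R V W)"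
  shows "f z = g z"
  using assms(5)
proof (induction z rule: tensor_induct)
  case zero
  show ?case
    using lin_zero[OF module_tensor assms(1,2)] lin_zero[OF module_tensor assms(1,3)] by simp
next
  case (add_pure z v w)
  then show ?case
    by (simp add: lin_add[OF assms(2)] lin_add[OF assms(3)] assms(4) pure_tensor_closed)
qed

context
  fixes P :: "('a, 'p, 'z) module_scheme" and h
  assumes P: "module R P" and h: "h \<in> bilinear_maps R V W P"
begin

interpretation P: module R P by (rule P)

text \<open>The linear extension of a bilinear \<open>h\<close> kills the four families of
  relations, hence their span. This makes \<open>tensor_lift\<close> single valued on
  cosets.\<close>

private lemma null_lift:
  assumes "f \<in> tensor_null R V W"
  shows "(\<Oplus>\<^bsub>P\<^esub>p\<in>{p. f p \<noteq> \<zero>}. f p \<odot>\<^bsub>P\<^esub> h (fst p) (snd p)) = \<zero>\<^bsub>P\<^esub>"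
proof -
  define l where "l = (\<lambda>f. \<Oplus>\<^bsub>P\<^esub>p\<in>{p. f p \<noteq> \<zero>}. f p \<odot>\<^bsub>P\<^esub> h (fst p) (snd p))"
  have Pi: "(\<lambda>p. h (fst p) (snd p)) \<in> carrier V \<times> carrier W \<rightarrow> carrier P"
    using bil_closed[OF h] by auto
  have lin: "l \<in> linear_maps R Fr P"
    unfolding l_def by (rule free_lift_linear[OF P Pi])
  note gen = free_gen_closed[of _ "carrier V \<times> carrier W"]
  have lgen: "l (free_gen R (v, w)) = h v w" if "v \<in> carrier V" "w \<in> carrier W" for v w
    unfolding l_def using free_lift_gen[OF P Pi, of "(v, w)"] that by simp
  have self: "x \<ominus>\<^bsub>P\<^esub> x = \<zero>\<^bsub>P\<^esub>" if "x \<in> carrier P" for x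
    using that by (simp add: a_minus_def P.r_neg)
  note lins = lin_minus[OF module_free P lin] lin_add[OF lin] lin_smult[OF lin]
  note bils = lin_add[OF bil_left[OF h]] lin_add[OF bil_right[OF h]]
    lin_smult[OF bil_left[OF h]] lin_smult[OF bil_right[OF h]]
  have 1: "l (free_gen R (v \<oplus>\<^bsub>V\<^esub> v', w) \<ominus>\<^bsub>Fr\<^esub> (free_gen R (v, w) \<oplus>\<^bsub>Fr\<^esub> free_gen R (v', w))) = \<zero>\<^bsub>P\<^esub>"
    if "v \<in> carrier V" "v' \<in> carrier V" "w \<in> carrier W" for v v' w
    using that by (simp add: lins lgen gen bils bil_closed[OF h] self)
  have 2: "l (free_gen R (v, w \<oplus>\<^bsub>W\<^esub> w') \<ominus>\<^bsub>Fr\<^esub> (free_gen R (v, w) \<oplus>\<^bsub>Fr\<^esub> free_gen R (v, w'))) = \<zero>\<^bsub>P\<^esub>"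
    if "v \<in> carrier V" "w' \<in> carrier W" "w \<in> carrier W" for v w' w
    using that by (simp add: lins lgen gen bils bil_closed[OF h] self)
  have 3: "l (free_gen R (c \<odot>\<^bsub>V\<^esub> v, w) \<ominus>\<^bsub>Fr\<^esub> c \<odot>\<^bsub>Fr\<^esub> free_gen R (v, w)) = \<zero>\<^bsub>P\<^esub>"
    if "c \<in> carrier R" "v \<in> carrier V" "w \<in> carrier W" for c v w
    using that by (simp add: lins lgen gen bils bil_closed[OF h] self)
  have 4: "l (free_gen R (v, c \<odot>\<^bsub>W\<^esub> w) \<ominus>\<^bsub>Fr\<^esub> c \<odot>\<^bsub>Fr\<^esub> free_gen R (v, w)) = \<zero>\<^bsub>P\<^esub>"
    if "c \<in> carrier R" "v \<in> carrier V" "w \<in> carrier W" for c v w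
    using that by (simp add: lins lgen gen bils bil_closed[OF h] self)
  have "l r = \<zero>\<^bsub>P\<^esub>" if "r \<in> tensor_rels R V W" for r
    using that unfolding tensor_rels_def Let_def
    by (elim UnE CollectE exE conjE) (simp_all only: 1 2 3 4)
  then have "l r \<in> {\<zero>\<^bsub>P\<^esub>}" if "r \<in> tensor_rels R V W" for r
    using that by simp
  then have "l f \<in> {\<zero>\<^bsub>P\<^esub>}"
    by (rule lin_span_image[OF module_free P lin submodule_zero[OF P] tensor_rels_subset])
      (simp_all add: assms[unfolded tensor_null_def])
  then show ?thesis unfolding l_def by (rule singletonD)
qed

lemma tensor_lift_linear: "tensor_lift R P h \<in> linear_maps R (tensor R V W) P"
proof -
  have "(\<lambda>p. h (fst p) (snd p)) \<in> carrier V \<times> carrier W \<rightarrow> carrier P"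
    using bil_closed[OF h] by auto
  from Q.lift_linear[OF P free_lift_linear[OF P this] null_lift]
  show ?thesis unfolding tensor_lift_def .
qed

lemma tensor_lift_pure:
  assumes "v \<in> carrier V" "w \<in> carrier W"
  shows "tensor_lift R P h (pure_tensor R V W v w) = h v w"
proof -
  have Pi: "(\<lambda>p. h (fst p) (snd p)) \<in> carrier V \<times> carrier W \<rightarrow> carrier P"
    using bil_closed[OF h] by auto
  show ?thesis
    unfolding tensor_lift_def pure_tensor_def
    using assms free_lift_gen[OF P Pi, of "(v, w)"]
    by (subst Q.lift_proj[OF P free_lift_linear[OF P Pi] null_lift]) (auto intro!: free_gen_closed)
qed

end

end

text \<open>The shape with index set \<open>{..<n}\<close> is the one in which
  \<open>d_generates\<close> and the right covariance axiom quantify over finite sums.\<close>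

lemma tensor_sum_rep:
  assumes "module R V" "module R W" "z \<in> carrier (tensor R V W)"
  obtains n :: nat and a b where "a \<in> {..<n} \<rightarrow> carrier V" "b \<in> {..<n} \<rightarrow> carrier W"
    and "z = (\<Oplus>\<^bsub>tensor R V W\<^esub>k\<in>{..<n}. pure_tensor R V W (a k) (b k))"
proof -
  interpret T: module R "tensor R V W" by (rule module_tensor[OF assms(1,2)])
  have "\<exists>(n::nat) a b. a \<in> {..<n} \<rightarrow> carrier V \<and> b \<in> {..<n} \<rightarrow> carrier W
      \<and> z = (\<Oplus>\<^bsub>tensor R V W\<^esub>k\<in>{..<n}. pure_tensor R V W (a k) (b k))"
    using assms(3)
  proof (induction z rule: tensor_induct[OF assms(1,2), consumes 1, case_names zero add_pure])
    case zero
    show ?case by (rule exI[of _ 0]) auto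
  next
    case (add_pure z v w)
    then obtain n :: nat and a b where n: "a \<in> {..<n} \<rightarrow> carrier V" "b \<in> {..<n} \<rightarrow> carrier W"
      and z: "z = (\<Oplus>\<^bsub>tensor R V W\<^esub>k\<in>{..<n}. pure_tensor R V W (a k) (b k))"
      by blast
    let ?a = "a(n := v)" and ?b = "b(n := w)"
    have cl: "pure_tensor R V W (a k) (b k) \<in> carrier (tensor R V W)" if "k < n" for k
      using n that by (intro pure_tensor_closed assms(1,2)) auto
    have "(\<Oplus>\<^bsub>tensor R V W\<^esub>k\<in>{..<Suc n}. pure_tensor R V W (?a k) (?b k))
        = pure_tensor R V W v w \<oplus>\<^bsub>tensor R V W\<^esub>
          (\<Oplus>\<^bsub>tensor R V W\<^esub>k\<in>{..<n}. pure_tensor R V W (?a k) (?b k))"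
      unfolding lessThan_Suc using cl add_pure.hyps pure_tensor_closed[OF assms(1,2)]
      by (subst T.finsum_insert) auto
    also have "(\<Oplus>\<^bsub>tensor R V W\<^esub>k\<in>{..<n}. pure_tensor R V W (?a k) (?b k)) = z"
      unfolding z using cl by (intro T.finsum_cong') auto
    also have "pure_tensor R V W v w \<oplus>\<^bsub>tensor R V W\<^esub> z = z \<oplus>\<^bsub>tensor R V W\<^esub> pure_tensor R V W v w"
      using add_pure.hyps pure_tensor_closed[OF assms(1,2)] by (intro T.a_comm) auto
    finally show ?case
      using n add_pure.hyps by (intro exI[of _ "Suc n"] exI[of _ ?a] exI[of _ ?b])
        (auto simp: Pi_iff less_Suc_eq)
  qed
  then show ?thesis using that by blast
qed

text \<open>The lift is given by \<open>the_elem\<close>, which shows no dependence on the parameter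
  \<open>x\<close>; induction on \<open>z\<close> reduces linearity in \<open>x\<close> to pure
  tensors. The nested lifts in \<open>tensor_map2\<close> and \<open>tensor_assoc\<close> rely on
  this.\<close>

lemma tensor_lift_param:
  assumes U: "module R U" and V: "module R V" and W: "module R W" and P: "module R P"
    and bil: "\<And>x. x \<in> carrier U \<Longrightarrow> h x \<in> bilinear_maps R V W P"
    and lin: "\<And>v w. \<lbrakk>v \<in> carrier V; w \<in> carrier W\<rbrakk> \<Longrightarrow> (\<lambda>x. h x v w) \<in> linear_maps R U P"
    and z: "z \<in> carrier (tensor R V W)"
  shows "(\<lambda>x. tensor_lift R P (h x) z) \<in> linear_maps R U P"
  using z
proof (induction z rule: tensor_induct[OF V W, consumes 1, case_names zero add_pure])
  case zero
  show ?case
    by (rule lin_cong[OF U lin_zero_fun[OF P]])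
      (rule lin_zero[OF module_tensor[OF V W] P tensor_lift_linear[OF V W P bil]])
next
  case (add_pure z v w)
  note l = tensor_lift_linear[OF V W P bil]
  show ?case
    by (rule lin_cong[OF U lin_add_fun[OF U P add_pure.IH lin[OF add_pure.hyps(2,3)]]])
      (simp add: lin_add[OF l] add_pure.hyps pure_tensor_closed[OF V W]
        tensor_lift_pure[OF V W P bil])
qed

section \<open>Tensor products of linear and bilinear maps, and reassociation\<close>

lemma tensor_map_linear:
  assumes "module R V" "module R W" "module R P" "module R Q"
    and "f \<in> linear_maps R V P" "g \<in> linear_maps R W Q"
  shows "tensor_map R P Q f g \<in> linear_maps R (tensor R V W) (tensor R P Q)"
  unfolding tensor_map_def
  by (intro tensor_lift_linear module_tensor assms bil_pre[OF pure_tensor_bilinear])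

lemma tensor_map_pure:
  assumes "module R V" "module R W" "module R P" "module R Q"
    and "f \<in> linear_maps R V P" "g \<in> linear_maps R W Q" "v \<in> carrier V" "w \<in> carrier W"
  shows "tensor_map R P Q f g (pure_tensor R V W v w) = pure_tensor R P Q (f v) (g w)"
  unfolding tensor_map_def
  by (subst tensor_lift_pure) (intro refl module_tensor assms bil_pre[OF pure_tensor_bilinear])+

lemma tensor_map_bilinear_left:
  assumes "module R U" "module R V" "module R W" "module R P" "module R Q"
    and "f \<in> bilinear_maps R U V P" "g \<in> linear_maps R W Q"
  shows "(\<lambda>u. tensor_map R P Q (f u) g) \<in> bilinear_maps R U (tensor R V W) (tensor R P Q)"
proof (rule bilinear_mapsI)
  note p = pure_tensor_bilinear[OF assms(4,5)]
  show "(\<lambda>u. tensor_map R P Q (f u) g z) \<in> linear_maps R U (tensor R P Q)"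
    if z: "z \<in> carrier (tensor R V W)" for z
    unfolding tensor_map_def
  proof (rule tensor_lift_param[OF assms(1-3) module_tensor[OF assms(4,5)] _ _ z])
    show "(\<lambda>v w. pure_tensor R P Q (f u v) (g w)) \<in> bilinear_maps R V W (tensor R P Q)"
      if "u \<in> carrier U" for u
      by (rule bil_pre[OF p bil_right[OF assms(6) that] assms(7)])
    show "(\<lambda>u. pure_tensor R P Q (f u v) (g w)) \<in> linear_maps R U (tensor R P Q)"
      if "v \<in> carrier V" "w \<in> carrier W" for v w
      by (rule lin_comp[OF bil_left[OF assms(6) that(1)] bil_left[OF p lin_closed[OF assms(7) that(2)]]])
  qed
qed (intro tensor_map_linear assms bil_right[OF assms(6)])

lemma tensor_map_bilinear_right:
  assumes "module R U" "module R V" "module R W" "module R P" "module R Q"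
    and "f \<in> linear_maps R V P" "g \<in> bilinear_maps R U W Q"
  shows "(\<lambda>u. tensor_map R P Q f (g u)) \<in> bilinear_maps R U (tensor R V W) (tensor R P Q)"
proof (rule bilinear_mapsI)
  note p = pure_tensor_bilinear[OF assms(4,5)]
  show "(\<lambda>u. tensor_map R P Q f (g u) z) \<in> linear_maps R U (tensor R P Q)"
    if z: "z \<in> carrier (tensor R V W)" for z
    unfolding tensor_map_def
  proof (rule tensor_lift_param[OF assms(1-3) module_tensor[OF assms(4,5)] _ _ z])
    show "(\<lambda>v w. pure_tensor R P Q (f v) (g u w)) \<in> bilinear_maps R V W (tensor R P Q)"
      if "u \<in> carrier U" for u
      by (rule bil_pre[OF p assms(6) bil_right[OF assms(7) that]])
    show "(\<lambda>u. pure_tensor R P Q (f v) (g u w)) \<in> linear_maps R U (tensor R P Q)"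
      if "v \<in> carrier V" "w \<in> carrier W" for v w
      by (rule lin_comp[OF bil_left[OF assms(7) that(2)] bil_right[OF p lin_closed[OF assms(6) that(1)]]])
  qed
qed (intro tensor_map_linear assms bil_right[OF assms(7)])

context
  fixes V :: "('a, 'v, 'x) module_scheme" and W :: "('a, 'w, 'y) module_scheme"
    and V' :: "('a, 'v', 'x') module_scheme" and W' :: "('a, 'w', 'y') module_scheme"
    and P :: "('a, 'p, 'z) module_scheme" and Q :: "('a, 'q, 'z') module_scheme" and f g
  assumes V: "module R V" and W: "module R W" and V': "module R V'" and W': "module R W'"
    and P: "module R P" and Q: "module R Q"
    and f: "f \<in> bilinear_maps R V V' P" and g: "g \<in> bilinear_maps R W W' Q"
begin

private abbreviation (input) "inner v w \<equiv> (\<lambda>v' w'. pure_tensor R P Q (f v v') (g w w'))"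

private lemma map2_inner:
  "\<lbrakk>v \<in> carrier V; w \<in> carrier W\<rbrakk> \<Longrightarrow> inner v w \<in> bilinear_maps R V' W' (tensor R P Q)"
  by (intro bil_pre[OF pure_tensor_bilinear[OF P Q]] bil_right[OF f] bil_right[OF g])

private lemma map2_outer:
  assumes Y: "Y \<in> carrier (tensor R V' W')"
  shows "(\<lambda>v w. tensor_lift R (tensor R P Q) (inner v w) Y) \<in> bilinear_maps R V W (tensor R P Q)"
proof (rule bilinear_mapsI)
  note p = pure_tensor_bilinear[OF P Q]
  show "(\<lambda>w. tensor_lift R (tensor R P Q) (inner v w) Y) \<in> linear_maps R W (tensor R P Q)"
    if v: "v \<in> carrier V" for v
    by (rule tensor_lift_param[OF W V' W' module_tensor[OF P Q] map2_inner[OF v] _ Y])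
      (auto intro!: lin_comp[OF bil_left[OF g] bil_right[OF p]] bil_closed[OF f v])
  show "(\<lambda>v. tensor_lift R (tensor R P Q) (inner v w) Y) \<in> linear_maps R V (tensor R P Q)"
    if w: "w \<in> carrier W" for w
    by (rule tensor_lift_param[OF V V' W' module_tensor[OF P Q] map2_inner[OF _ w] _ Y])
      (auto intro!: lin_comp[OF bil_left[OF f] bil_left[OF p]] bil_closed[OF g w])
qed

lemma tensor_map2_bilinear:
  "tensor_map2 R P Q f g \<in> bilinear_maps R (tensor R V W) (tensor R V' W') (tensor R P Q)"
proof (rule bilinear_mapsI)
  show "(\<lambda>X. tensor_map2 R P Q f g X Y) \<in> linear_maps R (tensor R V W) (tensor R P Q)"
    if Y: "Y \<in> carrier (tensor R V' W')" for Y
    unfolding tensor_map2_def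
    by (rule tensor_lift_linear[OF V W module_tensor[OF P Q] map2_outer[OF Y]])
  show "tensor_map2 R P Q f g X \<in> linear_maps R (tensor R V' W') (tensor R P Q)"
    if X: "X \<in> carrier (tensor R V W)" for X
    unfolding tensor_map2_def
    by (rule tensor_lift_param[OF module_tensor[OF V' W'] V W module_tensor[OF P Q]
          map2_outer _ X])
      (assumption | rule tensor_lift_linear[OF V' W' module_tensor[OF P Q] map2_inner])+
qed

lemma tensor_map2_pure:
  assumes "v \<in> carrier V" "w \<in> carrier W" "v' \<in> carrier V'" "w' \<in> carrier W'"
  shows "tensor_map2 R P Q f g (pure_tensor R V W v w) (pure_tensor R V' W' v' w')
    = pure_tensor R P Q (f v v') (g w w')"
  unfolding tensor_map2_def
  using assms pure_tensor_closed[OF V' W']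
  by (simp add: tensor_lift_pure[OF V W module_tensor[OF P Q] map2_outer]
      tensor_lift_pure[OF V' W' module_tensor[OF P Q] map2_inner])

end

context
  fixes U :: "('a, 'u, 'x) module_scheme" and V :: "('a, 'v, 'y) module_scheme"
    and W :: "('a, 'w, 'z) module_scheme"
  assumes U: "module R U" and V: "module R V" and W: "module R W"
begin

private abbreviation (input) "T3 \<equiv> tensor R U (tensor R V W)"
private lemmas m = module_tensor[OF V W] module_tensor[OF U module_tensor[OF V W]]

private lemma assoc_inner:
  assumes "w \<in> carrier W"
  shows "(\<lambda>u v. pure_tensor R U (tensor R V W) u (pure_tensor R V W v w)) \<in> bilinear_maps R U V T3"
  using bil_pre[OF pure_tensor_bilinear[OF U m(1)] lin_id bil_left[OF pure_tensor_bilinear[OF V W] assms]]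
  by simp

private lemma assoc_outer:
  "(\<lambda>X w. tensor_lift R T3 (\<lambda>u v. pure_tensor R U (tensor R V W) u (pure_tensor R V W v w)) X)
    \<in> bilinear_maps R (tensor R U V) W T3"
proof (rule bilinear_mapsI)
  show "(\<lambda>w. tensor_lift R T3 (\<lambda>u v. pure_tensor R U (tensor R V W) u (pure_tensor R V W v w)) X)
      \<in> linear_maps R W T3" if X: "X \<in> carrier (tensor R U V)" for X
    by (rule tensor_lift_param[OF W U V m(2) assoc_inner _ X])
      (assumption | rule lin_comp[OF bil_right[OF pure_tensor_bilinear[OF V W]]
          bil_right[OF pure_tensor_bilinear[OF U m(1)]]])+
qed (rule tensor_lift_linear[OF U V m(2) assoc_inner])

lemma tensor_assoc_linear:
  "tensor_assoc R U V W \<in> linear_maps R (tensor R (tensor R U V) W) T3"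
  unfolding tensor_assoc_def
  by (rule tensor_lift_linear[OF module_tensor[OF U V] W m(2) assoc_outer])

lemma tensor_assoc_pure:
  assumes "u \<in> carrier U" "v \<in> carrier V" "w \<in> carrier W"
  shows "tensor_assoc R U V W (pure_tensor R (tensor R U V) W (pure_tensor R U V u v) w)
    = pure_tensor R U (tensor R V W) u (pure_tensor R V W v w)"
  unfolding tensor_assoc_def
  using assms pure_tensor_closed[OF U V]
  by (simp add: tensor_lift_pure[OF module_tensor[OF U V] W m(2) assoc_outer]
      tensor_lift_pure[OF U V m(2) assoc_inner])

end

lemma tensor_bilinear_eqI:
  assumes "module R V" "module R W" "module R V'" "module R W'" "module R P"
    and "f \<in> bilinear_maps R (tensor R V W) (tensor R V' W') P"
    and "g \<in> bilinear_maps R (tensor R V W) (tensor R V' W') P"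
    and "\<And>v w v' w'. \<lbrakk>v \<in> carrier V; w \<in> carrier W; v' \<in> carrier V'; w' \<in> carrier W'\<rbrakk> \<Longrightarrow>
      f (pure_tensor R V W v w) (pure_tensor R V' W' v' w')
        = g (pure_tensor R V W v w) (pure_tensor R V' W' v' w')"
    and "X \<in> carrier (tensor R V W)" "Y \<in> carrier (tensor R V' W')"
  shows "f X Y = g X Y"
proof (rule tensor_eqI[OF assms(3,4,5) bil_right[OF assms(6,9)] bil_right[OF assms(7,9)] _ assms(10)])
  fix v' w' assume vw: "v' \<in> carrier V'" "w' \<in> carrier W'"
  note p = pure_tensor_closed[OF assms(3,4) vw]
  show "f X (pure_tensor R V' W' v' w') = g X (pure_tensor R V' W' v' w')"
    by (rule tensor_eqI[OF assms(1,2,5) bil_left[OF assms(6) p] bil_left[OF assms(7) p] _ assms(9)])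
      (rule assms(8)[OF _ _ vw])
qed

section \<open>Subspaces and finite sums in tensor products\<close>

context
  fixes V :: "('a, 'v, 'x) module_scheme" and W :: "('a, 'w, 'y) module_scheme" and S T
  assumes V: "module R V" and W: "module R W" and ST: "S \<subseteq> carrier V" "T \<subseteq> carrier W"
begin

lemma tensor_sub_submodule: "submodule (tensor_sub R V W S T) R (tensor R V W)"
  unfolding tensor_sub_def
  using ST pure_tensor_closed[OF V W] by (intro lin_span_submodule module_tensor V W) blast

lemma tensor_sub_pure: "\<lbrakk>s \<in> S; t \<in> T\<rbrakk> \<Longrightarrow> pure_tensor R V W s t \<in> tensor_sub R V W S T"
  unfolding tensor_sub_def
  by (rule subsetD[OF lin_span_incl]) blast

lemma tensor_sub_image:
  assumes "module R P" "f \<in> linear_maps R (tensor R V W) P" "submodule H R P"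
    and "\<And>s t. \<lbrakk>s \<in> S; t \<in> T\<rbrakk> \<Longrightarrow> f (pure_tensor R V W s t) \<in> H"
    and "x \<in> tensor_sub R V W S T"
  shows "f x \<in> H"
proof (rule lin_span_image[OF module_tensor[OF V W] assms(1-3)])
  show "x \<in> lin_span R (tensor R V W) {pure_tensor R V W s t |s t. s \<in> S \<and> t \<in> T}"
    using assms(5) unfolding tensor_sub_def .
  show "{pure_tensor R V W s t |s t. s \<in> S \<and> t \<in> T} \<subseteq> carrier (tensor R V W)"
    using ST pure_tensor_closed[OF V W] by blast
  show "f s \<in> H" if "s \<in> {pure_tensor R V W s t |s t. s \<in> S \<and> t \<in> T}" for s
    using that assms(4) by blast
qed

end

text \<open>In contrast to \<open>tensor_sub_image\<close> the source is the whole tensor product.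
  It serves to replace a coproduct occurring inside a generator by pure tensors.\<close>

lemma tensor_image:
  assumes "module R V" "module R W" "module R P"
    and "f \<in> linear_maps R (tensor R V W) P" "submodule H R P"
    and "\<And>v w. \<lbrakk>v \<in> carrier V; w \<in> carrier W\<rbrakk> \<Longrightarrow> f (pure_tensor R V W v w) \<in> H"
    and "z \<in> carrier (tensor R V W)"
  shows "f z \<in> H"
proof -
  interpret P: module R P by fact
  have 0: "\<zero>\<^bsub>P\<^esub> \<in> H"
    using submodule.axioms(1)[OF assms(5)] by (auto dest: subgroup.one_closed)
  show ?thesis
    using assms(7)
  proof (induction z rule: tensor_induct[OF assms(1,2), consumes 1, case_names zero add_pure])
    case zero
    show ?case using 0 by (simp add: lin_zero[OF module_tensor[OF assms(1,2)] assms(3,4)])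
  next
    case (add_pure z v w)
    then show ?case
      using P.submoduleE(5)[OF assms(5)] assms(6)
      by (simp add: lin_add[OF assms(4)] pure_tensor_closed[OF assms(1,2)])
  qed
qed

text \<open>Turns the sum in the conclusion of a covariance axiom into the value of one linear map
  at one tensor.\<close>

lemma tensor_lift_sum:
  assumes "module R V" "module R W" "module R P" "h \<in> bilinear_maps R V W P"
    and "finite I" "x \<in> I \<rightarrow> carrier V" "y \<in> I \<rightarrow> carrier W"
  shows "tensor_lift R P h (\<Oplus>\<^bsub>tensor R V W\<^esub>k\<in>I. pure_tensor R V W (x k) (y k))
    = (\<Oplus>\<^bsub>P\<^esub>k\<in>I. h (x k) (y k))"
proof -
  interpret P: module R P by fact
  have "(\<lambda>k. pure_tensor R V W (x k) (y k)) \<in> I \<rightarrow> carrier (tensor R V W)"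
    using assms(6,7) by (auto intro!: pure_tensor_closed[OF assms(1,2)])
  then have "tensor_lift R P h (\<Oplus>\<^bsub>tensor R V W\<^esub>k\<in>I. pure_tensor R V W (x k) (y k))
      = (\<Oplus>\<^bsub>P\<^esub>k\<in>I. tensor_lift R P h (pure_tensor R V W (x k) (y k)))"
    by (rule lin_finsum[OF module_tensor[OF assms(1,2)] assms(3) tensor_lift_linear[OF assms(1-4)] assms(5)])
  also have "\<dots> = (\<Oplus>\<^bsub>P\<^esub>k\<in>I. h (x k) (y k))"
    using assms(6,7) bil_closed[OF assms(4)]
    by (intro P.finsum_cong') (auto simp: tensor_lift_pure[OF assms(1-4)] Pi_iff)
  finally show ?thesis .
qed

end


section \<open>The Galois map of a Hopf group coalgebra\<close>

lemma (in assoc_algebra) module_A: "module K A"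
  by (rule module_axioms)

lemma (in assoc_algebra) mult_bilinear: "mult A \<in> bilinear_maps K A A A"
  by (intro bilinear_mapsI linear_mapsI)
    (simp_all add: l_distr r_distr smult_mult_left smult_mult_right)

context hopf_group_coalgebra
begin

abbreviation T :: "'g \<Rightarrow> 'g \<Rightarrow> ('k, ('k, 'a, 'a) tens) module"
  where "T \<alpha> \<beta> \<equiv> tensor K (A \<alpha>) (A \<beta>)"

abbreviation pt :: "'g \<Rightarrow> 'g \<Rightarrow> 'a \<Rightarrow> 'a \<Rightarrow> ('k, 'a, 'a) tens"
  where "pt \<alpha> \<beta> \<equiv> pure_tensor K (A \<alpha>) (A \<beta>)"

abbreviation \<mu> :: "'g \<Rightarrow> 'a \<Rightarrow> 'a \<Rightarrow> 'a"
  where "\<mu> \<alpha> \<equiv> mult (A \<alpha>)"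

abbreviation lmul1 :: "'g \<Rightarrow> 'g \<Rightarrow> 'a \<Rightarrow> ('k, 'a, 'a) tens \<Rightarrow> ('k, 'a, 'a) tens"
  where "lmul1 \<alpha> \<beta> a \<equiv> tensor_map K (A \<alpha>) (A \<beta>) (\<mu> \<alpha> a) id"

abbreviation lmul2 :: "'g \<Rightarrow> 'g \<Rightarrow> 'a \<Rightarrow> ('k, 'a, 'a) tens \<Rightarrow> ('k, 'a, 'a) tens"
  where "lmul2 \<alpha> \<beta> a \<equiv> tensor_map K (A \<alpha>) (A \<beta>) id (\<mu> \<beta> a)"

abbreviation u :: 'g where "u \<equiv> \<one>\<^bsub>G\<^esub>"

abbreviation rm :: "'g \<Rightarrow> ('k, 'a, 'a) tens \<Rightarrow> ('k, 'a, 'a) tens"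
  where "rm \<equiv> r_map K G A \<Delta>"

abbreviation tm :: "'g \<Rightarrow> ('k, 'a, 'a) tens \<Rightarrow> ('k, 'a, 'a) tens"
  where "tm \<equiv> t_map K G A \<Delta>"

section \<open>Multiplication in \<open>A \<alpha>\<close> and on the factors of
  \<open>A \<alpha> \<otimes> A \<beta>\<close>\<close>

context
  fixes \<alpha>
  assumes a: "\<alpha> \<in> carrier G"
begin

lemma mod_A: "module K (A \<alpha>)"
  by (rule assoc_algebra.module_A[OF algebra_A[OF a]])

lemma ring_A: "ring (A \<alpha>)"
  using algebra_A[OF a] by (simp add: assoc_algebra_def)

lemma mult_A: "\<mu> \<alpha> \<in> bilinear_maps K (A \<alpha>) (A \<alpha>) (A \<alpha>)"
  by (rule assoc_algebra.mult_bilinear[OF algebra_A[OF a]])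

lemma mult_A_closed: "\<lbrakk>x \<in> carrier (A \<alpha>); y \<in> carrier (A \<alpha>)\<rbrakk> \<Longrightarrow> \<mu> \<alpha> x y \<in> carrier (A \<alpha>)"
  by (rule bil_closed[OF mult_A])

lemma mult_A_assoc:
  "\<lbrakk>x \<in> carrier (A \<alpha>); y \<in> carrier (A \<alpha>); z \<in> carrier (A \<alpha>)\<rbrakk> \<Longrightarrow>
    \<mu> \<alpha> (\<mu> \<alpha> x y) z = \<mu> \<alpha> x (\<mu> \<alpha> y z)"
  using ring_A by (simp add: ring_def monoid.m_assoc)

lemma one_A_closed: "\<one>\<^bsub>A \<alpha>\<^esub> \<in> carrier (A \<alpha>)"
  using ring_A by (simp add: ring_def monoid.one_closed)

lemma mult_A_one: "x \<in> carrier (A \<alpha>) \<Longrightarrow> \<mu> \<alpha> x \<one>\<^bsub>A \<alpha>\<^esub> = x"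
  and one_mult_A: "x \<in> carrier (A \<alpha>) \<Longrightarrow> \<mu> \<alpha> \<one>\<^bsub>A \<alpha>\<^esub> x = x"
  using ring_A by (simp_all add: ring_def monoid.r_one monoid.l_one)

end

lemmas [simp] = mult_A_closed one_A_closed mult_A_one one_mult_A

lemma unit_closed: "u \<in> carrier G" by simp

context
  fixes \<alpha> \<beta>
  assumes a: "\<alpha> \<in> carrier G" and b: "\<beta> \<in> carrier G"
begin

lemma mod_T: "module K (T \<alpha> \<beta>)"
  by (rule module_tensor[OF mod_A[OF a] mod_A[OF b]])

lemma pt_closed [simp]: "\<lbrakk>x \<in> carrier (A \<alpha>); y \<in> carrier (A \<beta>)\<rbrakk> \<Longrightarrow> pt \<alpha> \<beta> x y \<in> carrier (T \<alpha> \<beta>)"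
  by (rule pure_tensor_closed[OF mod_A[OF a] mod_A[OF b]])

lemma pt_bilinear: "pt \<alpha> \<beta> \<in> bilinear_maps K (A \<alpha>) (A \<beta>) (T \<alpha> \<beta>)"
  by (rule pure_tensor_bilinear[OF mod_A[OF a] mod_A[OF b]])

lemma comult_closed [simp]: "x \<in> carrier (A (\<alpha> \<otimes>\<^bsub>G\<^esub> \<beta>)) \<Longrightarrow> \<Delta> \<alpha> \<beta> x \<in> carrier (T \<alpha> \<beta>)"
  by (rule lin_closed[OF comult_linear[OF a b]])

lemma comult_mult:
  "\<lbrakk>x \<in> carrier (A (\<alpha> \<otimes>\<^bsub>G\<^esub> \<beta>)); y \<in> carrier (A (\<alpha> \<otimes>\<^bsub>G\<^esub> \<beta>))\<rbrakk> \<Longrightarrow>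
    \<Delta> \<alpha> \<beta> (\<mu> (\<alpha> \<otimes>\<^bsub>G\<^esub> \<beta>) x y)
      = tensor_map2 K (A \<alpha>) (A \<beta>) (\<mu> \<alpha>) (\<mu> \<beta>) (\<Delta> \<alpha> \<beta> x) (\<Delta> \<alpha> \<beta> y)"
  using ring_hom_mult[OF comult_hom[OF a b]] by (simp add: tensor_alg_def)

lemma comult_one: "\<Delta> \<alpha> \<beta> \<one>\<^bsub>A (\<alpha> \<otimes>\<^bsub>G\<^esub> \<beta>)\<^esub> = pt \<alpha> \<beta> \<one>\<^bsub>A \<alpha>\<^esub> \<one>\<^bsub>A \<beta>\<^esub>"
  using ring_hom_one[OF comult_hom[OF a b]] by (simp add: tensor_alg_def)

lemma lmul1_bilinear: "lmul1 \<alpha> \<beta> \<in> bilinear_maps K (A \<alpha>) (T \<alpha> \<beta>) (T \<alpha> \<beta>)"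
  by (intro tensor_map_bilinear_left mod_A a b mult_A lin_id)

lemma lmul2_bilinear: "lmul2 \<alpha> \<beta> \<in> bilinear_maps K (A \<beta>) (T \<alpha> \<beta>) (T \<alpha> \<beta>)"
  by (intro tensor_map_bilinear_right mod_A a b mult_A lin_id)

lemma lmul1_pure [simp]:
  "\<lbrakk>x \<in> carrier (A \<alpha>); y \<in> carrier (A \<alpha>); z \<in> carrier (A \<beta>)\<rbrakk> \<Longrightarrow>
    lmul1 \<alpha> \<beta> x (pt \<alpha> \<beta> y z) = pt \<alpha> \<beta> (\<mu> \<alpha> x y) z"
  by (simp add: tensor_map_pure[OF mod_A[OF a] mod_A[OF b] mod_A[OF a] mod_A[OF b]
        bil_right[OF mult_A[OF a]] lin_id])

lemma lmul2_pure [simp]: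
  "\<lbrakk>x \<in> carrier (A \<beta>); y \<in> carrier (A \<alpha>); z \<in> carrier (A \<beta>)\<rbrakk> \<Longrightarrow>
    lmul2 \<alpha> \<beta> x (pt \<alpha> \<beta> y z) = pt \<alpha> \<beta> y (\<mu> \<beta> x z)"
  by (simp add: tensor_map_pure[OF mod_A[OF a] mod_A[OF b] mod_A[OF a] mod_A[OF b]
        lin_id bil_right[OF mult_A[OF b]]])

lemma mult_T_bilinear:
  "tensor_map2 K (A \<alpha>) (A \<beta>) (\<mu> \<alpha>) (\<mu> \<beta>) \<in> bilinear_maps K (T \<alpha> \<beta>) (T \<alpha> \<beta>) (T \<alpha> \<beta>)"
  by (intro tensor_map2_bilinear mod_A a b mult_A)

lemma mult_T_pure [simp]:
  assumes "x \<in> carrier (A \<alpha>)" "y \<in> carrier (A \<beta>)" "x' \<in> carrier (A \<alpha>)" "y' \<in> carrier (A \<beta>)"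
  shows "tensor_map2 K (A \<alpha>) (A \<beta>) (\<mu> \<alpha>) (\<mu> \<beta>) (pt \<alpha> \<beta> x y) (pt \<alpha> \<beta> x' y')
    = pt \<alpha> \<beta> (\<mu> \<alpha> x x') (\<mu> \<beta> y y')"
  by (intro tensor_map2_pure mod_A a b mult_A assms)

lemma lmul1_mult:
  assumes "x \<in> carrier (A \<alpha>)" "y \<in> carrier (A \<alpha>)" "z \<in> carrier (T \<alpha> \<beta>)"
  shows "lmul1 \<alpha> \<beta> (\<mu> \<alpha> x y) z = lmul1 \<alpha> \<beta> x (lmul1 \<alpha> \<beta> y z)"
proof (rule tensor_eqI[OF mod_A[OF a] mod_A[OF b] mod_T _ _ _ assms(3)])
  note l = bil_right[OF lmul1_bilinear]
  show "lmul1 \<alpha> \<beta> (\<mu> \<alpha> x y) \<in> linear_maps K (T \<alpha> \<beta>) (T \<alpha> \<beta>)"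
    by (rule l[OF mult_A_closed[OF a assms(1,2)]])
  show "(\<lambda>z. lmul1 \<alpha> \<beta> x (lmul1 \<alpha> \<beta> y z)) \<in> linear_maps K (T \<alpha> \<beta>) (T \<alpha> \<beta>)"
    by (rule lin_comp[OF l[OF assms(2)] l[OF assms(1)]])
  show "lmul1 \<alpha> \<beta> (\<mu> \<alpha> x y) (pt \<alpha> \<beta> v w) = lmul1 \<alpha> \<beta> x (lmul1 \<alpha> \<beta> y (pt \<alpha> \<beta> v w))"
    if "v \<in> carrier (A \<alpha>)" "w \<in> carrier (A \<beta>)" for v w
    using assms that a b by (simp add: mult_A_assoc)
qed

lemma lmul2_mult:
  assumes "x \<in> carrier (A \<beta>)" "y \<in> carrier (A \<beta>)" "z \<in> carrier (T \<alpha> \<beta>)"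
  shows "lmul2 \<alpha> \<beta> (\<mu> \<beta> x y) z = lmul2 \<alpha> \<beta> x (lmul2 \<alpha> \<beta> y z)"
proof (rule tensor_eqI[OF mod_A[OF a] mod_A[OF b] mod_T _ _ _ assms(3)])
  note l = bil_right[OF lmul2_bilinear]
  show "lmul2 \<alpha> \<beta> (\<mu> \<beta> x y) \<in> linear_maps K (T \<alpha> \<beta>) (T \<alpha> \<beta>)"
    by (rule l[OF mult_A_closed[OF b assms(1,2)]])
  show "(\<lambda>z. lmul2 \<alpha> \<beta> x (lmul2 \<alpha> \<beta> y z)) \<in> linear_maps K (T \<alpha> \<beta>) (T \<alpha> \<beta>)"
    by (rule lin_comp[OF l[OF assms(2)] l[OF assms(1)]])
  show "lmul2 \<alpha> \<beta> (\<mu> \<beta> x y) (pt \<alpha> \<beta> v w) = lmul2 \<alpha> \<beta> x (lmul2 \<alpha> \<beta> y (pt \<alpha> \<beta> v w))"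
    if "v \<in> carrier (A \<alpha>)" "w \<in> carrier (A \<beta>)" for v w
    using assms that a b by (simp add: mult_A_assoc)
qed

text \<open>Together with \<open>mult_T_right\<close> this rewrites the products in the definitions
  of \<open>r_map\<close> and \<open>t_map\<close> as actions on a single tensor factor.\<close>

lemma mult_T_left:
  assumes "x \<in> carrier (A \<alpha>)" "z \<in> carrier (T \<alpha> \<beta>)"
  shows "tensor_map2 K (A \<alpha>) (A \<beta>) (\<mu> \<alpha>) (\<mu> \<beta>) (pt \<alpha> \<beta> x \<one>\<^bsub>A \<beta>\<^esub>) z = lmul1 \<alpha> \<beta> x z"
  using assms a b
  by (intro tensor_eqI[OF mod_A[OF a] mod_A[OF b] mod_T bil_right[OF mult_T_bilinear]
        bil_right[OF lmul1_bilinear] _ assms(2)]) simp_all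

lemma mult_T_right:
  assumes "x \<in> carrier (A \<beta>)" "z \<in> carrier (T \<alpha> \<beta>)"
  shows "tensor_map2 K (A \<alpha>) (A \<beta>) (\<mu> \<alpha>) (\<mu> \<beta>) (pt \<alpha> \<beta> \<one>\<^bsub>A \<alpha>\<^esub> x) z = lmul2 \<alpha> \<beta> x z"
  using assms a b
  by (intro tensor_eqI[OF mod_A[OF a] mod_A[OF b] mod_T bil_right[OF mult_T_bilinear]
        bil_right[OF lmul2_bilinear] _ assms(2)]) simp_all

end

lemma tensor_A_eqI:
  assumes "\<alpha> \<in> carrier G" "\<beta> \<in> carrier G" "module K P"
    and "f \<in> linear_maps K (T \<alpha> \<beta>) P" "g \<in> linear_maps K (T \<alpha> \<beta>) P"
    and "\<And>x y. \<lbrakk>x \<in> carrier (A \<alpha>); y \<in> carrier (A \<beta>)\<rbrakk> \<Longrightarrow> f (pt \<alpha> \<beta> x y) = g (pt \<alpha> \<beta> x y)"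
    and "z \<in> carrier (T \<alpha> \<beta>)"
  shows "f z = g z"
  by (rule tensor_eqI[OF mod_A[OF assms(1)] mod_A[OF assms(2)] assms(3-7)])

section \<open>The maps \<open>r\<close> and \<open>t\<close> and their left linearity\<close>

context
  fixes \<alpha>
  assumes a: "\<alpha> \<in> carrier G"
begin

lemma comult_right_linear: "\<Delta> \<alpha> u \<in> linear_maps K (A \<alpha>) (T \<alpha> u)"
  and comult_left_linear: "\<Delta> u \<alpha> \<in> linear_maps K (A \<alpha>) (T u \<alpha>)"
  using comult_linear[OF a unit_closed] comult_linear[OF unit_closed a] a by simp_all

lemma comult_right_closed [simp]: "x \<in> carrier (A \<alpha>) \<Longrightarrow> \<Delta> \<alpha> u x \<in> carrier (T \<alpha> u)"
  and comult_left_closed [simp]: "x \<in> carrier (A \<alpha>) \<Longrightarrow> \<Delta> u \<alpha> x \<in> carrier (T u \<alpha>)"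
  by (rule lin_closed[OF comult_right_linear], assumption,
      rule lin_closed[OF comult_left_linear], assumption)

private lemma r_bilinear:
  "(\<lambda>x y. pt \<alpha> u x \<one>\<^bsub>A u\<^esub> \<otimes>\<^bsub>tensor_alg K (A \<alpha>) (A u)\<^esub> \<Delta> \<alpha> u y) \<in> bilinear_maps K (A \<alpha>) (A \<alpha>) (T \<alpha> u)"
  using bil_pre[OF mult_T_bilinear[OF a unit_closed]
      bil_left[OF pt_bilinear[OF a unit_closed] one_A_closed[OF unit_closed]] comult_right_linear]
  by (simp add: tensor_alg_def)

private lemma t_bilinear:
  "(\<lambda>x y. pt u \<alpha> \<one>\<^bsub>A u\<^esub> x \<otimes>\<^bsub>tensor_alg K (A u) (A \<alpha>)\<^esub> \<Delta> u \<alpha> y) \<in> bilinear_maps K (A \<alpha>) (A \<alpha>) (T u \<alpha>)"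
  using bil_pre[OF mult_T_bilinear[OF unit_closed a]
      bil_right[OF pt_bilinear[OF unit_closed a] one_A_closed[OF unit_closed]] comult_left_linear]
  by (simp add: tensor_alg_def)

lemma r_linear: "rm \<alpha> \<in> linear_maps K (T \<alpha> \<alpha>) (T \<alpha> u)"
  unfolding r_map_def
  by (rule tensor_lift_linear[OF mod_A[OF a] mod_A[OF a] mod_T[OF a unit_closed] r_bilinear])

lemma r_closed [simp]: "q \<in> carrier (T \<alpha> \<alpha>) \<Longrightarrow> rm \<alpha> q \<in> carrier (T \<alpha> u)"
  by (rule lin_closed[OF r_linear])

lemma r_pure [simp]:
  assumes "x \<in> carrier (A \<alpha>)" "y \<in> carrier (A \<alpha>)"
  shows "rm \<alpha> (pt \<alpha> \<alpha> x y) = lmul1 \<alpha> u x (\<Delta> \<alpha> u y)"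
  unfolding r_map_def
  using assms a mult_T_left[OF a unit_closed, of x "\<Delta> \<alpha> u y"]
  by (simp add: tensor_lift_pure[OF mod_A[OF a] mod_A[OF a] mod_T[OF a unit_closed] r_bilinear])
    (simp add: tensor_alg_def)

lemma t_linear: "tm \<alpha> \<in> linear_maps K (T \<alpha> \<alpha>) (T u \<alpha>)"
  unfolding t_map_def
  by (rule tensor_lift_linear[OF mod_A[OF a] mod_A[OF a] mod_T[OF unit_closed a] t_bilinear])

lemma t_pure [simp]:
  assumes "x \<in> carrier (A \<alpha>)" "y \<in> carrier (A \<alpha>)"
  shows "tm \<alpha> (pt \<alpha> \<alpha> x y) = lmul2 u \<alpha> x (\<Delta> u \<alpha> y)"
  unfolding t_map_def
  using assms a mult_T_right[OF unit_closed a, of x "\<Delta> u \<alpha> y"]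
  by (simp add: tensor_lift_pure[OF mod_A[OF a] mod_A[OF a] mod_T[OF unit_closed a] t_bilinear])
    (simp add: tensor_alg_def)

lemma r_lmul1:
  assumes "x \<in> carrier (A \<alpha>)" "q \<in> carrier (T \<alpha> \<alpha>)"
  shows "rm \<alpha> (lmul1 \<alpha> \<alpha> x q) = lmul1 \<alpha> u x (rm \<alpha> q)"
proof (rule tensor_A_eqI[OF a a mod_T[OF a unit_closed] _ _ _ assms(2)])
  note l = bil_right[OF lmul1_bilinear[OF a a] assms(1)]
    bil_right[OF lmul1_bilinear[OF a unit_closed] assms(1)]
  show "(\<lambda>q. rm \<alpha> (lmul1 \<alpha> \<alpha> x q)) \<in> linear_maps K (T \<alpha> \<alpha>) (T \<alpha> u)"
    by (rule lin_comp[OF l(1) r_linear])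
  show "(\<lambda>q. lmul1 \<alpha> u x (rm \<alpha> q)) \<in> linear_maps K (T \<alpha> \<alpha>) (T \<alpha> u)"
    by (rule lin_comp[OF r_linear l(2)])
  fix y z assume yz: "y \<in> carrier (A \<alpha>)" "z \<in> carrier (A \<alpha>)"
  then show "rm \<alpha> (lmul1 \<alpha> \<alpha> x (pt \<alpha> \<alpha> y z)) = lmul1 \<alpha> u x (rm \<alpha> (pt \<alpha> \<alpha> y z))"
    using yz assms(1) a by (simp add: lmul1_mult[OF a unit_closed])
qed

text \<open>Combined with \<open>r_lmul1\<close> this gives
  \<open>t (r^{-1} (y \<otimes> z)) = (1 \<otimes> y) ad z\<close>, so
  \<open>t \<circ> r^{-1}\<close> is determined by \<open>ad\<close>.\<close>

lemma t_lmul1: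
  assumes "x \<in> carrier (A \<alpha>)" "q \<in> carrier (T \<alpha> \<alpha>)"
  shows "tm \<alpha> (lmul1 \<alpha> \<alpha> x q) = lmul2 u \<alpha> x (tm \<alpha> q)"
proof (rule tensor_A_eqI[OF a a mod_T[OF unit_closed a] _ _ _ assms(2)])
  note l = bil_right[OF lmul1_bilinear[OF a a] assms(1)]
    bil_right[OF lmul2_bilinear[OF unit_closed a] assms(1)]
  show "(\<lambda>q. tm \<alpha> (lmul1 \<alpha> \<alpha> x q)) \<in> linear_maps K (T \<alpha> \<alpha>) (T u \<alpha>)"
    by (rule lin_comp[OF l(1) t_linear])
  show "(\<lambda>q. lmul2 u \<alpha> x (tm \<alpha> q)) \<in> linear_maps K (T \<alpha> \<alpha>) (T u \<alpha>)"
    by (rule lin_comp[OF t_linear l(2)])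
  fix y z assume yz: "y \<in> carrier (A \<alpha>)" "z \<in> carrier (A \<alpha>)"
  then show "tm \<alpha> (lmul1 \<alpha> \<alpha> x (pt \<alpha> \<alpha> y z)) = lmul2 u \<alpha> x (tm \<alpha> (pt \<alpha> \<alpha> y z))"
    using yz assms(1) a by (simp add: lmul2_mult[OF unit_closed a])
qed

end

section \<open>The inverse of \<open>r\<close> from the antipode\<close>

lemma counit_bilinear:
  assumes "\<alpha> \<in> carrier G"
  shows "(\<lambda>x y. \<epsilon> x \<odot>\<^bsub>A \<alpha>\<^esub> y) \<in> bilinear_maps K (A u) (A \<alpha>) (A \<alpha>)"
proof -
  interpret M: module K "A \<alpha>" by (rule mod_A[OF assms])
  have "\<epsilon> x \<in> carrier K" if "x \<in> carrier (A u)" for x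
    by (rule ring_hom_closed[OF counit_hom that])
  then show ?thesis
    by (intro bilinear_mapsI linear_mapsI)
      (simp_all add: ring_hom_add[OF counit_hom] counit_linear M.smult_l_distr M.smult_r_distr
        M.smult_assoc1[symmetric] m_comm)
qed

lemma counit_closed: "x \<in> carrier (A u) \<Longrightarrow> \<epsilon> x \<in> carrier K"
  by (rule ring_hom_closed[OF counit_hom])

context
  fixes \<alpha>
  assumes a: "\<alpha> \<in> carrier G"
begin

lemma mult_map_linear: "mult_map K (A \<alpha>) \<in> linear_maps K (T \<alpha> \<alpha>) (A \<alpha>)"
  unfolding mult_map_def
  by (rule tensor_lift_linear[OF mod_A[OF a] mod_A[OF a] mod_A[OF a] mult_A[OF a]])

lemma mult_map_pure [simp]:
  "\<lbrakk>x \<in> carrier (A \<alpha>); y \<in> carrier (A \<alpha>)\<rbrakk> \<Longrightarrow> mult_map K (A \<alpha>) (pt \<alpha> \<alpha> x y) = \<mu> \<alpha> x y"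
  unfolding mult_map_def
  by (rule tensor_lift_pure[OF mod_A[OF a] mod_A[OF a] mod_A[OF a] mult_A[OF a]])

private abbreviation (input) "i \<equiv> inv\<^bsub>G\<^esub> \<alpha>"

lemma antipode_inv_linear: "S i \<in> linear_maps K (A i) (A \<alpha>)"
  using antipode_linear[OF G.inv_closed[OF a]] a by simp

private lemma ii: "i \<in> carrier G" using a by simp

private lemmas S_cl [simp] = lin_closed[OF antipode_inv_linear]

text \<open>\<open>a \<otimes> b \<mapsto> a S(b\<^sub>1) \<otimes> b\<^sub>2\<close>, which will be the inverse of \<^term>\<open>rm \<alpha>\<close>.\<close>

definition s_map :: "('k, 'a, 'a) tens \<Rightarrow> ('k, 'a, 'a) tens"
  where "s_map = tensor_lift K (T \<alpha> \<alpha>)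
    (\<lambda>x y. tensor_map K (A \<alpha>) (A \<alpha>) (\<lambda>z. \<mu> \<alpha> x (S i z)) id (\<Delta> i \<alpha> y))"

private lemma comult_i: "\<Delta> i \<alpha> \<in> linear_maps K (A u) (T i \<alpha>)" "\<Delta> \<alpha> i \<in> linear_maps K (A u) (T \<alpha> i)"
  using comult_linear[OF ii a] comult_linear[OF a ii] a by simp_all

private lemma mS_bilinear: "(\<lambda>x z. \<mu> \<alpha> x (S i z)) \<in> bilinear_maps K (A \<alpha>) (A i) (A \<alpha>)"
  using bil_pre[OF mult_A[OF a] lin_id antipode_inv_linear] by simp

private lemma tmS_bilinear:
  "(\<lambda>x. tensor_map K (A \<alpha>) (A \<alpha>) (\<lambda>z. \<mu> \<alpha> x (S i z)) id)
    \<in> bilinear_maps K (A \<alpha>) (T i \<alpha>) (T \<alpha> \<alpha>)"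
  by (rule tensor_map_bilinear_left[OF mod_A[OF a] mod_A[OF ii] mod_A[OF a] mod_A[OF a] mod_A[OF a]
        mS_bilinear lin_id])

private lemma tmS_pure [simp]:
  "\<lbrakk>x \<in> carrier (A \<alpha>); y \<in> carrier (A i); z \<in> carrier (A \<alpha>)\<rbrakk> \<Longrightarrow>
    tensor_map K (A \<alpha>) (A \<alpha>) (\<lambda>z. \<mu> \<alpha> x (S i z)) id (pt i \<alpha> y z) = pt \<alpha> \<alpha> (\<mu> \<alpha> x (S i y)) z"
  using tensor_map_pure[OF mod_A[OF ii] mod_A[OF a] mod_A[OF a] mod_A[OF a]
      bil_right[OF mS_bilinear] lin_id] by simp

private lemma s_bilinear:
  "(\<lambda>x y. tensor_map K (A \<alpha>) (A \<alpha>) (\<lambda>z. \<mu> \<alpha> x (S i z)) id (\<Delta> i \<alpha> y))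
    \<in> bilinear_maps K (A \<alpha>) (A u) (T \<alpha> \<alpha>)"
  using bil_pre[OF tmS_bilinear lin_id comult_i(1)] by simp

lemma s_linear: "s_map \<in> linear_maps K (T \<alpha> u) (T \<alpha> \<alpha>)"
  unfolding s_map_def
  by (rule tensor_lift_linear[OF mod_A[OF a] mod_A[OF unit_closed] mod_T[OF a a] s_bilinear])

lemma s_closed [simp]: "q \<in> carrier (T \<alpha> u) \<Longrightarrow> s_map q \<in> carrier (T \<alpha> \<alpha>)"
  by (rule lin_closed[OF s_linear])

lemma s_pure:
  "\<lbrakk>x \<in> carrier (A \<alpha>); y \<in> carrier (A u)\<rbrakk> \<Longrightarrow>
    s_map (pt \<alpha> u x y) = tensor_map K (A \<alpha>) (A \<alpha>) (\<lambda>z. \<mu> \<alpha> x (S i z)) id (\<Delta> i \<alpha> y)"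
  unfolding s_map_def
  by (rule tensor_lift_pure[OF mod_A[OF a] mod_A[OF unit_closed] mod_T[OF a a] s_bilinear])

text \<open>In Sweedler notation the composite is \<open>x S(b_1) b_2 \<otimes> b_3 = x
  \<epsilon>(b_1) \<otimes> b_2 = x \<otimes> b\<close>, by coassociativity, the left antipode axiom
  and the left counit axiom.\<close>

lemma r_s_pure:
  assumes x: "x \<in> carrier (A \<alpha>)" and b: "b \<in> carrier (A u)"
  shows "rm \<alpha> (s_map (pt \<alpha> u x b)) = pt \<alpha> u x b"
proof -
  note M = mod_A[OF a] mod_A[OF ii] mod_A[OF unit_closed] mod_T[OF a a] mod_T[OF a unit_closed]
    mod_T[OF ii a] mod_T[OF unit_closed unit_closed]
  let ?T3 = "tensor K (A i) (T \<alpha> u)"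
  let ?as = "tensor_assoc K (A i) (A \<alpha>) (A u)"
  note asl = tensor_assoc_linear[OF M(2) M(1) M(3)]
  have mS: "(\<lambda>z. \<mu> \<alpha> x (S i z)) \<in> linear_maps K (A i) (A \<alpha>)"
    by (rule bil_right[OF mS_bilinear x])
  \<comment> \<open>\<open>F\<close> sends \<open>y \<otimes> (z \<otimes> w)\<close> to
    \<open>x S(y) z \<otimes> w\<close>. It is the part of the computation that does not involve a
    coproduct.\<close>
  define F where "F = tensor_lift K (T \<alpha> u) (\<lambda>y. lmul1 \<alpha> u (\<mu> \<alpha> x (S i y)))"
  have Fb: "(\<lambda>y. lmul1 \<alpha> u (\<mu> \<alpha> x (S i y))) \<in> bilinear_maps K (A i) (T \<alpha> u) (T \<alpha> u)"
    using bil_pre[OF lmul1_bilinear[OF a unit_closed] mS lin_id] by simp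
  have Fl: "F \<in> linear_maps K ?T3 (T \<alpha> u)"
    unfolding F_def by (rule tensor_lift_linear[OF M(2) M(5) M(5) Fb])
  have Fp: "F (pure_tensor K (A i) (T \<alpha> u) y z) = lmul1 \<alpha> u (\<mu> \<alpha> x (S i y)) z"
    if "y \<in> carrier (A i)" "z \<in> carrier (T \<alpha> u)" for y z
    unfolding F_def using that by (rule tensor_lift_pure[OF M(2) M(5) M(5) Fb])
  have D: "tensor_map K (A i) (T \<alpha> u) id (\<Delta> \<alpha> u) \<in> linear_maps K (T i \<alpha>) ?T3"
    by (rule tensor_map_linear[OF M(2) M(1) M(2) M(5) lin_id comult_right_linear[OF a]])
  have 1: "rm \<alpha> (tensor_map K (A \<alpha>) (A \<alpha>) (\<lambda>z. \<mu> \<alpha> x (S i z)) id Y)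
      = F (tensor_map K (A i) (T \<alpha> u) id (\<Delta> \<alpha> u) Y)"
    if Y: "Y \<in> carrier (T i \<alpha>)" for Y
  proof (rule tensor_A_eqI[OF ii a M(5) lin_comp[OF bil_right[OF tmS_bilinear x] r_linear[OF a]]
        lin_comp[OF D Fl] _ Y])
    fix y z assume yz: "y \<in> carrier (A i)" "z \<in> carrier (A \<alpha>)"
    show "rm \<alpha> (tensor_map K (A \<alpha>) (A \<alpha>) (\<lambda>z. \<mu> \<alpha> x (S i z)) id (pt i \<alpha> y z))
        = F (tensor_map K (A i) (T \<alpha> u) id (\<Delta> \<alpha> u) (pt i \<alpha> y z))"
      using yz x a
      by (simp add: Fp tensor_map_pure[OF M(2) M(1) M(2) M(5) lin_id comult_right_linear[OF a]])
  qed
  have mS1: "tensor_map K (A \<alpha>) (A \<alpha>) (S i) id \<in> linear_maps K (T i \<alpha>) (T \<alpha> \<alpha>)"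
    by (rule tensor_map_linear[OF M(2) M(1) M(1) M(1) antipode_inv_linear lin_id])
  \<comment> \<open>Here \<open>Y\<close> takes the place of \<open>\<Delta> i \<alpha> v\<close>;
    the product \<open>S(y) z\<close> is isolated in the form to which the antipode axiom
    applies.\<close>
  have 2: "F (?as (pure_tensor K (T i \<alpha>) (A u) Y w))
      = pt \<alpha> u (\<mu> \<alpha> x (mult_map K (A \<alpha>) (tensor_map K (A \<alpha>) (A \<alpha>) (S i) id Y))) w"
    if Y: "Y \<in> carrier (T i \<alpha>)" and w: "w \<in> carrier (A u)" for Y w
  proof (rule tensor_A_eqI[OF ii a M(5)
        lin_comp[OF lin_comp[OF bil_left[OF pure_tensor_bilinear[OF M(6) M(3)] w] asl] Fl]
        lin_comp[OF lin_comp[OF lin_comp[OF mS1 mult_map_linear] bil_right[OF mult_A[OF a] x]]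
          bil_left[OF pt_bilinear[OF a unit_closed] w]] _ Y])
    fix y z assume yz: "y \<in> carrier (A i)" "z \<in> carrier (A \<alpha>)"
    show "F (?as (pure_tensor K (T i \<alpha>) (A u) (pt i \<alpha> y z) w))
      = pt \<alpha> u (\<mu> \<alpha> x (mult_map K (A \<alpha>) (tensor_map K (A \<alpha>) (A \<alpha>) (S i) id (pt i \<alpha> y z)))) w"
      using yz x a w ii
      by (simp add: tensor_assoc_pure[OF M(2) M(1) M(3)] Fp mult_A_assoc
          tensor_map_pure[OF M(2) M(1) M(1) M(1) antipode_inv_linear lin_id])
  qed
  note tl = tensor_lift_linear[OF M(3) M(3) M(3) counit_bilinear[OF unit_closed]]
  have D2: "tensor_map K (T i \<alpha>) (A u) (\<Delta> i \<alpha>) id \<in> linear_maps K (T u u) (tensor K (T i \<alpha>) (A u))"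
    by (rule tensor_map_linear[OF M(3) M(3) M(6) M(3) comult_i(1) lin_id])
  have 3: "F (?as (tensor_map K (T i \<alpha>) (A u) (\<Delta> i \<alpha>) id z))
      = pt \<alpha> u x (tensor_lift K (A u) (\<lambda>v w. \<epsilon> v \<odot>\<^bsub>A u\<^esub> w) z)"
    if z: "z \<in> carrier (T u u)" for z
  proof (rule tensor_A_eqI[OF unit_closed unit_closed M(5) lin_comp[OF lin_comp[OF D2 asl] Fl]
        lin_comp[OF tl bil_right[OF pt_bilinear[OF a unit_closed] x]] _ z])
    fix v w assume vw: "v \<in> carrier (A u)" "w \<in> carrier (A u)"
    have "F (?as (tensor_map K (T i \<alpha>) (A u) (\<Delta> i \<alpha>) id (pt u u v w)))
        = pt \<alpha> u (\<mu> \<alpha> x (\<epsilon> v \<odot>\<^bsub>A \<alpha>\<^esub> \<one>\<^bsub>A \<alpha>\<^esub>)) w"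
      using vw a lin_closed[OF comult_i(1)]
      by (simp add: tensor_map_pure[OF M(3) M(3) M(6) M(3) comult_i(1) lin_id] 2 antipode_left)
    also have "\<dots> = pt \<alpha> u (\<epsilon> v \<odot>\<^bsub>A \<alpha>\<^esub> x) w"
      using a x vw by (simp add: lin_smult[OF bil_right[OF mult_A[OF a] x]] counit_closed)
    also have "\<dots> = pt \<alpha> u x (\<epsilon> v \<odot>\<^bsub>A u\<^esub> w)"
      using a x vw
      by (simp add: lin_smult[OF bil_right[OF pt_bilinear[OF a unit_closed]]]
          lin_smult[OF bil_left[OF pt_bilinear[OF a unit_closed]]] counit_closed)
    finally show "F (?as (tensor_map K (T i \<alpha>) (A u) (\<Delta> i \<alpha>) id (pt u u v w)))
      = pt \<alpha> u x (tensor_lift K (A u) (\<lambda>v w. \<epsilon> v \<odot>\<^bsub>A u\<^esub> w) (pt u u v w))"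
      using vw by (simp add: tensor_lift_pure[OF M(3) M(3) M(3) counit_bilinear[OF unit_closed]])
  qed
  have "rm \<alpha> (s_map (pt \<alpha> u x b)) = F (tensor_map K (A i) (T \<alpha> u) id (\<Delta> \<alpha> u) (\<Delta> i \<alpha> b))"
    using 1 x b by (simp add: s_pure lin_closed[OF comult_i(1)])
  \<comment> \<open>Coassociativity for the indices \<open>i\<close>, \<open>\<alpha>\<close>,
    \<open>u\<close>: since \<open>i \<otimes> \<alpha> = u\<close>, the first two legs become the
    coproduct of one element of \<open>A u\<close>, as the antipode axiom requires.\<close>
  also have "tensor_map K (A i) (T \<alpha> u) id (\<Delta> \<alpha> u) (\<Delta> i \<alpha> b)
      = ?as (tensor_map K (T i \<alpha>) (A u) (\<Delta> i \<alpha>) id (\<Delta> u u b))"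
    using coassoc[OF ii a unit_closed, of b] a b by simp
  also have "F \<dots> = pt \<alpha> u x b"
    using 3 b counit_left[OF unit_closed b] comult_right_closed[OF unit_closed b] by simp
  finally show ?thesis .
qed

lemma r_s:
  assumes "z \<in> carrier (T \<alpha> u)"
  shows "rm \<alpha> (s_map z) = z"
  using tensor_A_eqI[OF a unit_closed mod_T[OF a unit_closed] lin_comp[OF s_linear r_linear[OF a]]
      lin_id _ assms] r_s_pure by simp

text \<open>The mirror computation \<open>x b_1 S(b_2) \<otimes> b_3 = x \<epsilon>(b_1) \<otimes>
  b_2 = x \<otimes> b\<close>, with the right antipode axiom and coassociativity for the indices
  \<open>\<alpha>\<close>, \<open>i\<close>, \<open>\<alpha>\<close>.\<close>

lemma s_r_pure:
  assumes x: "x \<in> carrier (A \<alpha>)" and b: "b \<in> carrier (A \<alpha>)"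
  shows "s_map (rm \<alpha> (pt \<alpha> \<alpha> x b)) = pt \<alpha> \<alpha> x b"
proof -
  note M = mod_A[OF a] mod_A[OF ii] mod_A[OF unit_closed] mod_T[OF a a] mod_T[OF ii a]
    mod_T[OF a ii] mod_T[OF unit_closed a]
  let ?T3 = "tensor K (A \<alpha>) (T i \<alpha>)"
  let ?as = "tensor_assoc K (A \<alpha>) (A i) (A \<alpha>)"
  note asl = tensor_assoc_linear[OF M(1) M(2) M(1)]
  let ?f = "\<lambda>y. tensor_map K (A \<alpha>) (A \<alpha>) (\<lambda>z. \<mu> \<alpha> (\<mu> \<alpha> x y) (S i z)) id"
  define F where "F = tensor_lift K (T \<alpha> \<alpha>) ?f"
  have Fb: "?f \<in> bilinear_maps K (A \<alpha>) (T i \<alpha>) (T \<alpha> \<alpha>)"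
    using bil_pre[OF tmS_bilinear bil_right[OF mult_A[OF a] x] lin_id] by simp
  have Fl: "F \<in> linear_maps K ?T3 (T \<alpha> \<alpha>)"
    unfolding F_def by (rule tensor_lift_linear[OF M(1) M(5) M(4) Fb])
  have Fp: "F (pure_tensor K (A \<alpha>) (T i \<alpha>) y z) = ?f y z"
    if "y \<in> carrier (A \<alpha>)" "z \<in> carrier (T i \<alpha>)" for y z
    unfolding F_def using that by (rule tensor_lift_pure[OF M(1) M(5) M(4) Fb])
  have D: "tensor_map K (A \<alpha>) (T i \<alpha>) id (\<Delta> i \<alpha>) \<in> linear_maps K (T \<alpha> u) ?T3"
    by (rule tensor_map_linear[OF M(1) M(3) M(1) M(5) lin_id comult_i(1)])
  have 1: "s_map (lmul1 \<alpha> u x Y) = F (tensor_map K (A \<alpha>) (T i \<alpha>) id (\<Delta> i \<alpha>) Y)"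
    if Y: "Y \<in> carrier (T \<alpha> u)" for Y
  proof (rule tensor_A_eqI[OF a unit_closed M(4)
        lin_comp[OF bil_right[OF lmul1_bilinear[OF a unit_closed] x] s_linear] lin_comp[OF D Fl] _ Y])
    fix y z assume yz: "y \<in> carrier (A \<alpha>)" "z \<in> carrier (A u)"
    show "s_map (lmul1 \<alpha> u x (pt \<alpha> u y z))
        = F (tensor_map K (A \<alpha>) (T i \<alpha>) id (\<Delta> i \<alpha>) (pt \<alpha> u y z))"
      using yz x a
      by (simp add: Fp s_pure lin_closed[OF comult_i(1)]
          tensor_map_pure[OF M(1) M(3) M(1) M(5) lin_id comult_i(1)])
  qed
  have mS1: "tensor_map K (A \<alpha>) (A \<alpha>) id (S i) \<in> linear_maps K (T \<alpha> i) (T \<alpha> \<alpha>)"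
    by (rule tensor_map_linear[OF M(1) M(2) M(1) M(1) lin_id antipode_inv_linear])
  have 2: "F (?as (pure_tensor K (T \<alpha> i) (A \<alpha>) Y w))
      = pt \<alpha> \<alpha> (\<mu> \<alpha> x (mult_map K (A \<alpha>) (tensor_map K (A \<alpha>) (A \<alpha>) id (S i) Y))) w"
    if Y: "Y \<in> carrier (T \<alpha> i)" and w: "w \<in> carrier (A \<alpha>)" for Y w
  proof (rule tensor_A_eqI[OF a ii M(4)
        lin_comp[OF lin_comp[OF bil_left[OF pure_tensor_bilinear[OF M(6) M(1)] w] asl] Fl]
        lin_comp[OF lin_comp[OF lin_comp[OF mS1 mult_map_linear] bil_right[OF mult_A[OF a] x]]
          bil_left[OF pt_bilinear[OF a a] w]] _ Y])
    fix y z assume yz: "y \<in> carrier (A \<alpha>)" "z \<in> carrier (A i)"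
    show "F (?as (pure_tensor K (T \<alpha> i) (A \<alpha>) (pt \<alpha> i y z) w))
      = pt \<alpha> \<alpha> (\<mu> \<alpha> x (mult_map K (A \<alpha>) (tensor_map K (A \<alpha>) (A \<alpha>) id (S i) (pt \<alpha> i y z)))) w"
      using yz x a w ii
      by (simp add: tensor_assoc_pure[OF M(1) M(2) M(1)] Fp mult_A_assoc
          tensor_map_pure[OF M(1) M(2) M(1) M(1) lin_id antipode_inv_linear])
  qed
  note tl = tensor_lift_linear[OF M(3) M(1) M(1) counit_bilinear[OF a]]
  have D2: "tensor_map K (T \<alpha> i) (A \<alpha>) (\<Delta> \<alpha> i) id \<in> linear_maps K (T u \<alpha>) (tensor K (T \<alpha> i) (A \<alpha>))"
    by (rule tensor_map_linear[OF M(3) M(1) M(6) M(1) comult_i(2) lin_id])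
  have 3: "F (?as (tensor_map K (T \<alpha> i) (A \<alpha>) (\<Delta> \<alpha> i) id z))
      = pt \<alpha> \<alpha> x (tensor_lift K (A \<alpha>) (\<lambda>v w. \<epsilon> v \<odot>\<^bsub>A \<alpha>\<^esub> w) z)"
    if z: "z \<in> carrier (T u \<alpha>)" for z
  proof (rule tensor_A_eqI[OF unit_closed a M(4) lin_comp[OF lin_comp[OF D2 asl] Fl]
        lin_comp[OF tl bil_right[OF pt_bilinear[OF a a] x]] _ z])
    fix v w assume vw: "v \<in> carrier (A u)" "w \<in> carrier (A \<alpha>)"
    have "F (?as (tensor_map K (T \<alpha> i) (A \<alpha>) (\<Delta> \<alpha> i) id (pt u \<alpha> v w)))
        = pt \<alpha> \<alpha> (\<mu> \<alpha> x (\<epsilon> v \<odot>\<^bsub>A \<alpha>\<^esub> \<one>\<^bsub>A \<alpha>\<^esub>)) w"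
      using vw a lin_closed[OF comult_i(2)]
      by (simp add: tensor_map_pure[OF M(3) M(1) M(6) M(1) comult_i(2) lin_id] 2 antipode_right)
    also have "\<dots> = pt \<alpha> \<alpha> (\<epsilon> v \<odot>\<^bsub>A \<alpha>\<^esub> x) w"
      using a x vw by (simp add: lin_smult[OF bil_right[OF mult_A[OF a] x]] counit_closed)
    also have "\<dots> = pt \<alpha> \<alpha> x (\<epsilon> v \<odot>\<^bsub>A \<alpha>\<^esub> w)"
      using a x vw
      by (simp add: lin_smult[OF bil_right[OF pt_bilinear[OF a a]]]
          lin_smult[OF bil_left[OF pt_bilinear[OF a a]]] counit_closed)
    finally show "F (?as (tensor_map K (T \<alpha> i) (A \<alpha>) (\<Delta> \<alpha> i) id (pt u \<alpha> v w)))
      = pt \<alpha> \<alpha> x (tensor_lift K (A \<alpha>) (\<lambda>v w. \<epsilon> v \<odot>\<^bsub>A \<alpha>\<^esub> w) (pt u \<alpha> v w))"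
      using vw by (simp add: tensor_lift_pure[OF M(3) M(1) M(1) counit_bilinear[OF a]])
  qed
  have "s_map (rm \<alpha> (pt \<alpha> \<alpha> x b)) = F (tensor_map K (A \<alpha>) (T i \<alpha>) id (\<Delta> i \<alpha>) (\<Delta> \<alpha> u b))"
    using 1 x b a by simp
  also have "tensor_map K (A \<alpha>) (T i \<alpha>) id (\<Delta> i \<alpha>) (\<Delta> \<alpha> u b)
      = ?as (tensor_map K (T \<alpha> i) (A \<alpha>) (\<Delta> \<alpha> i) id (\<Delta> u \<alpha> b))"
    using coassoc[OF a ii a, of b] a b by simp
  also have "F \<dots> = pt \<alpha> \<alpha> x b"
    using 3 b counit_left[OF a b] comult_left_closed[OF a b] by simp
  finally show ?thesis .
qed

lemma s_r:
  assumes "z \<in> carrier (T \<alpha> \<alpha>)"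
  shows "s_map (rm \<alpha> z) = z"
  using tensor_A_eqI[OF a a mod_T[OF a a] lin_comp[OF r_linear[OF a] s_linear]
      lin_id _ assms] s_r_pure by simp

lemma r_bij: "bij_betw (rm \<alpha>) (carrier (T \<alpha> \<alpha>)) (carrier (T \<alpha> u))"
  by (rule bij_betw_byWitness[where f' = s_map]) (auto simp: a s_r r_s)

lemma r_inv_eq: "z \<in> carrier (T \<alpha> u) \<Longrightarrow> r_inv K G A \<Delta> \<alpha> z = s_map z"
  unfolding r_inv_def
  by (rule inv_into_f_eq[OF bij_betw_imp_inj_on[OF r_bij]]) (simp_all add: r_s)

end

abbreviation ri :: "'g \<Rightarrow> ('k, 'a, 'a) tens \<Rightarrow> ('k, 'a, 'a) tens"
  where "ri \<equiv> r_inv K G A \<Delta>"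

text \<open>\<open>r_inv\<close> is given by choice through \<open>inv_into\<close>, so its
  linearity is transported from \<open>s_map\<close>.\<close>

lemma r_inv_linear: "\<alpha> \<in> carrier G \<Longrightarrow> ri \<alpha> \<in> linear_maps K (T \<alpha> u) (T \<alpha> \<alpha>)"
  by (rule lin_cong[OF mod_T[OF _ unit_closed] s_linear r_inv_eq])

lemma r_inv_closed [simp]:
  "\<lbrakk>\<alpha> \<in> carrier G; z \<in> carrier (T \<alpha> u)\<rbrakk> \<Longrightarrow> ri \<alpha> z \<in> carrier (T \<alpha> \<alpha>)"
  by (rule lin_closed[OF r_inv_linear])

lemma r_r_inv [simp]: "\<lbrakk>\<alpha> \<in> carrier G; z \<in> carrier (T \<alpha> u)\<rbrakk> \<Longrightarrow> rm \<alpha> (ri \<alpha> z) = z"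
  by (simp add: r_inv_eq r_s)

lemma r_inv_r [simp]: "\<lbrakk>\<alpha> \<in> carrier G; z \<in> carrier (T \<alpha> \<alpha>)\<rbrakk> \<Longrightarrow> ri \<alpha> (rm \<alpha> z) = z"
  by (simp add: r_inv_eq s_r)

section \<open>Compatibility of the Galois maps with the coproduct\<close>

context
  fixes \<alpha> \<beta>
  assumes a: "\<alpha> \<in> carrier G" and b: "\<beta> \<in> carrier G"
begin

private abbreviation (input) "\<gamma> \<equiv> \<alpha> \<otimes>\<^bsub>G\<^esub> \<beta>"

private lemma c: "\<gamma> \<in> carrier G" using a b by simp

private lemmas Me = mod_A[OF a] mod_A[OF b] mod_A[OF c] mod_A[OF unit_closed]
  mod_T[OF a b] mod_T[OF b b] mod_T[OF b unit_closed] mod_T[OF a unit_closed] mod_T[OF unit_closed b]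

private abbreviation (input) "TT \<equiv> tensor K (A \<alpha>) (T \<beta> \<beta>)"
private abbreviation (input) "TU \<equiv> tensor K (A \<alpha>) (T \<beta> u)"
private abbreviation (input) "UT \<equiv> tensor K (A \<alpha>) (T u \<beta>)"

private lemma M_TT: "module K TT" "module K TU" "module K UT"
  by (intro module_tensor Me)+

text \<open>In Sweedler notation \<open>expand (a \<otimes> b) = a\<^sub>1 b\<^sub>1 \<otimes> (a\<^sub>2 \<otimes> b\<^sub>2)\<close>.\<close>

definition pair3 :: "('k, 'a, 'a) tens \<Rightarrow> ('k, 'a, 'a) tens \<Rightarrow> ('k, 'a, ('k, 'a, 'a) tens) tens"
  where "pair3 = tensor_map2 K (A \<alpha>) (T \<beta> \<beta>) (\<mu> \<alpha>) (pt \<beta> \<beta>)"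

definition expand :: "('k, 'a, 'a) tens \<Rightarrow> ('k, 'a, ('k, 'a, 'a) tens) tens"
  where "expand = tensor_lift K (tensor K (A \<alpha>) (T \<beta> \<beta>))
    (\<lambda>x y. pair3 (\<Delta> \<alpha> \<beta> x) (\<Delta> \<alpha> \<beta> y))"

lemma pair3_bilinear: "pair3 \<in> bilinear_maps K (T \<alpha> \<beta>) (T \<alpha> \<beta>) TT"
  unfolding pair3_def
  by (rule tensor_map2_bilinear[OF Me(1,2,1,2,1,6) mult_A[OF a] pt_bilinear[OF b b]])

lemma pair3_pure [simp]:
  "\<lbrakk>x \<in> carrier (A \<alpha>); y \<in> carrier (A \<beta>); x' \<in> carrier (A \<alpha>); y' \<in> carrier (A \<beta>)\<rbrakk> \<Longrightarrow>
    pair3 (pt \<alpha> \<beta> x y) (pt \<alpha> \<beta> x' y')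
      = pure_tensor K (A \<alpha>) (T \<beta> \<beta>) (\<mu> \<alpha> x x') (pt \<beta> \<beta> y y')"
  unfolding pair3_def
  by (rule tensor_map2_pure[OF Me(1,2,1,2,1,6) mult_A[OF a] pt_bilinear[OF b b]])

private lemma expand_bilinear:
  "(\<lambda>x y. pair3 (\<Delta> \<alpha> \<beta> x) (\<Delta> \<alpha> \<beta> y)) \<in> bilinear_maps K (A \<gamma>) (A \<gamma>) TT"
  by (rule bil_pre[OF pair3_bilinear comult_linear[OF a b] comult_linear[OF a b]])

lemma expand_linear: "expand \<in> linear_maps K (T \<gamma> \<gamma>) TT"
  unfolding expand_def by (rule tensor_lift_linear[OF Me(3,3) M_TT(1) expand_bilinear])

lemma expand_pure:
  "\<lbrakk>x \<in> carrier (A \<gamma>); y \<in> carrier (A \<gamma>)\<rbrakk> \<Longrightarrow>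
    expand (pt \<gamma> \<gamma> x y) = pair3 (\<Delta> \<alpha> \<beta> x) (\<Delta> \<alpha> \<beta> y)"
  unfolding expand_def by (rule tensor_lift_pure[OF Me(3,3) M_TT(1) expand_bilinear])

text \<open>On \<open>a \<otimes> b\<close> both sides equal
  \<open>a_1 b_1 \<otimes> (a_2 b_2 \<otimes> b_3)\<close>: the left one after splitting
  \<open>b_2\<close>, the right one by applying \<open>\<Delta>\<close> to the product
  \<open>a b_1\<close>.\<close>

lemma r_expand:
  assumes q: "q \<in> carrier (T \<gamma> \<gamma>)"
  shows "tensor_map K (A \<alpha>) (T \<beta> u) id (rm \<beta>) (expand q)
    = tensor_assoc K (A \<alpha>) (A \<beta>) (A u) (tensor_map K (T \<alpha> \<beta>) (A u) (\<Delta> \<alpha> \<beta>) id (rm \<gamma> q))"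
proof -
  let ?as = "tensor_assoc K (A \<alpha>) (A \<beta>) (A u)"
  \<comment> \<open>\<open>?h X\<close> multiplies the first two of three tensor legs by
    \<open>X\<close> from the left and leaves the leg in \<open>A u\<close> alone.\<close>
  let ?h = "tensor_map2 K (A \<alpha>) (T \<beta> u) (\<mu> \<alpha>) (lmul1 \<beta> u)"
  note asl = tensor_assoc_linear[OF Me(1,2,4)]
  note hb = tensor_map2_bilinear[OF Me(1,2,1,7,1,7) mult_A[OF a] lmul1_bilinear[OF b unit_closed]]
  note hp = tensor_map2_pure[OF Me(1,2,1,7,1,7) mult_A[OF a] lmul1_bilinear[OF b unit_closed]]
  note idr = tensor_map_linear[OF Me(1,6,1,7) lin_id r_linear[OF b]]
  note D = tensor_map_linear[OF Me(1,2,1,7) lin_id comult_right_linear[OF b]]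
  note D2 = tensor_map_linear[OF Me(3,4,5,4) comult_linear[OF a b] lin_id]
  have 1: "tensor_map K (A \<alpha>) (T \<beta> u) id (rm \<beta>) (pair3 X Y)
      = ?h X (tensor_map K (A \<alpha>) (T \<beta> u) id (\<Delta> \<beta> u) Y)"
    if "X \<in> carrier (T \<alpha> \<beta>)" "Y \<in> carrier (T \<alpha> \<beta>)" for X Y
  proof (rule tensor_bilinear_eqI[OF Me(1,2,1,2) M_TT(2) bil_post[OF pair3_bilinear idr] _ _ that])
    show "(\<lambda>X Y. ?h X (tensor_map K (A \<alpha>) (T \<beta> u) id (\<Delta> \<beta> u) Y))
        \<in> bilinear_maps K (T \<alpha> \<beta>) (T \<alpha> \<beta>) TU"
      using bil_pre[OF hb lin_id D] by simp
    show "tensor_map K (A \<alpha>) (T \<beta> u) id (rm \<beta>) (pair3 (pt \<alpha> \<beta> x y) (pt \<alpha> \<beta> x' y'))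
        = ?h (pt \<alpha> \<beta> x y) (tensor_map K (A \<alpha>) (T \<beta> u) id (\<Delta> \<beta> u) (pt \<alpha> \<beta> x' y'))"
      if "x \<in> carrier (A \<alpha>)" "y \<in> carrier (A \<beta>)" "x' \<in> carrier (A \<alpha>)" "y' \<in> carrier (A \<beta>)"
      for x y x' y'
      using that a b
      by (simp add: hp tensor_map_pure[OF Me(1,6,1,7) lin_id r_linear[OF b]]
          tensor_map_pure[OF Me(1,2,1,7) lin_id comult_right_linear[OF b]])
  qed
  \<comment> \<open>Acting by \<open>X\<close> after reassociation is the product of
    \<open>X\<close> with the pair \<open>Y\<close> before it. In this form
    \<open>comult_mult\<close> can merge two coproducts into that of a product.\<close>
  have 2: "?h X (?as (pure_tensor K (T \<alpha> \<beta>) (A u) Y w))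
      = ?as (pure_tensor K (T \<alpha> \<beta>) (A u) (tensor_map2 K (A \<alpha>) (A \<beta>) (\<mu> \<alpha>) (\<mu> \<beta>) X Y) w)"
    if XY: "X \<in> carrier (T \<alpha> \<beta>)" "Y \<in> carrier (T \<alpha> \<beta>)" and w: "w \<in> carrier (A u)" for X Y w
  proof -
    note pl = lin_comp[OF bil_left[OF pure_tensor_bilinear[OF Me(5,4)] w] asl]
    show ?thesis
    proof (rule tensor_bilinear_eqI[OF Me(1,2,1,2) M_TT(2) _
          bil_post[OF mult_T_bilinear[OF a b] pl] _ XY])
      show "(\<lambda>X Y. ?h X (?as (pure_tensor K (T \<alpha> \<beta>) (A u) Y w)))
          \<in> bilinear_maps K (T \<alpha> \<beta>) (T \<alpha> \<beta>) TU"
        using bil_pre[OF hb lin_id pl] by simp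
      show "?h (pt \<alpha> \<beta> x y) (?as (pure_tensor K (T \<alpha> \<beta>) (A u) (pt \<alpha> \<beta> x' y') w))
        = ?as (pure_tensor K (T \<alpha> \<beta>) (A u)
            (tensor_map2 K (A \<alpha>) (A \<beta>) (\<mu> \<alpha>) (\<mu> \<beta>) (pt \<alpha> \<beta> x y) (pt \<alpha> \<beta> x' y')) w)"
        if "x \<in> carrier (A \<alpha>)" "y \<in> carrier (A \<beta>)" "x' \<in> carrier (A \<alpha>)" "y' \<in> carrier (A \<beta>)"
        for x y x' y'
        using that w a b by (simp add: hp tensor_assoc_pure[OF Me(1,2,4)])
    qed
  qed
  have 3: "?h (\<Delta> \<alpha> \<beta> x) (?as (tensor_map K (T \<alpha> \<beta>) (A u) (\<Delta> \<alpha> \<beta>) id z))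
      = ?as (tensor_map K (T \<alpha> \<beta>) (A u) (\<Delta> \<alpha> \<beta>) id (lmul1 \<gamma> u x z))"
    if x: "x \<in> carrier (A \<gamma>)" and z: "z \<in> carrier (T \<gamma> u)" for x z
  proof (rule tensor_A_eqI[OF c unit_closed M_TT(2)
        lin_comp[OF lin_comp[OF D2 asl] bil_right[OF hb comult_closed[OF a b x]]]
        lin_comp[OF lin_comp[OF bil_right[OF lmul1_bilinear[OF c unit_closed] x] D2] asl] _ z])
    fix y w assume "y \<in> carrier (A \<gamma>)" "w \<in> carrier (A u)"
    then show "?h (\<Delta> \<alpha> \<beta> x) (?as (tensor_map K (T \<alpha> \<beta>) (A u) (\<Delta> \<alpha> \<beta>) id (pt \<gamma> u y w)))
      = ?as (tensor_map K (T \<alpha> \<beta>) (A u) (\<Delta> \<alpha> \<beta>) id (lmul1 \<gamma> u x (pt \<gamma> u y w)))"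
      using x a b by (simp add: tensor_map_pure[OF Me(3,4,5,4) comult_linear[OF a b] lin_id]
          comult_mult 2)
  qed
  show ?thesis
  proof (rule tensor_A_eqI[OF c c M_TT(2) lin_comp[OF expand_linear idr]
        lin_comp[OF lin_comp[OF r_linear[OF c] D2] asl] _ q])
    fix x y assume xy: "x \<in> carrier (A \<gamma>)" "y \<in> carrier (A \<gamma>)"
    have "tensor_map K (A \<alpha>) (T \<beta> u) id (\<Delta> \<beta> u) (\<Delta> \<alpha> \<beta> y)
        = ?as (tensor_map K (T \<alpha> \<beta>) (A u) (\<Delta> \<alpha> \<beta>) id (\<Delta> \<gamma> u y))"
      using coassoc[OF a b unit_closed, of y] xy a b c by simp
    then show "tensor_map K (A \<alpha>) (T \<beta> u) id (rm \<beta>) (expand (pt \<gamma> \<gamma> x y))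
      = ?as (tensor_map K (T \<alpha> \<beta>) (A u) (\<Delta> \<alpha> \<beta>) id (rm \<gamma> (pt \<gamma> \<gamma> x y)))"
      using xy a b c by (simp add: expand_pure 1 3)
  qed
qed

text \<open>Membership of \<open>expand q\<close> in \<open>A \<alpha> \<otimes> N \<beta>\<close>
  is phrased through linear maps \<open>f\<close> that send the generators of that space into
  \<open>H\<close>. Both covariance arguments use it with \<open>H\<close> the zero submodule and
  \<open>f\<close> the map to be annihilated.\<close>

lemma expand_image:
  assumes R: "R \<subseteq> carrier (A u)" and q: "q \<in> carrier (T \<gamma> \<gamma>)"
    and rq: "rm \<gamma> q \<in> tensor_sub K (A \<gamma>) (A u) (carrier (A \<gamma>)) R"
    and f: "f \<in> linear_maps K TT P" and P: "module K P" and H: "submodule H K P"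
    and gen: "\<And>x y z. \<lbrakk>x \<in> carrier (A \<alpha>); y \<in> carrier (A \<beta>); z \<in> R\<rbrakk> \<Longrightarrow>
      f (pure_tensor K (A \<alpha>) (T \<beta> \<beta>) x (ri \<beta> (pt \<beta> u y z))) \<in> H"
  shows "f (expand q) \<in> H"
proof -
  let ?as = "tensor_assoc K (A \<alpha>) (A \<beta>) (A u)"
  let ?D = "tensor_map K (T \<alpha> \<beta>) (A u) (\<Delta> \<alpha> \<beta>) id"
  let ?i = "tensor_map K (A \<alpha>) (T \<beta> \<beta>) id (ri \<beta>)"
  note asl = tensor_assoc_linear[OF Me(1,2,4)]
  note D2 = tensor_map_linear[OF Me(3,4,5,4) comult_linear[OF a b] lin_id]
  note idr = tensor_map_linear[OF Me(1,6,1,7) lin_id r_linear[OF b]]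
  note idi = tensor_map_linear[OF Me(1,7,1,6) lin_id r_inv_linear[OF b]]
  \<comment> \<open>Inverting \<open>id \<otimes> r\<close> recovers \<open>expand q\<close> from
    the right-hand side of \<open>r_expand\<close>, where the assumption on
    \<open>rm \<gamma> q\<close> can be used.\<close>
  have ir: "?i (tensor_map K (A \<alpha>) (T \<beta> u) id (rm \<beta>) z) = z" if z: "z \<in> carrier TT" for z
  proof -
    have "?i (tensor_map K (A \<alpha>) (T \<beta> u) id (rm \<beta>) z) = id z"
    proof (rule tensor_eqI[OF Me(1,6) M_TT(1) lin_comp[OF idr idi] lin_id _ z])
      fix v w assume "v \<in> carrier (A \<alpha>)" "w \<in> carrier (T \<beta> \<beta>)"
      then show "?i (tensor_map K (A \<alpha>) (T \<beta> u) id (rm \<beta>) (pure_tensor K (A \<alpha>) (T \<beta> \<beta>) v w))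
        = id (pure_tensor K (A \<alpha>) (T \<beta> \<beta>) v w)"
        using b by (simp add: tensor_map_pure[OF Me(1,6,1,7) lin_id r_linear[OF b]]
            tensor_map_pure[OF Me(1,7,1,6) lin_id r_inv_linear[OF b]])
    qed
    then show ?thesis by simp
  qed
  have "f (?i (?as (?D (rm \<gamma> q)))) \<in> H"
  proof (rule tensor_sub_image[OF Me(3,4) subset_refl R P _ H _ rq])
    show "(\<lambda>z. f (?i (?as (?D z)))) \<in> linear_maps K (T \<gamma> u) P"
      by (rule lin_comp[OF lin_comp[OF lin_comp[OF D2 asl] idi] f])
    fix s t assume s: "s \<in> carrier (A \<gamma>)" and t: "t \<in> R"
    then have t': "t \<in> carrier (A u)" using R by auto
    \<comment> \<open>Only the first leg of a generator \<open>s \<otimes> t\<close> is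
      comultiplied, so \<open>t\<close> stays in \<open>R\<close>. The coproduct of \<open>s\<close>
      is replaced by an arbitrary \<open>Y\<close>, which may be taken pure.\<close>
    have "f (?i (?as (pure_tensor K (T \<alpha> \<beta>) (A u) Y t))) \<in> H" if Y: "Y \<in> carrier (T \<alpha> \<beta>)" for Y
    proof (rule tensor_image[OF Me(1,2) P _ H _ Y])
      show "(\<lambda>Y. f (?i (?as (pure_tensor K (T \<alpha> \<beta>) (A u) Y t)))) \<in> linear_maps K (T \<alpha> \<beta>) P"
        by (rule lin_comp[OF lin_comp[OF lin_comp[OF bil_left[OF pure_tensor_bilinear[OF Me(5,4)] t']
                asl] idi] f])
      show "f (?i (?as (pure_tensor K (T \<alpha> \<beta>) (A u) (pt \<alpha> \<beta> v w) t))) \<in> H"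
        if "v \<in> carrier (A \<alpha>)" "w \<in> carrier (A \<beta>)" for v w
        using that t t' gen b
        by (simp add: tensor_assoc_pure[OF Me(1,2,4)]
            tensor_map_pure[OF Me(1,7,1,6) lin_id r_inv_linear[OF b]])
    qed
    from this[OF comult_closed[OF a b s]]
    show "f (?i (?as (?D (pt \<gamma> u s t)))) \<in> H"
      using s t' by (simp add: tensor_map_pure[OF Me(3,4,5,4) comult_linear[OF a b] lin_id])
  qed
  moreover have "?i (?as (?D (rm \<gamma> q))) = expand q"
    using ir[OF lin_closed[OF expand_linear q]] r_expand[OF q] by simp
  ultimately show ?thesis by simp
qed

end

end


section \<open>The universal bimodule\<close>

context hopf_group_coalgebra
begin

abbreviation rmul2 :: "'g \<Rightarrow> 'g \<Rightarrow> 'a \<Rightarrow> ('k, 'a, 'a) tens \<Rightarrow> ('k, 'a, 'a) tens"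
  where "rmul2 \<alpha> \<beta> b \<equiv> tensor_map K (A \<alpha>) (A \<beta>) id (\<lambda>y. \<mu> \<beta> y b)"

abbreviation U :: "'g \<Rightarrow> ('k, 'a, ('k, 'a, 'a) tens) bimod"
  where "U \<alpha> \<equiv> universal_bimod K (A \<alpha>)"

context
  fixes \<alpha>
  assumes a: "\<alpha> \<in> carrier G"
begin

private lemmas Mu = mod_A[OF a] mod_T[OF a a]

interpretation T: module K "T \<alpha> \<alpha>" by (rule Mu(2))

lemma rmul2_bilinear: "rmul2 \<alpha> \<alpha> \<in> bilinear_maps K (A \<alpha>) (T \<alpha> \<alpha>) (T \<alpha> \<alpha>)"
  using tensor_map_bilinear_right[OF Mu(1) Mu(1) Mu(1) Mu(1) Mu(1) lin_id bil_flip[OF mult_A[OF a]]] .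

lemma rmul2_pure [simp]:
  "\<lbrakk>x \<in> carrier (A \<alpha>); y \<in> carrier (A \<alpha>); z \<in> carrier (A \<alpha>)\<rbrakk> \<Longrightarrow>
    rmul2 \<alpha> \<alpha> x (pt \<alpha> \<alpha> y z) = pt \<alpha> \<alpha> y (\<mu> \<alpha> z x)"
  by (simp add: tensor_map_pure[OF Mu(1) Mu(1) Mu(1) Mu(1) lin_id bil_left[OF mult_A[OF a]]])

lemma mult_map_lmul1:
  assumes x: "x \<in> carrier (A \<alpha>)" and q: "q \<in> carrier (T \<alpha> \<alpha>)"
  shows "mult_map K (A \<alpha>) (lmul1 \<alpha> \<alpha> x q) = \<mu> \<alpha> x (mult_map K (A \<alpha>) q)"
  by (rule tensor_A_eqI[OF a a Mu(1)
        lin_comp[OF bil_right[OF lmul1_bilinear[OF a a] x] mult_map_linear[OF a]]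
        lin_comp[OF mult_map_linear[OF a] bil_right[OF mult_A[OF a] x]] _ q])
    (simp add: a x mult_A_assoc)

lemma mult_map_rmul2:
  assumes x: "x \<in> carrier (A \<alpha>)" and q: "q \<in> carrier (T \<alpha> \<alpha>)"
  shows "mult_map K (A \<alpha>) (rmul2 \<alpha> \<alpha> x q) = \<mu> \<alpha> (mult_map K (A \<alpha>) q) x"
  by (rule tensor_A_eqI[OF a a Mu(1)
        lin_comp[OF bil_right[OF rmul2_bilinear x] mult_map_linear[OF a]]
        lin_comp[OF mult_map_linear[OF a] bil_left[OF mult_A[OF a] x]] _ q])
    (simp add: a x mult_A_assoc)

lemma carrier_U: "carrier (U \<alpha>) = {q \<in> carrier (T \<alpha> \<alpha>). mult_map K (A \<alpha>) q = \<zero>\<^bsub>A \<alpha>\<^esub>}"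
  and zero_U: "\<zero>\<^bsub>U \<alpha>\<^esub> = \<zero>\<^bsub>T \<alpha> \<alpha>\<^esub>"
  and add_U: "add (U \<alpha>) = add (T \<alpha> \<alpha>)"
  and smult_U: "smult (U \<alpha>) = smult (T \<alpha> \<alpha>)"
  and lact_U: "lact (U \<alpha>) = lmul1 \<alpha> \<alpha>"
  and ract_U: "ract (U \<alpha>) q x = rmul2 \<alpha> \<alpha> x q"
  by (simp_all add: universal_bimod_def)

lemma U_submodule: "submodule (carrier (U \<alpha>)) K (T \<alpha> \<alpha>)"
  using submodule_preimage[OF Mu(2,1) mult_map_linear[OF a] submodule_zero[OF Mu(1)]]
  by (simp add: carrier_U)

lemma U_carrierD: "q \<in> carrier (U \<alpha>) \<Longrightarrow> q \<in> carrier (T \<alpha> \<alpha>)"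
  by (simp add: carrier_U)

lemma module_U: "module K (U \<alpha>)"
proof -
  note E = T.submoduleE[OF U_submodule]
  have 0: "\<zero>\<^bsub>T \<alpha> \<alpha>\<^esub> \<in> carrier (U \<alpha>)"
    using submodule.axioms(1)[OF U_submodule] by (auto dest: subgroup.one_closed)
  have "abelian_group (U \<alpha>)"
  proof (rule abelian_groupI; unfold zero_U add_U)
    show "\<exists>y\<in>carrier (U \<alpha>). y \<oplus>\<^bsub>T \<alpha> \<alpha>\<^esub> q = \<zero>\<^bsub>T \<alpha> \<alpha>\<^esub>" if q: "q \<in> carrier (U \<alpha>)" for q
      using T.l_neg[OF U_carrierD[OF q]] E(3)[OF q] by (rule bexI)
  qed (use 0 in \<open>simp_all add: E(5) U_carrierD T.a_ac\<close>)
  then show ?thesis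
    by (rule moduleI[OF cring_axioms]; unfold zero_U add_U smult_U)
      (auto dest!: U_carrierD simp: E(4) T.smult_l_distr T.smult_r_distr T.smult_assoc1)
qed

end

lemma bimodule_U:
  assumes a: "\<alpha> \<in> carrier G"
  shows "bimodule K (A \<alpha>) (U \<alpha>)"
proof -
  note ll = bil_left[OF lmul1_bilinear[OF a a]] and lr = bil_right[OF lmul1_bilinear[OF a a]]
  note rl = bil_left[OF rmul2_bilinear[OF a]] and rr = bil_right[OF rmul2_bilinear[OF a]]
  note M = mod_A[OF a] mod_T[OF a a]
  have id_l: "lmul1 \<alpha> \<alpha> \<one>\<^bsub>A \<alpha>\<^esub> q = q" if q: "q \<in> carrier (T \<alpha> \<alpha>)" for q
    using tensor_A_eqI[OF a a M(2) lr[OF one_A_closed[OF a]] lin_id _ q] a by simp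
  have id_r: "rmul2 \<alpha> \<alpha> \<one>\<^bsub>A \<alpha>\<^esub> q = q" if q: "q \<in> carrier (T \<alpha> \<alpha>)" for q
    using tensor_A_eqI[OF a a M(2) rr[OF one_A_closed[OF a]] lin_id _ q] a by simp
  have rmul2_mult: "rmul2 \<alpha> \<alpha> (\<mu> \<alpha> x y) q = rmul2 \<alpha> \<alpha> y (rmul2 \<alpha> \<alpha> x q)"
    if "x \<in> carrier (A \<alpha>)" "y \<in> carrier (A \<alpha>)" and q: "q \<in> carrier (T \<alpha> \<alpha>)" for x y q
    by (rule tensor_A_eqI[OF a a M(2) rr[OF mult_A_closed[OF a that(1,2)]]
          lin_comp[OF rr[OF that(1)] rr[OF that(2)]] _ q])
      (simp add: a that mult_A_assoc)
  have lr_comm: "rmul2 \<alpha> \<alpha> y (lmul1 \<alpha> \<alpha> x q) = lmul1 \<alpha> \<alpha> x (rmul2 \<alpha> \<alpha> y q)"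
    if "x \<in> carrier (A \<alpha>)" "y \<in> carrier (A \<alpha>)" and q: "q \<in> carrier (T \<alpha> \<alpha>)" for x y q
    by (rule tensor_A_eqI[OF a a M(2) lin_comp[OF lr[OF that(1)] rr[OF that(2)]]
          lin_comp[OF rr[OF that(2)] lr[OF that(1)]] _ q])
      (simp add: a that)
  have lU: "lmul1 \<alpha> \<alpha> x q \<in> carrier (U \<alpha>)" if "x \<in> carrier (A \<alpha>)" "q \<in> carrier (U \<alpha>)" for x q
    using that lin_closed[OF lr] lin_zero[OF M(1,1) bil_right[OF mult_A[OF a]]]
    by (simp add: carrier_U[OF a] mult_map_lmul1[OF a])
  have rU: "rmul2 \<alpha> \<alpha> x q \<in> carrier (U \<alpha>)" if "x \<in> carrier (A \<alpha>)" "q \<in> carrier (U \<alpha>)" for x q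
    using that lin_closed[OF rr] lin_zero[OF M(1,1) bil_left[OF mult_A[OF a]]]
    by (simp add: carrier_U[OF a] mult_map_rmul2[OF a])
  note UT = U_carrierD[OF a]
  show ?thesis
    by (intro bimodule.intro bimodule_axioms.intro algebra_A[OF a] module_U[OF a];
        unfold add_U[OF a] smult_U[OF a] lact_U[OF a] ract_U[OF a])
      (simp_all add: lU rU UT id_l id_r lmul1_mult[OF a a] rmul2_mult lr_comm
        lin_add[OF ll] lin_add[OF lr] lin_add[OF rl] lin_add[OF rr]
        lin_smult[OF ll] lin_smult[OF lr] lin_smult[OF rl] lin_smult[OF rr])
qed

text \<open>The counit axiom gives \<open>a b_1 \<epsilon>(b_2) = a b\<close>. Hence a tensor that
  \<open>r\<close> sends into \<open>A \<otimes> R\<close>, with \<open>R\<close> in the kernel of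
  the counit, has product zero; this puts \<open>N \<alpha>\<close> inside
  \<open>U \<alpha>\<close>.\<close>

lemma counit_r:
  assumes a: "\<alpha> \<in> carrier G" and q: "q \<in> carrier (T \<alpha> \<alpha>)"
  shows "tensor_lift K (A \<alpha>) (\<lambda>x y. \<epsilon> y \<odot>\<^bsub>A \<alpha>\<^esub> x) (rm \<alpha> q) = mult_map K (A \<alpha>) q"
proof -
  let ?E = "tensor_lift K (A \<alpha>) (\<lambda>x y. \<epsilon> y \<odot>\<^bsub>A \<alpha>\<^esub> x)"
  note M = mod_A[OF a] mod_A[OF unit_closed]
  note Eb = bil_flip[OF counit_bilinear[OF a]]
  note El = tensor_lift_linear[OF M(1,2,1) Eb]
  show ?thesis
  proof (rule tensor_A_eqI[OF a a M(1) lin_comp[OF r_linear[OF a] El] mult_map_linear[OF a] _ q])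
    fix x y assume xy: "x \<in> carrier (A \<alpha>)" "y \<in> carrier (A \<alpha>)"
    have "?E (lmul1 \<alpha> u x z) = \<mu> \<alpha> x (?E z)" if z: "z \<in> carrier (T \<alpha> u)" for z
    proof (rule tensor_A_eqI[OF a unit_closed M(1)
          lin_comp[OF bil_right[OF lmul1_bilinear[OF a unit_closed] xy(1)] El]
          lin_comp[OF El bil_right[OF mult_A[OF a] xy(1)]] _ z])
      fix v w assume "v \<in> carrier (A \<alpha>)" "w \<in> carrier (A u)"
      then show "?E (lmul1 \<alpha> u x (pt \<alpha> u v w)) = \<mu> \<alpha> x (?E (pt \<alpha> u v w))"
        using xy a by (simp add: tensor_lift_pure[OF M(1,2,1) Eb] counit_closed
            lin_smult[OF bil_right[OF mult_A[OF a] xy(1)]])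
    qed
    then show "?E (rm \<alpha> (pt \<alpha> \<alpha> x y)) = mult_map K (A \<alpha>) (pt \<alpha> \<alpha> x y)"
      using xy a counit_right[OF a xy(2)] by simp
  qed
qed

text \<open>Multiplicativity of \<open>\<Delta>\<close> turns right multiplication by
  \<open>x\<close> into right multiplication by \<open>\<Delta> \<alpha> u x\<close>. This is where
  the right ideal property of \<open>R\<close> will make \<open>N \<alpha>\<close> stable on the
  right.\<close>

lemma r_rmul2:
  assumes a: "\<alpha> \<in> carrier G" and x: "x \<in> carrier (A \<alpha>)" and q: "q \<in> carrier (T \<alpha> \<alpha>)"
  shows "rm \<alpha> (rmul2 \<alpha> \<alpha> x q)
    = tensor_map2 K (A \<alpha>) (A u) (\<mu> \<alpha>) (\<mu> u) (rm \<alpha> q) (\<Delta> \<alpha> u x)"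
proof -
  let ?m = "tensor_map2 K (A \<alpha>) (A u) (\<mu> \<alpha>) (\<mu> u)"
  note M = mod_A[OF a] mod_A[OF unit_closed] mod_T[OF a unit_closed]
  note mb = mult_T_bilinear[OF a unit_closed]
  note lb = lmul1_bilinear[OF a unit_closed]
  have 1: "lmul1 \<alpha> u y (?m Z X) = ?m (lmul1 \<alpha> u y Z) X"
    if y: "y \<in> carrier (A \<alpha>)" and ZX: "Z \<in> carrier (T \<alpha> u)" "X \<in> carrier (T \<alpha> u)" for y Z X
  proof (rule tensor_bilinear_eqI[OF M(1,2,1,2,3) bil_post[OF mb bil_right[OF lb y]] _ _ ZX])
    show "(\<lambda>Z X. ?m (lmul1 \<alpha> u y Z) X) \<in> bilinear_maps K (T \<alpha> u) (T \<alpha> u) (T \<alpha> u)"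
      using bil_pre[OF mb bil_right[OF lb y] lin_id] by simp
    show "lmul1 \<alpha> u y (?m (pt \<alpha> u v w) (pt \<alpha> u v' w')) = ?m (lmul1 \<alpha> u y (pt \<alpha> u v w)) (pt \<alpha> u v' w')"
      if "v \<in> carrier (A \<alpha>)" "w \<in> carrier (A u)" "v' \<in> carrier (A \<alpha>)" "w' \<in> carrier (A u)"
      for v w v' w'
      using that a y by (simp add: mult_A_assoc)
  qed
  show ?thesis
  proof (rule tensor_A_eqI[OF a a M(3) lin_comp[OF bil_right[OF rmul2_bilinear[OF a] x] r_linear[OF a]]
        lin_comp[OF r_linear[OF a] bil_left[OF mb comult_right_closed[OF a x]]] _ q])
    fix y z assume yz: "y \<in> carrier (A \<alpha>)" "z \<in> carrier (A \<alpha>)"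
    have "\<Delta> \<alpha> u (\<mu> \<alpha> z x) = ?m (\<Delta> \<alpha> u z) (\<Delta> \<alpha> u x)"
      using comult_mult[OF a unit_closed, of z x] yz x a by simp
    then show "rm \<alpha> (rmul2 \<alpha> \<alpha> x (pt \<alpha> \<alpha> y z)) = ?m (rm \<alpha> (pt \<alpha> \<alpha> y z)) (\<Delta> \<alpha> u x)"
      using yz x a by (simp add: 1)
  qed
qed

text \<open>The left linear projection of \<open>A \<otimes> A\<close> onto the kernel of
  multiplication along \<open>A \<otimes> 1\<close>. It sends \<open>a \<otimes> b\<close> to
  \<open>a D b\<close>, so it extends the generating expressions of the calculus to all
  tensors.\<close>

definition univ_proj :: "'g \<Rightarrow> ('k, 'a, 'a) tens \<Rightarrow> ('k, 'a, 'a) tens"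
  where "univ_proj \<alpha> q = q \<ominus>\<^bsub>T \<alpha> \<alpha>\<^esub> pt \<alpha> \<alpha> (mult_map K (A \<alpha>) q) \<one>\<^bsub>A \<alpha>\<^esub>"

context
  fixes \<alpha>
  assumes a: "\<alpha> \<in> carrier G"
begin

private lemmas Mp = mod_A[OF a] mod_T[OF a a]

interpretation T: module K "T \<alpha> \<alpha>" by (rule Mp(2))
interpretation B: module K "A \<alpha>" by (rule Mp(1))

private lemma univ_proj_linear_T: "univ_proj \<alpha> \<in> linear_maps K (T \<alpha> \<alpha>) (T \<alpha> \<alpha>)"
  using lin_minus_fun[OF Mp(2,2) lin_id
      lin_comp[OF mult_map_linear[OF a] bil_left[OF pt_bilinear[OF a a] one_A_closed[OF a]]]]
  by (simp add: univ_proj_def[abs_def])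

lemma univ_proj_closed [simp]:
  assumes "q \<in> carrier (T \<alpha> \<alpha>)"
  shows "univ_proj \<alpha> q \<in> carrier (U \<alpha>)"
proof -
  have c: "mult_map K (A \<alpha>) q \<in> carrier (A \<alpha>)"
    by (rule lin_closed[OF mult_map_linear[OF a] assms])
  then show ?thesis
    using assms a lin_closed[OF univ_proj_linear_T assms]
    by (simp add: carrier_U[OF a])
      (simp add: univ_proj_def lin_minus[OF Mp(2,1) mult_map_linear[OF a]]
        B.r_neg[folded a_minus_def])
qed

lemma univ_proj_linear: "univ_proj \<alpha> \<in> linear_maps K (T \<alpha> \<alpha>) (U \<alpha>)"
  by (rule linear_mapsI)
    (simp_all add: add_U[OF a] smult_U[OF a] linear_mapsD[OF univ_proj_linear_T])

lemma univ_proj_U: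
  assumes "q \<in> carrier (U \<alpha>)"
  shows "univ_proj \<alpha> q = q"
proof -
  have "pt \<alpha> \<alpha> \<zero>\<^bsub>A \<alpha>\<^esub> \<one>\<^bsub>A \<alpha>\<^esub> = \<zero>\<^bsub>T \<alpha> \<alpha>\<^esub>"
    by (rule lin_zero[OF Mp(1,2) bil_left[OF pt_bilinear[OF a a] one_A_closed[OF a]]])
  then show ?thesis
    using assms by (simp add: univ_proj_def carrier_U[OF a] a_minus_def)
qed

lemma univ_proj_one:
  assumes "x \<in> carrier (A \<alpha>)"
  shows "univ_proj \<alpha> (pt \<alpha> \<alpha> x \<one>\<^bsub>A \<alpha>\<^esub>) = \<zero>\<^bsub>U \<alpha>\<^esub>"
  using assms a by (simp add: univ_proj_def zero_U[OF a] a_minus_def T.r_neg)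

lemma univ_proj_lmul1:
  assumes "x \<in> carrier (A \<alpha>)" "q \<in> carrier (T \<alpha> \<alpha>)"
  shows "univ_proj \<alpha> (lmul1 \<alpha> \<alpha> x q) = lmul1 \<alpha> \<alpha> x (univ_proj \<alpha> q)"
  using assms a lin_closed[OF mult_map_linear[OF a]]
  by (simp add: univ_proj_def mult_map_lmul1[OF a]
      lin_minus[OF Mp(2,2) bil_right[OF lmul1_bilinear[OF a a] assms(1)]])

lemma univ_proj_diff:
  "x \<in> carrier (A \<alpha>) \<Longrightarrow> univ_proj \<alpha> (pt \<alpha> \<alpha> \<one>\<^bsub>A \<alpha>\<^esub> x) = universal_diff K (A \<alpha>) x"
  using a by (simp add: univ_proj_def universal_diff_def)

lemma univ_proj_decomp:
  assumes "q \<in> carrier (T \<alpha> \<alpha>)"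
  shows "q = univ_proj \<alpha> q \<oplus>\<^bsub>T \<alpha> \<alpha>\<^esub> pt \<alpha> \<alpha> (mult_map K (A \<alpha>) q) \<one>\<^bsub>A \<alpha>\<^esub>"
proof -
  have "pt \<alpha> \<alpha> (mult_map K (A \<alpha>) q) \<one>\<^bsub>A \<alpha>\<^esub> \<in> carrier (T \<alpha> \<alpha>)"
    using a lin_closed[OF mult_map_linear[OF a] assms] by simp
  then show ?thesis
    using assms by (simp add: univ_proj_def a_minus_def T.a_assoc T.l_neg)
qed

text \<open>The tensor \<open>x \<otimes> y\<close> cancels between
  \<open>(D x) y = 1 \<otimes> x y - x \<otimes> y\<close> and
  \<open>x D y = x \<otimes> y - x y \<otimes> 1\<close>, the latter written with
  \<open>univ_proj\<close>.\<close>

lemma universal_leibniz: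
  assumes "x \<in> carrier (A \<alpha>)" "y \<in> carrier (A \<alpha>)"
  shows "universal_diff K (A \<alpha>) (\<mu> \<alpha> x y)
    = rmul2 \<alpha> \<alpha> y (universal_diff K (A \<alpha>) x) \<oplus>\<^bsub>T \<alpha> \<alpha>\<^esub> univ_proj \<alpha> (pt \<alpha> \<alpha> x y)"
proof -
  note rr = bil_right[OF rmul2_bilinear[OF a] assms(2)]
  have "rmul2 \<alpha> \<alpha> y (universal_diff K (A \<alpha>) x)
      = pt \<alpha> \<alpha> \<one>\<^bsub>A \<alpha>\<^esub> (\<mu> \<alpha> x y) \<ominus>\<^bsub>T \<alpha> \<alpha>\<^esub> pt \<alpha> \<alpha> x y"
    using assms a by (simp add: universal_diff_def lin_minus[OF Mp(2,2) rr])
  then show ?thesis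
    using assms a
    by (simp add: universal_diff_def univ_proj_def a_minus_def T.a_assoc T.r_neg1)
qed

end

end


section \<open>The calculus of a right ideal\<close>

locale hopf_calculus = hopf_group_coalgebra K G A \<Delta> \<epsilon> S
  for K :: "('k, 'm) ring_scheme" (structure) and G :: "('g, 'n) monoid_scheme" (structure)
    and A :: "'g \<Rightarrow> ('k, 'a) module" and \<Delta> \<epsilon> S +
  fixes R :: "'a set"
  assumes right_ideal_R: "right_ideal R (A \<one>\<^bsub>G\<^esub>)"
    and R_kernel: "R \<subseteq> a_kernel (A \<one>\<^bsub>G\<^esub>) K \<epsilon>"
begin

abbreviation N :: "'g \<Rightarrow> ('k, 'a, 'a) tens set"
  where "N \<equiv> calculus_N K G A \<Delta> R"

abbreviation \<Gamma> :: "'g \<Rightarrow> ('k, 'a, ('k, 'a, 'a) tens set) bimod"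
  where "\<Gamma> \<equiv> calculus_bimod K G A \<Delta> R"

abbreviation d :: "'g \<Rightarrow> 'a \<Rightarrow> ('k, 'a, 'a) tens set"
  where "d \<equiv> calculus_diff K G A \<Delta> R"

abbreviation AR :: "'g \<Rightarrow> ('k, 'a, 'a) tens set"
  where "AR \<alpha> \<equiv> tensor_sub K (A \<alpha>) (A u) (carrier (A \<alpha>)) R"

lemma R_carrier: "R \<subseteq> carrier (A u)"
  using right_ideal_R by (simp add: right_ideal_def additive_subgroup.a_subset)

lemma R_mult: "\<lbrakk>x \<in> R; y \<in> carrier (A u)\<rbrakk> \<Longrightarrow> \<mu> u x y \<in> R"
  by (rule right_ideal.right_closed[OF right_ideal_R])

lemma counit_R: "x \<in> R \<Longrightarrow> \<epsilon> x = \<zero>"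
  using R_kernel by (auto simp: a_kernel_def')

text \<open>Scalars act through the unit, \<open>c x = x (c 1)\<close>, so a right ideal is
  automatically a subspace.\<close>

lemma submodule_R: "submodule R K (A u)"
proof -
  interpret B: module K "A u" by (rule mod_A[OF unit_closed])
  interpret R: additive_subgroup R "A u" using right_ideal_R by (simp add: right_ideal_def)
  have "c \<odot>\<^bsub>A u\<^esub> x \<in> R" if "c \<in> carrier K" "x \<in> R" for c x
  proof -
    have x: "x \<in> carrier (A u)" using that R_carrier by auto
    have "c \<odot>\<^bsub>A u\<^esub> x = \<mu> u x (c \<odot>\<^bsub>A u\<^esub> \<one>\<^bsub>A u\<^esub>)"
      using lin_smult[OF bil_right[OF mult_A[OF unit_closed] x]] that x by simp
    then show ?thesis using R_mult that by simp
  qed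
  then show ?thesis by (intro B.submodule_closedI R_carrier) auto
qed

section \<open>The sub-bimodules \<open>N \<alpha>\<close> and their quotients\<close>

context
  fixes \<alpha>
  assumes a: "\<alpha> \<in> carrier G"
begin

private lemmas Mn = mod_A[OF a] mod_A[OF unit_closed] mod_T[OF a a] mod_T[OF a unit_closed]

lemma AR_submodule: "submodule (AR \<alpha>) K (T \<alpha> u)"
  by (rule tensor_sub_submodule[OF Mn(1,2) subset_refl R_carrier])

lemma AR_pure: "\<lbrakk>x \<in> carrier (A \<alpha>); y \<in> R\<rbrakk> \<Longrightarrow> pt \<alpha> u x y \<in> AR \<alpha>"
  by (rule tensor_sub_pure[OF Mn(1,2) subset_refl R_carrier])

lemmas AR_image = tensor_sub_image[OF Mn(1,2) subset_refl R_carrier]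

text \<open>Bijectivity of \<open>r\<close> exchanges an image under its inverse for a preimage
  under a linear map, from which the closure properties of \<open>N \<alpha>\<close> are read
  off.\<close>

lemma N_iff: "q \<in> N \<alpha> \<longleftrightarrow> q \<in> carrier (T \<alpha> \<alpha>) \<and> rm \<alpha> q \<in> AR \<alpha>"
proof -
  interpret T: module K "T \<alpha> u" by (rule Mn(4))
  have "AR \<alpha> \<subseteq> carrier (T \<alpha> u)" by (rule T.submoduleE(1)[OF AR_submodule])
  then show ?thesis
    unfolding calculus_N_def using a r_inv_r[OF a, of q] by (force simp: image_iff)
qed

lemma r_inv_pure_N: "\<lbrakk>x \<in> carrier (A \<alpha>); y \<in> R\<rbrakk> \<Longrightarrow> ri \<alpha> (pt \<alpha> u x y) \<in> N \<alpha>"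
  using a R_carrier AR_pure by (simp add: N_iff subset_iff)

lemma N_mult_map:
  assumes "q \<in> N \<alpha>"
  shows "mult_map K (A \<alpha>) q = \<zero>\<^bsub>A \<alpha>\<^esub>"
proof -
  let ?E = "tensor_lift K (A \<alpha>) (\<lambda>x y. \<epsilon> y \<odot>\<^bsub>A \<alpha>\<^esub> x)"
  interpret B: module K "A \<alpha>" by (rule Mn(1))
  note Eb = bil_flip[OF counit_bilinear[OF a]]
  have q: "q \<in> carrier (T \<alpha> \<alpha>)" "rm \<alpha> q \<in> AR \<alpha>" using assms N_iff by auto
  have "?E (rm \<alpha> q) \<in> {\<zero>\<^bsub>A \<alpha>\<^esub>}"
  proof (rule AR_image[OF Mn(1) tensor_lift_linear[OF Mn(1,2,1) Eb] submodule_zero[OF Mn(1)] _ q(2)])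
    show "?E (pt \<alpha> u s t) \<in> {\<zero>\<^bsub>A \<alpha>\<^esub>}" if "s \<in> carrier (A \<alpha>)" "t \<in> R" for s t
      using that R_carrier counit_R by (auto simp: tensor_lift_pure[OF Mn(1,2,1) Eb])
  qed
  then show ?thesis using counit_r[OF a q(1)] by simp
qed

lemma N_U: "N \<alpha> \<subseteq> carrier (U \<alpha>)"
  using N_iff N_mult_map by (auto simp: carrier_U[OF a])

lemma submodule_N: "submodule (N \<alpha>) K (U \<alpha>)"
proof -
  interpret T: module K "T \<alpha> \<alpha>" by (rule Mn(3))
  interpret UU: module K "U \<alpha>" by (rule module_U[OF a])
  have "N \<alpha> = {q \<in> carrier (T \<alpha> \<alpha>). rm \<alpha> q \<in> AR \<alpha>}" using N_iff by auto
  then have *: "submodule (N \<alpha>) K (T \<alpha> \<alpha>)"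
    using submodule_preimage[OF Mn(3,4) r_linear[OF a] AR_submodule] by simp
  have 0: "\<zero>\<^bsub>T \<alpha> \<alpha>\<^esub> \<in> N \<alpha>"
    using submodule.axioms(1)[OF *] by (auto dest: subgroup.one_closed)
  show ?thesis
    by (rule UU.submodule_closedI[OF N_U]; unfold zero_U[OF a] add_U[OF a] smult_U[OF a])
      (simp_all add: 0 T.submoduleE(4,5)[OF *])
qed

lemma N_lmul1:
  assumes "x \<in> carrier (A \<alpha>)" "q \<in> N \<alpha>"
  shows "lmul1 \<alpha> \<alpha> x q \<in> N \<alpha>"
proof -
  note lb = bil_right[OF lmul1_bilinear[OF a unit_closed] assms(1)]
  have q: "q \<in> carrier (T \<alpha> \<alpha>)" "rm \<alpha> q \<in> AR \<alpha>" using assms N_iff by auto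
  have "lmul1 \<alpha> u x (rm \<alpha> q) \<in> AR \<alpha>"
  proof (rule AR_image[OF Mn(4) lb AR_submodule _ q(2)])
    show "lmul1 \<alpha> u x (pt \<alpha> u s t) \<in> AR \<alpha>" if "s \<in> carrier (A \<alpha>)" "t \<in> R" for s t
      using that R_carrier assms a AR_pure by (simp add: subset_iff)
  qed
  then show ?thesis
    using q assms(1) r_lmul1[OF a] lin_closed[OF bil_right[OF lmul1_bilinear[OF a a]]]
    by (simp add: N_iff)
qed

lemma N_rmul2:
  assumes x: "x \<in> carrier (A \<alpha>)" and "q \<in> N \<alpha>"
  shows "rmul2 \<alpha> \<alpha> x q \<in> N \<alpha>"
proof -
  let ?m = "tensor_map2 K (A \<alpha>) (A u) (\<mu> \<alpha>) (\<mu> u)"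
  note mb = mult_T_bilinear[OF a unit_closed]
  have q: "q \<in> carrier (T \<alpha> \<alpha>)" "rm \<alpha> q \<in> AR \<alpha>" using assms N_iff by auto
  have "?m (rm \<alpha> q) (\<Delta> \<alpha> u x) \<in> AR \<alpha>"
  proof (rule AR_image[OF Mn(4) bil_left[OF mb comult_right_closed[OF a x]] AR_submodule _ q(2)])
    fix s t assume st: "s \<in> carrier (A \<alpha>)" "t \<in> R"
    then have t: "t \<in> carrier (A u)" using R_carrier by auto
    \<comment> \<open>For pure \<open>X = v \<otimes> w\<close> the product is
      \<open>s v \<otimes> t w\<close>, and \<open>t w\<close> lies in the right ideal; the
      coproduct of \<open>x\<close> is a special case of \<open>X\<close>.\<close>
    have "?m (pt \<alpha> u s t) X \<in> AR \<alpha>" if X: "X \<in> carrier (T \<alpha> u)" for X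
      by (rule tensor_image[OF Mn(1,2,4) bil_right[OF mb] AR_submodule _ X])
        (use st t a R_mult AR_pure in simp_all)
    then show "?m (pt \<alpha> u s t) (\<Delta> \<alpha> u x) \<in> AR \<alpha>" using x a by simp
  qed
  then show ?thesis
    using q x r_rmul2[OF a x q(1)] lin_closed[OF bil_right[OF rmul2_bilinear[OF a]]]
    by (simp add: N_iff)
qed

lemma calculus_quot:
  shows bimodule_\<Gamma>: "bimodule K (A \<alpha>) (\<Gamma> \<alpha>)"
    and lact_\<Gamma>: "\<lbrakk>x \<in> carrier (A \<alpha>); q \<in> carrier (U \<alpha>)\<rbrakk> \<Longrightarrow>
      lact (\<Gamma> \<alpha>) x (N \<alpha> +>\<^bsub>U \<alpha>\<^esub> q) = N \<alpha> +>\<^bsub>U \<alpha>\<^esub> lmul1 \<alpha> \<alpha> x q"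
    and ract_\<Gamma>: "\<lbrakk>x \<in> carrier (A \<alpha>); q \<in> carrier (U \<alpha>)\<rbrakk> \<Longrightarrow>
      ract (\<Gamma> \<alpha>) (N \<alpha> +>\<^bsub>U \<alpha>\<^esub> q) x = N \<alpha> +>\<^bsub>U \<alpha>\<^esub> rmul2 \<alpha> \<alpha> x q"
  using bimodule_quot_bimodule[OF bimodule_U[OF a] submodule_N] N_lmul1 N_rmul2
  by (simp_all add: calculus_bimod_def lact_U[OF a] ract_U[OF a])

end

text \<open>The map \<open>a \<otimes> b \<mapsto> a d b\<close> (see \<open>lact_d\<close>).\<close>

definition omega :: "'g \<Rightarrow> ('k, 'a, 'a) tens \<Rightarrow> ('k, 'a, 'a) tens set"
  where "omega \<alpha> q = N \<alpha> +>\<^bsub>U \<alpha>\<^esub> univ_proj \<alpha> q"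

section \<open>The generating map \<open>omega\<close> and the axioms of a first order
  calculus\<close>

context
  fixes \<alpha>
  assumes a: "\<alpha> \<in> carrier G"
begin

private lemmas Mo = mod_A[OF a] mod_T[OF a a]

lemma quotient_\<Gamma>: "quotient_space K (U \<alpha>) (N \<alpha>) (\<Gamma> \<alpha>)"
  unfolding calculus_bimod_def
  by (rule quotient_space_quot_bimodule[OF module_U[OF a] submodule_N[OF a]])

interpretation Q: quotient_space K "U \<alpha>" "N \<alpha>" "\<Gamma> \<alpha>" by (rule quotient_\<Gamma>)
interpretation B: bimodule K "A \<alpha>" "\<Gamma> \<alpha>" by (rule bimodule_\<Gamma>[OF a])

lemma module_\<Gamma>: "module K (\<Gamma> \<alpha>)"
  by (rule Q.module_Q)

lemma omega_linear: "omega \<alpha> \<in> linear_maps K (T \<alpha> \<alpha>) (\<Gamma> \<alpha>)"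
  using lin_comp[OF univ_proj_linear[OF a] Q.proj_linear] by (simp add: omega_def[abs_def])

lemma omega_zero_iff: "q \<in> carrier (T \<alpha> \<alpha>) \<Longrightarrow> omega \<alpha> q = \<zero>\<^bsub>\<Gamma> \<alpha>\<^esub> \<longleftrightarrow> univ_proj \<alpha> q \<in> N \<alpha>"
  unfolding omega_def using a by (simp add: Q.proj_eq_zero_iff)

lemma omega_N: "q \<in> N \<alpha> \<Longrightarrow> omega \<alpha> q = \<zero>\<^bsub>\<Gamma> \<alpha>\<^esub>"
  using N_iff[OF a] N_U[OF a] by (simp add: omega_zero_iff univ_proj_U[OF a] subset_iff)

lemma omega_one: "x \<in> carrier (A \<alpha>) \<Longrightarrow> omega \<alpha> (pt \<alpha> \<alpha> x \<one>\<^bsub>A \<alpha>\<^esub>) = \<zero>\<^bsub>\<Gamma> \<alpha>\<^esub>"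
  unfolding omega_def by (simp add: univ_proj_one[OF a] Q.proj_eq_zero_iff)

text \<open>\<open>univ_proj\<close> is the identity on \<open>U \<alpha>\<close>, so there
  \<open>omega\<close> is just the canonical epimorphism.\<close>

lemma \<Gamma>_omega:
  assumes "\<omega> \<in> carrier (\<Gamma> \<alpha>)"
  obtains q where "q \<in> carrier (U \<alpha>)" "\<omega> = omega \<alpha> q"
  using assms by (auto elim!: Q.carrier_QE simp: omega_def univ_proj_U[OF a])

lemma d_omega: "x \<in> carrier (A \<alpha>) \<Longrightarrow> d \<alpha> x = omega \<alpha> (pt \<alpha> \<alpha> \<one>\<^bsub>A \<alpha>\<^esub> x)"
  unfolding omega_def calculus_diff_def by (simp add: univ_proj_diff[OF a])

lemma lact_omega:
  "\<lbrakk>x \<in> carrier (A \<alpha>); q \<in> carrier (T \<alpha> \<alpha>)\<rbrakk> \<Longrightarrow> lact (\<Gamma> \<alpha>) x (omega \<alpha> q) = omega \<alpha> (lmul1 \<alpha> \<alpha> x q)"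
  unfolding omega_def using a by (simp add: lact_\<Gamma>[OF a] univ_proj_lmul1[OF a])

lemma lact_d:
  "\<lbrakk>x \<in> carrier (A \<alpha>); y \<in> carrier (A \<alpha>)\<rbrakk> \<Longrightarrow> lact (\<Gamma> \<alpha>) x (d \<alpha> y) = omega \<alpha> (pt \<alpha> \<alpha> x y)"
  using a by (simp add: d_omega lact_omega)

lemma lact_bilinear: "lact (\<Gamma> \<alpha>) \<in> bilinear_maps K (A \<alpha>) (\<Gamma> \<alpha>) (\<Gamma> \<alpha>)"
  by (intro bilinear_mapsI linear_mapsI)
    (simp_all add: B.lact_closed B.lact_add_left B.lact_add_right B.lact_smult_left B.lact_smult_right)

lemma d_linear_maps: "d \<alpha> \<in> linear_maps K (A \<alpha>) (\<Gamma> \<alpha>)"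
  by (rule lin_cong[OF Mo(1) lin_comp[OF bil_right[OF pt_bilinear[OF a a] one_A_closed[OF a]]
          omega_linear] d_omega])

lemma d_product_rule:
  assumes "x \<in> carrier (A \<alpha>)" "y \<in> carrier (A \<alpha>)"
  shows "d \<alpha> (\<mu> \<alpha> x y) = ract (\<Gamma> \<alpha>) (d \<alpha> x) y \<oplus>\<^bsub>\<Gamma> \<alpha>\<^esub> lact (\<Gamma> \<alpha>) x (d \<alpha> y)"
proof -
  have D: "universal_diff K (A \<alpha>) x \<in> carrier (U \<alpha>)"
    using assms a univ_proj_diff[OF a assms(1)] univ_proj_closed[OF a, of "pt \<alpha> \<alpha> \<one>\<^bsub>A \<alpha>\<^esub> x"]
    by simp
  then have r: "rmul2 \<alpha> \<alpha> y (universal_diff K (A \<alpha>) x) \<in> carrier (U \<alpha>)"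
    using bimodule.ract_closed[OF bimodule_U[OF a] assms(2) D] by (simp add: ract_U[OF a])
  have "d \<alpha> (\<mu> \<alpha> x y) = Q.proj (rmul2 \<alpha> \<alpha> y (universal_diff K (A \<alpha>) x)
      \<oplus>\<^bsub>U \<alpha>\<^esub> univ_proj \<alpha> (pt \<alpha> \<alpha> x y))"
    unfolding calculus_diff_def using assms by (simp add: universal_leibniz[OF a] add_U[OF a])
  also have "\<dots> = ract (\<Gamma> \<alpha>) (d \<alpha> x) y \<oplus>\<^bsub>\<Gamma> \<alpha>\<^esub> omega \<alpha> (pt \<alpha> \<alpha> x y)"
    using assms r D a by (simp add: Q.proj_add ract_\<Gamma>[OF a] calculus_diff_def omega_def)
  finally show ?thesis using assms by (simp add: lact_d)
qed

text \<open>With \<open>tensor_lift_sum\<close> this makes both sides of a covariance implication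
  statements about the single tensor assembled from the \<open>a_k \<otimes> b_k\<close>.\<close>

lemma omega_sum:
  assumes "finite I" "x \<in> I \<rightarrow> carrier (A \<alpha>)" "y \<in> I \<rightarrow> carrier (A \<alpha>)"
  shows "(\<Oplus>\<^bsub>\<Gamma> \<alpha>\<^esub>k\<in>I. lact (\<Gamma> \<alpha>) (x k) (d \<alpha> (y k))) = omega \<alpha> (\<Oplus>\<^bsub>T \<alpha> \<alpha>\<^esub>k\<in>I. pt \<alpha> \<alpha> (x k) (y k))"
proof -
  have p: "(\<lambda>k. pt \<alpha> \<alpha> (x k) (y k)) \<in> I \<rightarrow> carrier (T \<alpha> \<alpha>)"
    using assms a by (auto intro!: pt_closed)
  have "omega \<alpha> (\<Oplus>\<^bsub>T \<alpha> \<alpha>\<^esub>k\<in>I. pt \<alpha> \<alpha> (x k) (y k)) = (\<Oplus>\<^bsub>\<Gamma> \<alpha>\<^esub>k\<in>I. omega \<alpha> (pt \<alpha> \<alpha> (x k) (y k)))"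
    by (rule lin_finsum[OF Mo(2) module_\<Gamma> omega_linear assms(1) p])
  also have "\<dots> = (\<Oplus>\<^bsub>\<Gamma> \<alpha>\<^esub>k\<in>I. lact (\<Gamma> \<alpha>) (x k) (d \<alpha> (y k)))"
    using assms p lin_closed[OF omega_linear]
    by (intro B.V.finsum_cong') (auto simp: lact_d Pi_iff)
  finally show ?thesis by simp
qed

lemma d_spans:
  assumes "\<omega> \<in> carrier (\<Gamma> \<alpha>)"
  shows "\<exists>(n::nat) x y. x \<in> {..<n} \<rightarrow> carrier (A \<alpha>) \<and> y \<in> {..<n} \<rightarrow> carrier (A \<alpha>)
    \<and> \<omega> = (\<Oplus>\<^bsub>\<Gamma> \<alpha>\<^esub>k\<in>{..<n}. lact (\<Gamma> \<alpha>) (x k) (d \<alpha> (y k)))"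
proof -
  obtain q where q: "q \<in> carrier (U \<alpha>)" "\<omega> = omega \<alpha> q" using assms by (rule \<Gamma>_omega)
  obtain n :: nat and x y where xy: "x \<in> {..<n} \<rightarrow> carrier (A \<alpha>)" "y \<in> {..<n} \<rightarrow> carrier (A \<alpha>)"
    and sum: "q = (\<Oplus>\<^bsub>T \<alpha> \<alpha>\<^esub>k\<in>{..<n}. pt \<alpha> \<alpha> (x k) (y k))"
    by (rule tensor_sum_rep[OF Mo(1,1) U_carrierD[OF a q(1)]])
  have "\<omega> = (\<Oplus>\<^bsub>\<Gamma> \<alpha>\<^esub>k\<in>{..<n}. lact (\<Gamma> \<alpha>) (x k) (d \<alpha> (y k)))"
    unfolding q(2) sum by (rule omega_sum[symmetric]) (simp_all add: xy)
  with xy show ?thesis by (intro exI[of _ n] exI[of _ x] exI[of _ y] conjI)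
qed

text \<open>By \<open>univ_proj_decomp\<close> such a \<open>q\<close> is the sum of an element of
  \<open>N \<alpha>\<close> and a tensor \<open>x \<otimes> 1\<close>; covariance therefore needs
  checking on these two kinds of tensors only.\<close>

lemma lin_eq_zero_of_omega_zero:
  assumes P: "module K P" and f: "f \<in> linear_maps K (T \<alpha> \<alpha>) P"
    and N: "\<And>q. q \<in> N \<alpha> \<Longrightarrow> f q = \<zero>\<^bsub>P\<^esub>"
    and one: "\<And>x. x \<in> carrier (A \<alpha>) \<Longrightarrow> f (pt \<alpha> \<alpha> x \<one>\<^bsub>A \<alpha>\<^esub>) = \<zero>\<^bsub>P\<^esub>"
    and q: "q \<in> carrier (T \<alpha> \<alpha>)" "omega \<alpha> q = \<zero>\<^bsub>\<Gamma> \<alpha>\<^esub>"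
  shows "f q = \<zero>\<^bsub>P\<^esub>"
proof -
  interpret P: module K P by (rule P)
  let ?m = "mult_map K (A \<alpha>) q"
  have m: "?m \<in> carrier (A \<alpha>)" by (rule lin_closed[OF mult_map_linear[OF a] q(1)])
  have n: "univ_proj \<alpha> q \<in> N \<alpha>" using q omega_zero_iff by simp
  then have "univ_proj \<alpha> q \<in> carrier (T \<alpha> \<alpha>)" using N_iff[OF a] by simp
  then have "f (univ_proj \<alpha> q \<oplus>\<^bsub>T \<alpha> \<alpha>\<^esub> pt \<alpha> \<alpha> ?m \<one>\<^bsub>A \<alpha>\<^esub>) = \<zero>\<^bsub>P\<^esub>"
    using m a n by (simp add: lin_add[OF f] N one)
  then show ?thesis using univ_proj_decomp[OF a q(1)] by simp
qed

end

lemma graded_fodc: "graded_fodc K G A \<Gamma> d"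
  by (rule graded_fodc.intro)
    (simp_all only: bimodule_\<Gamma> d_linear_maps d_product_rule d_spans)

section \<open>The maps tested by covariance\<close>

context
  fixes \<alpha> \<beta>
  assumes a: "\<alpha> \<in> carrier G" and b: "\<beta> \<in> carrier G"
begin

private abbreviation (input) "\<delta> \<equiv> \<alpha> \<otimes>\<^bsub>G\<^esub> \<beta>"

private lemma c: "\<delta> \<in> carrier G" using a b by simp

private lemmas Ms = mod_A[OF a] mod_A[OF b] mod_A[OF c] mod_A[OF unit_closed]
  mod_T[OF a b] mod_T[OF b b] mod_T[OF a a] mod_T[OF a unit_closed] mod_T[OF unit_closed b]
  module_\<Gamma>[OF a] module_\<Gamma>[OF b]

private abbreviation (input) "ATT \<equiv> tensor K (A \<alpha>) (T \<beta> \<beta>)"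
private abbreviation (input) "AUT \<equiv> tensor K (A \<alpha>) (T u \<beta>)"
private abbreviation (input) "A\<Gamma> \<equiv> tensor K (A \<alpha>) (\<Gamma> \<beta>)"
private abbreviation (input) "\<Gamma>A \<equiv> tensor K (\<Gamma> \<alpha>) (A \<beta>)"

private lemma M3: "module K ATT" "module K AUT" "module K A\<Gamma>" "module K \<Gamma>A"
  by (intro module_tensor Ms)+

text \<open>The summand in the covariance axiom as a bilinear map of \<open>x\<close> and
  \<open>y\<close>. Covariance says that its lift to \<open>T \<delta> \<delta>\<close> vanishes on
  the kernel of \<open>omega\<close>, that is, that \<open>x d y \<mapsto> left_coaction x y\<close>
  is well defined on the calculus.\<close>

definition left_coaction :: "'a \<Rightarrow> 'a \<Rightarrow> ('k, 'a, ('k, 'a, 'a) tens set) tens"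
  where "left_coaction x y = tensor_map2 K (A \<alpha>) (\<Gamma> \<beta>) (\<mu> \<alpha>) (lact (\<Gamma> \<beta>))
    (\<Delta> \<alpha> \<beta> x) (tensor_map K (A \<alpha>) (\<Gamma> \<beta>) id (d \<beta>) (\<Delta> \<alpha> \<beta> y))"

definition right_coaction :: "'a \<Rightarrow> 'a \<Rightarrow> ('k, ('k, 'a, 'a) tens set, 'a) tens"
  where "right_coaction x y = tensor_map2 K (\<Gamma> \<alpha>) (A \<beta>) (lact (\<Gamma> \<alpha>)) (\<mu> \<beta>)
    (\<Delta> \<alpha> \<beta> x) (tensor_map K (\<Gamma> \<alpha>) (A \<beta>) (d \<alpha>) id (\<Delta> \<alpha> \<beta> y))"

private lemmas lmb = tensor_map2_bilinear[OF Ms(1,2,1,11,1,11) mult_A[OF a] lact_bilinear[OF b]]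
private lemmas lmp = tensor_map2_pure[OF Ms(1,2,1,11,1,11) mult_A[OF a] lact_bilinear[OF b]]
private lemmas rmb = tensor_map2_bilinear[OF Ms(1,2,10,2,10,2) lact_bilinear[OF a] mult_A[OF b]]
private lemmas rmp = tensor_map2_pure[OF Ms(1,2,10,2,10,2) lact_bilinear[OF a] mult_A[OF b]]
private lemmas idd = tensor_map_linear[OF Ms(1,2,1,11) lin_id d_linear_maps[OF b]]
private lemmas idd_pure = tensor_map_pure[OF Ms(1,2,1,11) lin_id d_linear_maps[OF b]]
private lemmas did = tensor_map_linear[OF Ms(1,2,10,2) d_linear_maps[OF a] lin_id]
private lemmas did_pure = tensor_map_pure[OF Ms(1,2,10,2) d_linear_maps[OF a] lin_id]

lemma left_coaction_bilinear: "left_coaction \<in> bilinear_maps K (A \<delta>) (A \<delta>) A\<Gamma>"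
  using bil_pre[OF lmb comult_linear[OF a b] lin_comp[OF comult_linear[OF a b] idd]]
  by (simp add: left_coaction_def[abs_def])

lemma right_coaction_bilinear: "right_coaction \<in> bilinear_maps K (A \<delta>) (A \<delta>) \<Gamma>A"
  using bil_pre[OF rmb comult_linear[OF a b] lin_comp[OF comult_linear[OF a b] did]]
  by (simp add: right_coaction_def[abs_def])

text \<open>\<open>\<Delta> 1 = 1 \<otimes> 1\<close> and \<open>d 1 = 0\<close>; this disposes of
  the part \<open>A \<otimes> 1\<close> of the kernel of \<open>omega\<close>.\<close>

lemma left_coaction_one:
  assumes "x \<in> carrier (A \<delta>)"
  shows "left_coaction x \<one>\<^bsub>A \<delta>\<^esub> = \<zero>\<^bsub>A\<Gamma>\<^esub>"
proof -
  have "d \<beta> \<one>\<^bsub>A \<beta>\<^esub> = \<zero>\<^bsub>\<Gamma> \<beta>\<^esub>" using d_omega[OF b] omega_one[OF b] b by simp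
  then have "tensor_map K (A \<alpha>) (\<Gamma> \<beta>) id (d \<beta>) (pt \<alpha> \<beta> \<one>\<^bsub>A \<alpha>\<^esub> \<one>\<^bsub>A \<beta>\<^esub>) = \<zero>\<^bsub>A\<Gamma>\<^esub>"
    using a b lin_zero[OF Ms(11) M3(3) bil_right[OF pure_tensor_bilinear[OF Ms(1,11)]]]
    by (simp add: idd_pure)
  then show ?thesis
    using lin_zero[OF M3(3,3) bil_right[OF lmb comult_closed[OF a b assms]]]
    by (simp add: left_coaction_def comult_one[OF a b])
qed

lemma right_coaction_one:
  assumes "x \<in> carrier (A \<delta>)"
  shows "right_coaction x \<one>\<^bsub>A \<delta>\<^esub> = \<zero>\<^bsub>\<Gamma>A\<^esub>"
proof -
  have "d \<alpha> \<one>\<^bsub>A \<alpha>\<^esub> = \<zero>\<^bsub>\<Gamma> \<alpha>\<^esub>" using d_omega[OF a] omega_one[OF a] a by simp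
  then have "tensor_map K (\<Gamma> \<alpha>) (A \<beta>) (d \<alpha>) id (pt \<alpha> \<beta> \<one>\<^bsub>A \<alpha>\<^esub> \<one>\<^bsub>A \<beta>\<^esub>) = \<zero>\<^bsub>\<Gamma>A\<^esub>"
    using a b lin_zero[OF Ms(10) M3(4) bil_left[OF pure_tensor_bilinear[OF Ms(10,2)]]]
    by (simp add: did_pure)
  then show ?thesis
    using lin_zero[OF M3(4,4) bil_right[OF rmb comult_closed[OF a b assms]]]
    by (simp add: right_coaction_def comult_one[OF a b])
qed

lemma left_coaction_expand:
  assumes "x \<in> carrier (A \<delta>)" "y \<in> carrier (A \<delta>)"
  shows "left_coaction x y
    = tensor_map K (A \<alpha>) (\<Gamma> \<beta>) id (omega \<beta>) (expand \<alpha> \<beta> (pt \<delta> \<delta> x y))"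
proof -
  note io = tensor_map_linear[OF Ms(1,6,1,11) lin_id omega_linear[OF b]]
  have "tensor_map K (A \<alpha>) (\<Gamma> \<beta>) id (omega \<beta>) (pair3 \<alpha> \<beta> X Y)
      = tensor_map2 K (A \<alpha>) (\<Gamma> \<beta>) (\<mu> \<alpha>) (lact (\<Gamma> \<beta>)) X (tensor_map K (A \<alpha>) (\<Gamma> \<beta>) id (d \<beta>) Y)"
    if XY: "X \<in> carrier (T \<alpha> \<beta>)" "Y \<in> carrier (T \<alpha> \<beta>)" for X Y
  proof (rule tensor_bilinear_eqI[OF Ms(1,2,1,2) M3(3) bil_post[OF pair3_bilinear[OF a b] io] _ _ XY])
    show "(\<lambda>X Y. tensor_map2 K (A \<alpha>) (\<Gamma> \<beta>) (\<mu> \<alpha>) (lact (\<Gamma> \<beta>)) X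
        (tensor_map K (A \<alpha>) (\<Gamma> \<beta>) id (d \<beta>) Y)) \<in> bilinear_maps K (T \<alpha> \<beta>) (T \<alpha> \<beta>) A\<Gamma>"
      using bil_pre[OF lmb lin_id idd] by simp
    show "tensor_map K (A \<alpha>) (\<Gamma> \<beta>) id (omega \<beta>) (pair3 \<alpha> \<beta> (pt \<alpha> \<beta> v w) (pt \<alpha> \<beta> v' w'))
        = tensor_map2 K (A \<alpha>) (\<Gamma> \<beta>) (\<mu> \<alpha>) (lact (\<Gamma> \<beta>)) (pt \<alpha> \<beta> v w)
          (tensor_map K (A \<alpha>) (\<Gamma> \<beta>) id (d \<beta>) (pt \<alpha> \<beta> v' w'))"
      if "v \<in> carrier (A \<alpha>)" "w \<in> carrier (A \<beta>)" "v' \<in> carrier (A \<alpha>)" "w' \<in> carrier (A \<beta>)"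
      for v w v' w'
      using that a b lin_closed[OF d_linear_maps[OF b]]
      by (simp add: idd_pure lmp tensor_map_pure[OF Ms(1,6,1,11) lin_id omega_linear[OF b]] lact_d[OF b])
  qed
  then show ?thesis
    using assms a b by (simp add: left_coaction_def expand_pure)
qed

lemma left_coaction_sum:
  assumes "q \<in> carrier (T \<delta> \<delta>)" "omega \<delta> q = \<zero>\<^bsub>\<Gamma> \<delta>\<^esub>"
  shows "tensor_lift K A\<Gamma> left_coaction q = \<zero>\<^bsub>A\<Gamma>\<^esub>"
proof (rule lin_eq_zero_of_omega_zero[OF c M3(3)
      tensor_lift_linear[OF Ms(3,3) M3(3) left_coaction_bilinear] _ _ assms])
  note io = tensor_map_linear[OF Ms(1,6,1,11) lin_id omega_linear[OF b]]
  show "tensor_lift K A\<Gamma> left_coaction (pt \<delta> \<delta> x \<one>\<^bsub>A \<delta>\<^esub>) = \<zero>\<^bsub>A\<Gamma>\<^esub>" if "x \<in> carrier (A \<delta>)" for x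
    using that c by (simp add: tensor_lift_pure[OF Ms(3,3) M3(3) left_coaction_bilinear] left_coaction_one)
  fix q assume "q \<in> N \<delta>"
  then have q: "q \<in> carrier (T \<delta> \<delta>)" "rm \<delta> q \<in> AR \<delta>" using N_iff[OF c] by auto
  have "tensor_lift K A\<Gamma> left_coaction q = tensor_map K (A \<alpha>) (\<Gamma> \<beta>) id (omega \<beta>) (expand \<alpha> \<beta> q)"
    by (rule tensor_A_eqI[OF c c M3(3) tensor_lift_linear[OF Ms(3,3) M3(3) left_coaction_bilinear]
          lin_comp[OF expand_linear[OF a b] io] _ q(1)])
      (simp add: tensor_lift_pure[OF Ms(3,3) M3(3) left_coaction_bilinear] left_coaction_expand)
  moreover have "tensor_map K (A \<alpha>) (\<Gamma> \<beta>) id (omega \<beta>) (expand \<alpha> \<beta> q) \<in> {\<zero>\<^bsub>A\<Gamma>\<^esub>}"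
  proof (rule expand_image[OF a b R_carrier q io M3(3) submodule_zero[OF M3(3)]])
    fix x y z assume xyz: "x \<in> carrier (A \<alpha>)" "y \<in> carrier (A \<beta>)" "z \<in> R"
    have n: "ri \<beta> (pt \<beta> u y z) \<in> N \<beta>" by (rule r_inv_pure_N[OF b xyz(2,3)])
    then have "ri \<beta> (pt \<beta> u y z) \<in> carrier (T \<beta> \<beta>)" using N_iff[OF b] by simp
    then show "tensor_map K (A \<alpha>) (\<Gamma> \<beta>) id (omega \<beta>)
        (pure_tensor K (A \<alpha>) (T \<beta> \<beta>) x (ri \<beta> (pt \<beta> u y z))) \<in> {\<zero>\<^bsub>A\<Gamma>\<^esub>}"
      using xyz(1) lin_zero[OF Ms(11) M3(3) bil_right[OF pure_tensor_bilinear[OF Ms(1,11)]]]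
      by (simp add: tensor_map_pure[OF Ms(1,6,1,11) lin_id omega_linear[OF b]] omega_N[OF b n])
  qed
  ultimately show "tensor_lift K A\<Gamma> left_coaction q = \<zero>\<^bsub>A\<Gamma>\<^esub>" by simp
qed

text \<open>\<open>a \<otimes> (x \<otimes> c) \<mapsto> omega (r\<inverse> (a \<otimes> x)) \<otimes> c\<close>\<close>

definition recombine :: "('k, 'a, ('k, 'a, 'a) tens) tens \<Rightarrow> ('k, ('k, 'a, 'a) tens set, 'a) tens"
  where "recombine = tensor_lift K (tensor K (\<Gamma> \<alpha>) (A \<beta>))
    (\<lambda>x. tensor_map K (\<Gamma> \<alpha>) (A \<beta>) (\<lambda>y. omega \<alpha> (ri \<alpha> (pt \<alpha> u x y))) id)"

private lemmas ori = lin_comp[OF r_inv_linear[OF a] omega_linear[OF a]]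

private lemmas ori_bil = bil_post[OF pt_bilinear[OF a unit_closed] ori]

private lemmas recombine_bilinear =
  tensor_map_bilinear_left[OF Ms(1,4,2,10,2) ori_bil lin_id]

lemma recombine_linear: "recombine \<in> linear_maps K AUT \<Gamma>A"
  unfolding recombine_def by (rule tensor_lift_linear[OF Ms(1,9) M3(4) recombine_bilinear])

lemma recombine_pure:
  assumes "x \<in> carrier (A \<alpha>)" "y \<in> carrier (A u)" "z \<in> carrier (A \<beta>)"
  shows "recombine (pure_tensor K (A \<alpha>) (T u \<beta>) x (pt u \<beta> y z))
    = pure_tensor K (\<Gamma> \<alpha>) (A \<beta>) (omega \<alpha> (ri \<alpha> (pt \<alpha> u x y))) z"
  unfolding recombine_def
  using assms b tensor_map_pure[OF Ms(4,2,10,2) bil_right[OF ori_bil assms(1)] lin_id]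
  by (simp add: tensor_lift_pure[OF Ms(1,9) M3(4) recombine_bilinear])

text \<open>In Sweedler notation \<open>expand\<close> followed by \<open>t\<close> gives
  \<open>x_1 y_1 \<otimes> (y_2 \<otimes> x_2 y_3)\<close>. Here
  \<open>x_1 y_1 \<otimes> y_2\<close> is \<open>r (x_1 \<otimes> y_1)\<close>, so
  \<open>recombine\<close> returns \<open>x_1 d y_1 \<otimes> x_2 y_2\<close>.\<close>

lemma right_coaction_expand:
  assumes xy: "x \<in> carrier (A \<delta>)" "y \<in> carrier (A \<delta>)"
  shows "right_coaction x y
    = recombine (tensor_map K (A \<alpha>) (T u \<beta>) id (tm \<beta>) (expand \<alpha> \<beta> (pt \<delta> \<delta> x y)))"
proof -
  let ?as = "tensor_assoc K (A \<alpha>) (A u) (A \<beta>)"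
  let ?h = "tensor_map2 K (A \<alpha>) (T u \<beta>) (\<mu> \<alpha>) (lmul2 u \<beta>)"
  note asl = tensor_assoc_linear[OF Ms(1,4,2)]
  note l2 = lmul2_bilinear[OF unit_closed b]
  note hb = tensor_map2_bilinear[OF Ms(1,2,1,9,1,9) mult_A[OF a] l2]
  note hp = tensor_map2_pure[OF Ms(1,2,1,9,1,9) mult_A[OF a] l2]
  note idt = tensor_map_linear[OF Ms(1,6,1,9) lin_id t_linear[OF b]]
  note idD = tensor_map_linear[OF Ms(1,2,1,9) lin_id comult_left_linear[OF b]]
  note Did = tensor_map_linear[OF Ms(1,2,8,2) comult_right_linear[OF a] lin_id]
  have 1: "tensor_map K (A \<alpha>) (T u \<beta>) id (tm \<beta>) (pair3 \<alpha> \<beta> X Y)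
      = ?h X (tensor_map K (A \<alpha>) (T u \<beta>) id (\<Delta> u \<beta>) Y)"
    if XY: "X \<in> carrier (T \<alpha> \<beta>)" "Y \<in> carrier (T \<alpha> \<beta>)" for X Y
  proof (rule tensor_bilinear_eqI[OF Ms(1,2,1,2) M3(2) bil_post[OF pair3_bilinear[OF a b] idt] _ _ XY])
    show "(\<lambda>X Y. ?h X (tensor_map K (A \<alpha>) (T u \<beta>) id (\<Delta> u \<beta>) Y))
        \<in> bilinear_maps K (T \<alpha> \<beta>) (T \<alpha> \<beta>) AUT"
      using bil_pre[OF hb lin_id idD] by simp
    show "tensor_map K (A \<alpha>) (T u \<beta>) id (tm \<beta>) (pair3 \<alpha> \<beta> (pt \<alpha> \<beta> v w) (pt \<alpha> \<beta> v' w'))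
        = ?h (pt \<alpha> \<beta> v w) (tensor_map K (A \<alpha>) (T u \<beta>) id (\<Delta> u \<beta>) (pt \<alpha> \<beta> v' w'))"
      if "v \<in> carrier (A \<alpha>)" "w \<in> carrier (A \<beta>)" "v' \<in> carrier (A \<alpha>)" "w' \<in> carrier (A \<beta>)"
      for v w v' w'
      using that a b
      by (simp add: hp tensor_map_pure[OF Ms(1,6,1,9) lin_id t_linear[OF b]]
          tensor_map_pure[OF Ms(1,2,1,9) lin_id comult_left_linear[OF b]])
  qed
  \<comment> \<open>\<open>Z\<close> stands for a coproduct \<open>\<Delta> \<alpha> u v'\<close>.
    It is kept arbitrary because \<open>r^{-1}\<close> has to be applied to \<open>v Z\<close> as a
    whole.\<close>
  have 2: "recombine (?h (pt \<alpha> \<beta> v w) (?as (pure_tensor K (T \<alpha> u) (A \<beta>) Z w')))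
      = pure_tensor K (\<Gamma> \<alpha>) (A \<beta>) (omega \<alpha> (ri \<alpha> (lmul1 \<alpha> u v Z))) (\<mu> \<beta> w w')"
    if vw: "v \<in> carrier (A \<alpha>)" "w \<in> carrier (A \<beta>)" "w' \<in> carrier (A \<beta>)" and Z: "Z \<in> carrier (T \<alpha> u)"
    for v w w' Z
  proof (rule tensor_A_eqI[OF a unit_closed M3(4) _ _ _ Z])
    have p: "pt \<alpha> \<beta> v w \<in> carrier (T \<alpha> \<beta>)" and ww: "\<mu> \<beta> w w' \<in> carrier (A \<beta>)" using vw a b by simp_all
    show "(\<lambda>Z. recombine (?h (pt \<alpha> \<beta> v w) (?as (pure_tensor K (T \<alpha> u) (A \<beta>) Z w'))))
        \<in> linear_maps K (T \<alpha> u) \<Gamma>A"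
      by (rule lin_comp[OF lin_comp[OF lin_comp[OF bil_left[OF pure_tensor_bilinear[OF Ms(8,2)] vw(3)]
              asl] bil_right[OF hb p]] recombine_linear])
    show "(\<lambda>Z. pure_tensor K (\<Gamma> \<alpha>) (A \<beta>) (omega \<alpha> (ri \<alpha> (lmul1 \<alpha> u v Z))) (\<mu> \<beta> w w'))
        \<in> linear_maps K (T \<alpha> u) \<Gamma>A"
      by (rule lin_comp[OF lin_comp[OF bil_right[OF lmul1_bilinear[OF a unit_closed] vw(1)] ori]
            bil_left[OF pure_tensor_bilinear[OF Ms(10,2)] ww]])
    show "recombine (?h (pt \<alpha> \<beta> v w) (?as (pure_tensor K (T \<alpha> u) (A \<beta>) (pt \<alpha> u s t) w')))
        = pure_tensor K (\<Gamma> \<alpha>) (A \<beta>) (omega \<alpha> (ri \<alpha> (lmul1 \<alpha> u v (pt \<alpha> u s t)))) (\<mu> \<beta> w w')"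
      if "s \<in> carrier (A \<alpha>)" "t \<in> carrier (A u)" for s t
      using that vw a b by (simp add: tensor_assoc_pure[OF Ms(1,4,2)] hp recombine_pure)
  qed
  have 3: "recombine (?h X (?as (tensor_map K (T \<alpha> u) (A \<beta>) (\<Delta> \<alpha> u) id Y)))
      = tensor_map2 K (\<Gamma> \<alpha>) (A \<beta>) (lact (\<Gamma> \<alpha>)) (\<mu> \<beta>) X (tensor_map K (\<Gamma> \<alpha>) (A \<beta>) (d \<alpha>) id Y)"
    if XY: "X \<in> carrier (T \<alpha> \<beta>)" "Y \<in> carrier (T \<alpha> \<beta>)" for X Y
  proof (rule tensor_bilinear_eqI[OF Ms(1,2,1,2) M3(4) _ _ _ XY])
    show "(\<lambda>X Y. recombine (?h X (?as (tensor_map K (T \<alpha> u) (A \<beta>) (\<Delta> \<alpha> u) id Y))))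
        \<in> bilinear_maps K (T \<alpha> \<beta>) (T \<alpha> \<beta>) \<Gamma>A"
      using bil_comp[OF hb lin_id lin_comp[OF Did asl] recombine_linear] by simp
    show "(\<lambda>X Y. tensor_map2 K (\<Gamma> \<alpha>) (A \<beta>) (lact (\<Gamma> \<alpha>)) (\<mu> \<beta>) X
        (tensor_map K (\<Gamma> \<alpha>) (A \<beta>) (d \<alpha>) id Y)) \<in> bilinear_maps K (T \<alpha> \<beta>) (T \<alpha> \<beta>) \<Gamma>A"
      using bil_pre[OF rmb lin_id did] by simp
    show "recombine (?h (pt \<alpha> \<beta> v w) (?as (tensor_map K (T \<alpha> u) (A \<beta>) (\<Delta> \<alpha> u) id (pt \<alpha> \<beta> v' w'))))
      = tensor_map2 K (\<Gamma> \<alpha>) (A \<beta>) (lact (\<Gamma> \<alpha>)) (\<mu> \<beta>) (pt \<alpha> \<beta> v w)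
          (tensor_map K (\<Gamma> \<alpha>) (A \<beta>) (d \<alpha>) id (pt \<alpha> \<beta> v' w'))"
      if vw: "v \<in> carrier (A \<alpha>)" "w \<in> carrier (A \<beta>)" "v' \<in> carrier (A \<alpha>)" "w' \<in> carrier (A \<beta>)"
      for v w v' w'
    proof -
      \<comment> \<open>The argument of the inverse is by construction
        \<open>r (v \<otimes> v')\<close>; here the two factors that \<open>expand\<close>
        multiplied are separated again.\<close>
      have "ri \<alpha> (lmul1 \<alpha> u v (\<Delta> \<alpha> u v')) = pt \<alpha> \<alpha> v v'"
        using r_inv_r[OF a, of "pt \<alpha> \<alpha> v v'"] vw a by simp
      then show ?thesis
        using vw a b lin_closed[OF d_linear_maps[OF a]]
        by (simp add: tensor_map_pure[OF Ms(1,2,8,2) comult_right_linear[OF a] lin_id] 2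
            did_pure rmp lact_d[OF a])
    qed
  qed
  \<comment> \<open>Coassociativity with the unit as middle index: the leg in \<open>A u\<close> may
    be split off from the right factor, as \<open>t\<close> produces it, or from the left factor, as
    \<open>r\<close> produces it.\<close>
  have "tensor_map K (A \<alpha>) (T u \<beta>) id (\<Delta> u \<beta>) (\<Delta> \<alpha> \<beta> y)
      = ?as (tensor_map K (T \<alpha> u) (A \<beta>) (\<Delta> \<alpha> u) id (\<Delta> \<alpha> \<beta> y))"
    using coassoc[OF a unit_closed b, of y] xy a b by simp
  then show ?thesis
    using xy a b by (simp add: right_coaction_def expand_pure 1 3)
qed

lemma right_coaction_sum:
  assumes ad: "ad K G A \<Delta> \<beta> ` R \<subseteq> tensor_sub K (A u) (A \<beta>) R (carrier (A \<beta>))"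
    and q: "q \<in> carrier (T \<delta> \<delta>)" "omega \<delta> q = \<zero>\<^bsub>\<Gamma> \<delta>\<^esub>"
  shows "tensor_lift K \<Gamma>A right_coaction q = \<zero>\<^bsub>\<Gamma>A\<^esub>"
proof (rule lin_eq_zero_of_omega_zero[OF c M3(4)
      tensor_lift_linear[OF Ms(3,3) M3(4) right_coaction_bilinear] _ _ q])
  note idt = tensor_map_linear[OF Ms(1,6,1,9) lin_id t_linear[OF b]]
  show "tensor_lift K \<Gamma>A right_coaction (pt \<delta> \<delta> x \<one>\<^bsub>A \<delta>\<^esub>) = \<zero>\<^bsub>\<Gamma>A\<^esub>" if "x \<in> carrier (A \<delta>)" for x
    using that c by (simp add: tensor_lift_pure[OF Ms(3,3) M3(4) right_coaction_bilinear] right_coaction_one)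
  fix q assume "q \<in> N \<delta>"
  then have q: "q \<in> carrier (T \<delta> \<delta>)" "rm \<delta> q \<in> AR \<delta>" using N_iff[OF c] by auto
  let ?f = "\<lambda>z. recombine (tensor_map K (A \<alpha>) (T u \<beta>) id (tm \<beta>) z)"
  have "tensor_lift K \<Gamma>A right_coaction q = ?f (expand \<alpha> \<beta> q)"
    by (rule tensor_A_eqI[OF c c M3(4) tensor_lift_linear[OF Ms(3,3) M3(4) right_coaction_bilinear]
          lin_comp[OF lin_comp[OF expand_linear[OF a b] idt] recombine_linear] _ q(1)])
      (simp add: tensor_lift_pure[OF Ms(3,3) M3(4) right_coaction_bilinear] right_coaction_expand)
  moreover have "?f (expand \<alpha> \<beta> q) \<in> {\<zero>\<^bsub>\<Gamma>A\<^esub>}"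
  proof (rule expand_image[OF a b R_carrier q lin_comp[OF idt recombine_linear] M3(4)
        submodule_zero[OF M3(4)]])
    fix x y z assume xyz: "x \<in> carrier (A \<alpha>)" "y \<in> carrier (A \<beta>)" "z \<in> R"
    then have z: "z \<in> carrier (A u)" using R_carrier by auto
    note l2 = bil_right[OF lmul2_bilinear[OF unit_closed b] xyz(2)]
    let ?w = "ri \<beta> (pt \<beta> u \<one>\<^bsub>A \<beta>\<^esub> z)"
    have w: "?w \<in> carrier (T \<beta> \<beta>)" using z b by simp
    \<comment> \<open>Writing \<open>y \<otimes> z = y (1 \<otimes> z)\<close> and using that
      \<open>r\<close> and \<open>t\<close> are left linear brings in \<open>ad\<close> of the
      element \<open>z\<close> of \<open>R\<close>.\<close>
    have "rm \<beta> (lmul1 \<beta> \<beta> y ?w) = pt \<beta> u y z"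
      using r_lmul1[OF b xyz(2) w] xyz z b by simp
    then have "ri \<beta> (pt \<beta> u y z) = lmul1 \<beta> \<beta> y ?w"
      using r_inv_r[OF b lin_closed[OF bil_right[OF lmul1_bilinear[OF b b] xyz(2)] w]] by simp
    then have t: "tm \<beta> (ri \<beta> (pt \<beta> u y z)) = lmul2 u \<beta> y (ad K G A \<Delta> \<beta> z)"
      using t_lmul1[OF b xyz(2) w] by (simp add: ad_def)
    have lin: "(\<lambda>e. recombine (pure_tensor K (A \<alpha>) (T u \<beta>) x (lmul2 u \<beta> y e)))
        \<in> linear_maps K (T u \<beta>) \<Gamma>A"
      by (rule lin_comp[OF lin_comp[OF l2 bil_right[OF pure_tensor_bilinear[OF Ms(1,9)] xyz(1)]]
            recombine_linear])
    have "recombine (pure_tensor K (A \<alpha>) (T u \<beta>) x (lmul2 u \<beta> y (ad K G A \<Delta> \<beta> z))) \<in> {\<zero>\<^bsub>\<Gamma>A\<^esub>}"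
    proof (rule tensor_sub_image[OF Ms(4,2) R_carrier subset_refl M3(4) lin submodule_zero[OF M3(4)]])
      show "ad K G A \<Delta> \<beta> z \<in> tensor_sub K (A u) (A \<beta>) R (carrier (A \<beta>))"
        using ad xyz(3) by auto
      \<comment> \<open>On a generator of \<open>R \<otimes> A\<close> the first factor becomes
        \<open>omega\<close> of \<open>r^{-1} (x \<otimes> s)\<close>, which lies in
        \<open>N \<alpha>\<close> and is killed.\<close>
      fix s t assume st: "s \<in> R" "t \<in> carrier (A \<beta>)"
      then have "s \<in> carrier (A u)" using R_carrier by auto
      then show "recombine (pure_tensor K (A \<alpha>) (T u \<beta>) x (lmul2 u \<beta> y (pt u \<beta> s t))) \<in> {\<zero>\<^bsub>\<Gamma>A\<^esub>}"
        using st xyz a b lin_zero[OF Ms(10) M3(4) bil_left[OF pure_tensor_bilinear[OF Ms(10,2)]]]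
        by (simp add: recombine_pure omega_N[OF a r_inv_pure_N[OF a]])
    qed
    then show "?f (pure_tensor K (A \<alpha>) (T \<beta> \<beta>) x (ri \<beta> (pt \<beta> u y z))) \<in> {\<zero>\<^bsub>\<Gamma>A\<^esub>}"
      using xyz z b by (simp add: tensor_map_pure[OF Ms(1,6,1,9) lin_id t_linear[OF b]] t)
  qed
  ultimately show "tensor_lift K \<Gamma>A right_coaction q = \<zero>\<^bsub>\<Gamma>A\<^esub>" by simp
qed

end

section \<open>Covariance expressed by single tensors\<close>

lemma omega_sum_closed:
  assumes a: "\<alpha> \<in> carrier G"
    and "finite I" "x \<in> I \<rightarrow> carrier (A \<alpha>)" "y \<in> I \<rightarrow> carrier (A \<alpha>)"
  shows "(\<Oplus>\<^bsub>T \<alpha> \<alpha>\<^esub>k\<in>I. pt \<alpha> \<alpha> (x k) (y k)) \<in> carrier (T \<alpha> \<alpha>)"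
proof -
  interpret T: module K "T \<alpha> \<alpha>" by (rule mod_T[OF a a])
  show ?thesis
    using assms a by (intro T.finsum_closed) (auto intro!: pt_closed)
qed

lemma left_covariant_fodc: "left_covariant_fodc K G A \<Delta> \<Gamma> d"
proof (intro left_covariant_fodc.intro left_covariant_fodc_axioms.intro graded_fodc)
  fix \<alpha> \<beta> and n :: nat and x y
  assume a: "\<alpha> \<in> carrier G" and b: "\<beta> \<in> carrier G"
    and x: "x \<in> {..<n} \<rightarrow> carrier (A (\<alpha> \<otimes>\<^bsub>G\<^esub> \<beta>))" and y: "y \<in> {..<n} \<rightarrow> carrier (A (\<alpha> \<otimes>\<^bsub>G\<^esub> \<beta>))"
    and 0: "(\<Oplus>\<^bsub>\<Gamma> (\<alpha> \<otimes>\<^bsub>G\<^esub> \<beta>)\<^esub>k\<in>{..<n}. lact (\<Gamma> (\<alpha> \<otimes>\<^bsub>G\<^esub> \<beta>)) (x k) (d (\<alpha> \<otimes>\<^bsub>G\<^esub> \<beta>) (y k)))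
      = \<zero>\<^bsub>\<Gamma> (\<alpha> \<otimes>\<^bsub>G\<^esub> \<beta>)\<^esub>"
  have c: "\<alpha> \<otimes>\<^bsub>G\<^esub> \<beta> \<in> carrier G" using a b by simp
  note M = mod_A[OF c] module_tensor[OF mod_A[OF a] module_\<Gamma>[OF b]]
  show "(\<Oplus>\<^bsub>tensor K (A \<alpha>) (\<Gamma> \<beta>)\<^esub>k\<in>{..<n}.
        tensor_map2 K (A \<alpha>) (\<Gamma> \<beta>) (\<mu> \<alpha>) (lact (\<Gamma> \<beta>))
          (\<Delta> \<alpha> \<beta> (x k)) (tensor_map K (A \<alpha>) (\<Gamma> \<beta>) id (d \<beta>) (\<Delta> \<alpha> \<beta> (y k))))
      = \<zero>\<^bsub>tensor K (A \<alpha>) (\<Gamma> \<beta>)\<^esub>"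
    unfolding left_coaction_def[OF a b, symmetric]
      tensor_lift_sum[OF M(1,1,2) left_coaction_bilinear[OF a b] finite_lessThan x y, symmetric]
    by (rule left_coaction_sum[OF a b omega_sum_closed[OF c finite_lessThan x y]])
      (simp only: omega_sum[OF c finite_lessThan x y, symmetric] 0)
qed

lemma right_covariant_fodc:
  assumes "ad_invariant K G A \<Delta> R"
  shows "right_covariant_fodc K G A \<Delta> \<Gamma> d"
proof (intro right_covariant_fodc.intro right_covariant_fodc_axioms.intro graded_fodc)
  fix \<alpha> \<beta> and n :: nat and x y
  assume a: "\<alpha> \<in> carrier G" and b: "\<beta> \<in> carrier G"
    and x: "x \<in> {..<n} \<rightarrow> carrier (A (\<alpha> \<otimes>\<^bsub>G\<^esub> \<beta>))" and y: "y \<in> {..<n} \<rightarrow> carrier (A (\<alpha> \<otimes>\<^bsub>G\<^esub> \<beta>))"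
    and 0: "(\<Oplus>\<^bsub>\<Gamma> (\<alpha> \<otimes>\<^bsub>G\<^esub> \<beta>)\<^esub>k\<in>{..<n}. lact (\<Gamma> (\<alpha> \<otimes>\<^bsub>G\<^esub> \<beta>)) (x k) (d (\<alpha> \<otimes>\<^bsub>G\<^esub> \<beta>) (y k)))
      = \<zero>\<^bsub>\<Gamma> (\<alpha> \<otimes>\<^bsub>G\<^esub> \<beta>)\<^esub>"
  have c: "\<alpha> \<otimes>\<^bsub>G\<^esub> \<beta> \<in> carrier G" using a b by simp
  note M = mod_A[OF c] module_tensor[OF module_\<Gamma>[OF a] mod_A[OF b]]
  have ad: "ad K G A \<Delta> \<beta> ` R \<subseteq> tensor_sub K (A u) (A \<beta>) R (carrier (A \<beta>))"
    using assms b unfolding ad_invariant_def by blast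
  show "(\<Oplus>\<^bsub>tensor K (\<Gamma> \<alpha>) (A \<beta>)\<^esub>k\<in>{..<n}.
        tensor_map2 K (\<Gamma> \<alpha>) (A \<beta>) (lact (\<Gamma> \<alpha>)) (\<mu> \<beta>)
          (\<Delta> \<alpha> \<beta> (x k)) (tensor_map K (\<Gamma> \<alpha>) (A \<beta>) (d \<alpha>) id (\<Delta> \<alpha> \<beta> (y k))))
      = \<zero>\<^bsub>tensor K (\<Gamma> \<alpha>) (A \<beta>)\<^esub>"
    unfolding right_coaction_def[OF a b, symmetric]
      tensor_lift_sum[OF M(1,1,2) right_coaction_bilinear[OF a b] finite_lessThan x y, symmetric]
    by (rule right_coaction_sum[OF a b ad omega_sum_closed[OF c finite_lessThan x y]])
      (simp only: omega_sum[OF c finite_lessThan x y, symmetric] 0)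
qed

text \<open>Every tensor in the kernel of \<open>omega\<close> is a finite sum of pure tensors, so
  the axiom, which speaks of sums, controls the whole kernel.\<close>

lemma right_coaction_sum_covariant:
  assumes "right_covariant_fodc K G A \<Delta> \<Gamma> d"
    and a: "\<alpha> \<in> carrier G" and b: "\<beta> \<in> carrier G"
    and q: "q \<in> carrier (T (\<alpha> \<otimes>\<^bsub>G\<^esub> \<beta>) (\<alpha> \<otimes>\<^bsub>G\<^esub> \<beta>))" "omega (\<alpha> \<otimes>\<^bsub>G\<^esub> \<beta>) q = \<zero>\<^bsub>\<Gamma> (\<alpha> \<otimes>\<^bsub>G\<^esub> \<beta>)\<^esub>"
  shows "tensor_lift K (tensor K (\<Gamma> \<alpha>) (A \<beta>)) (right_coaction \<alpha> \<beta>) q = \<zero>\<^bsub>tensor K (\<Gamma> \<alpha>) (A \<beta>)\<^esub>"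
proof -
  interpret right_covariant_fodc K G A \<Delta> \<Gamma> d by fact
  let ?c = "\<alpha> \<otimes>\<^bsub>G\<^esub> \<beta>"
  have c: "?c \<in> carrier G" using a b by simp
  note M = mod_A[OF c] module_tensor[OF module_\<Gamma>[OF a] mod_A[OF b]]
  obtain n :: nat and x y where x: "x \<in> {..<n} \<rightarrow> carrier (A ?c)" and y: "y \<in> {..<n} \<rightarrow> carrier (A ?c)"
    and sum: "q = (\<Oplus>\<^bsub>T ?c ?c\<^esub>k\<in>{..<n}. pt ?c ?c (x k) (y k))"
    by (rule tensor_sum_rep[OF M(1,1) q(1)])
  have 0: "(\<Oplus>\<^bsub>\<Gamma> ?c\<^esub>k\<in>{..<n}. lact (\<Gamma> ?c) (x k) (d ?c (y k))) = \<zero>\<^bsub>\<Gamma> ?c\<^esub>"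
    unfolding omega_sum[OF c finite_lessThan x y] sum[symmetric] by (rule q(2))
  show ?thesis
    unfolding sum tensor_lift_sum[OF M(1,1,2) right_coaction_bilinear[OF a b] finite_lessThan x y]
      right_coaction_def[OF a b]
    by (rule right_covariant[OF a b x y 0])
qed

section \<open>Ad-invariance from right covariance\<close>

context
  fixes \<beta>
  assumes b: "\<beta> \<in> carrier G"
begin

private abbreviation (input) "RA \<equiv> tensor_sub K (A u) (A \<beta>) R (carrier (A \<beta>))"
text \<open>Membership in \<open>R \<otimes> A\<close> is tested as vanishing in this quotient,
  because evaluating classes of the calculus with the counit is well defined only modulo
  \<open>R\<close>.\<close>

private abbreviation (input) "Qt \<equiv> quot_module (T u \<beta>) RA"
private abbreviation (input) "\<Gamma>1A \<equiv> tensor K (\<Gamma> u) (A \<beta>)"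

private lemmas cu = unit_closed
private lemmas Mb = mod_A[OF b] mod_A[OF cu] mod_T[OF cu b] mod_T[OF cu cu] mod_T[OF b b] module_\<Gamma>[OF cu]
  module_U[OF cu]

private lemma RA_submodule: "submodule RA K (T u \<beta>)"
  by (rule tensor_sub_submodule[OF Mb(2,1) R_carrier subset_refl])

interpretation Q: quotient_space K "T u \<beta>" RA Qt
  by (rule quotient_space_quot_module[OF Mb(3) RA_submodule])

interpretation QG: quotient_space K "U u" "N u" "\<Gamma> u"
  by (rule quotient_\<Gamma>[OF cu])

private abbreviation (input) "ev \<gamma> \<equiv> tensor_lift K (A \<gamma>) (\<lambda>x y. \<epsilon> x \<odot>\<^bsub>A \<gamma>\<^esub> y)"

private lemmas ev_linear = tensor_lift_linear[OF Mb(2) mod_A mod_A counit_bilinear]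
private lemmas ev_pure = tensor_lift_pure[OF Mb(2) mod_A mod_A counit_bilinear]

text \<open>Multiplicativity of the counit and the left counit axiom give
  \<open>\<epsilon>(x y_1) y_2 = \<epsilon>(x) y\<close>.\<close>

lemma counit_left_r:
  assumes q: "q \<in> carrier (T u u)"
  shows "ev u (rm u q) = ev u q"
proof (rule tensor_A_eqI[OF cu cu Mb(2) lin_comp[OF r_linear[OF cu] ev_linear[OF cu cu cu]] ev_linear[OF cu cu cu] _ q])
  fix x y assume xy: "x \<in> carrier (A u)" "y \<in> carrier (A u)"
  interpret B: module K "A u" by (rule Mb(2))
  have "ev u (lmul1 u u x z) = \<epsilon> x \<odot>\<^bsub>A u\<^esub> ev u z" if z: "z \<in> carrier (T u u)" for z
  proof (rule tensor_A_eqI[OF cu cu Mb(2)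
        lin_comp[OF bil_right[OF lmul1_bilinear[OF cu cu] xy(1)] ev_linear[OF cu cu cu]]
        lin_smult_fun[OF Mb(4,2) ev_linear[OF cu cu cu] counit_closed[OF xy(1)]] _ z])
    fix v w assume "v \<in> carrier (A u)" "w \<in> carrier (A u)"
    then show "ev u (lmul1 u u x (pt u u v w)) = \<epsilon> x \<odot>\<^bsub>A u\<^esub> ev u (pt u u v w)"
      using xy by (simp add: ev_pure[OF cu cu cu] ring_hom_mult[OF counit_hom] B.smult_assoc1 counit_closed)
  qed
  then show "ev u (rm u (pt u u x y)) = ev u (pt u u x y)"
    using xy counit_left[OF cu xy(2)] by (simp add: ev_pure[OF cu cu cu])
qed

text \<open>On \<open>r (N u) = A u \<otimes> R\<close> the evaluation visibly takes values in
  \<open>R\<close>, and \<open>r\<close> does not affect it. Hence \<open>ev u\<close> induces a map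
  from the calculus at the unit to \<open>A u\<close> modulo \<open>R\<close>.\<close>

lemma counit_left_N:
  assumes "q \<in> N u"
  shows "ev u q \<in> R"
proof -
  have q: "q \<in> carrier (T u u)" "rm u q \<in> AR u" using assms N_iff[OF cu] by auto
  interpret B: module K "A u" by (rule Mb(2))
  have "ev u (rm u q) \<in> R"
  proof (rule AR_image[OF cu Mb(2) ev_linear[OF cu cu cu] submodule_R _ q(2)])
    fix s t assume "s \<in> carrier (A u)" "t \<in> R"
    then show "ev u (pt u u s t) \<in> R"
      using R_carrier B.submoduleE(4)[OF submodule_R] by (simp add: ev_pure[OF cu cu cu] counit_closed subset_iff)
  qed
  then show ?thesis using counit_left_r[OF q(1)] by simp
qed

text \<open>\<open>lam2\<close> sends \<open>a d b\<close>, \<open>c\<close> to the class of \<open>\<epsilon> a (b - \<epsilon> b 1) \<otimes> c\<close> modulo \<open>R \<otimes> A\<^sub>\<beta>\<close>.\<close>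

private definition "lam1 x = (\<lambda>q. Q.proj (pt u \<beta> (ev u q) x))"

private lemma ev_linear_U: "ev u \<in> linear_maps K (U u) (A u)"
  by (rule linear_mapsI)
    (simp_all add: add_U[OF cu] smult_U[OF cu] U_carrierD[OF cu] linear_mapsD[OF ev_linear[OF cu cu cu]])

private lemma lam1_linear: "x \<in> carrier (A \<beta>) \<Longrightarrow> lam1 x \<in> linear_maps K (U u) Qt"
  unfolding lam1_def
  by (rule lin_comp[OF lin_comp[OF ev_linear_U bil_left[OF pt_bilinear[OF cu b]]] Q.proj_linear])

private lemma lam1_N:
  assumes "x \<in> carrier (A \<beta>)" "q \<in> N u"
  shows "lam1 x q = \<zero>\<^bsub>Qt\<^esub>"
proof -
  have "pt u \<beta> (ev u q) x \<in> RA"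
    by (rule tensor_sub_pure[OF Mb(2,1) R_carrier subset_refl counit_left_N[OF assms(2)] assms(1)])
  moreover have "ev u q \<in> carrier (A u)" using counit_left_N[OF assms(2)] R_carrier by auto
  ultimately show ?thesis
    unfolding lam1_def using assms(1) b by (simp add: Q.proj_eq_zero_iff)
qed

private definition "lam2 X x = the_elem (lam1 x ` X)"

private lemma lam2_proj:
  "\<lbrakk>x \<in> carrier (A \<beta>); q \<in> carrier (U u)\<rbrakk> \<Longrightarrow> lam2 (QG.proj q) x = Q.proj (pt u \<beta> (ev u q) x)"
  using QG.lift_proj[OF Q.module_Q lam1_linear lam1_N] by (simp add: lam2_def lam1_def)

private lemma lam2_bilinear: "lam2 \<in> bilinear_maps K (\<Gamma> u) (A \<beta>) Qt"
proof (rule bilinear_mapsI)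
  show "(\<lambda>X. lam2 X x) \<in> linear_maps K (\<Gamma> u) Qt" if "x \<in> carrier (A \<beta>)" for x
    unfolding lam2_def by (rule QG.lift_linear[OF Q.module_Q lam1_linear[OF that] lam1_N[OF that]])
  show "lam2 X \<in> linear_maps K (A \<beta>) Qt" if X: "X \<in> carrier (\<Gamma> u)" for X
  proof -
    \<comment> \<open>One representative \<open>q\<close> serves all \<open>x\<close>, so that
      linearity in \<open>x\<close> is that of
      \<open>x \<mapsto> ev u q \<otimes> x\<close>.\<close>
    obtain q where q: "q \<in> carrier (U u)" "X = QG.proj q" using X by (rule QG.carrier_QE)
    then have "ev u q \<in> carrier (A u)" by (intro lin_closed[OF ev_linear_U])
    from lin_comp[OF bil_right[OF pt_bilinear[OF cu b] this] Q.proj_linear]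
    show ?thesis
      unfolding q(2) by (rule lin_cong[OF Mb(1)]) (rule lam2_proj[OF _ q(1)])
  qed
qed

private lemmas lift_lam2_linear = tensor_lift_linear[OF Mb(6,1) Q.module_Q lam2_bilinear]
private lemmas lift_lam2_pure = tensor_lift_pure[OF Mb(6,1) Q.module_Q lam2_bilinear]

text \<open>\<open>X\<close> and \<open>Y\<close> stand for the coproducts of \<open>x\<close> and
  \<open>y\<close>. Then the counit axiom turns the two evaluations into \<open>x\<close> and
  \<open>y\<close>, the first term into the class of \<open>t (x \<otimes> y)\<close> and the second
  into that of \<open>1 \<otimes> x y\<close>.\<close>

private lemma lift_lam2_coaction:
  assumes XY: "X \<in> carrier (T u \<beta>)" "Y \<in> carrier (T u \<beta>)"
  shows "tensor_lift K Qt lam2 (tensor_map2 K (\<Gamma> u) (A \<beta>) (lact (\<Gamma> u)) (\<mu> \<beta>) X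
      (tensor_map K (\<Gamma> u) (A \<beta>) (d u) id Y))
    = Q.proj (lmul2 u \<beta> (ev \<beta> X) Y) \<ominus>\<^bsub>Qt\<^esub> Q.proj (pt u \<beta> \<one>\<^bsub>A u\<^esub> (\<mu> \<beta> (ev \<beta> X) (ev \<beta> Y)))"
proof -
  interpret BB: module K "A \<beta>" by (rule Mb(1))
  let ?L = "\<lambda>X Y. tensor_lift K Qt lam2 (tensor_map2 K (\<Gamma> u) (A \<beta>) (lact (\<Gamma> u)) (\<mu> \<beta>) X
      (tensor_map K (\<Gamma> u) (A \<beta>) (d u) id Y))"
  let ?R = "\<lambda>X Y. Q.proj (lmul2 u \<beta> (ev \<beta> X) Y)
    \<ominus>\<^bsub>Qt\<^esub> Q.proj (pt u \<beta> \<one>\<^bsub>A u\<^esub> (\<mu> \<beta> (ev \<beta> X) (ev \<beta> Y)))"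
  note rmb = tensor_map2_bilinear[OF Mb(2,1,6,1,6,1) lact_bilinear[OF cu] mult_A[OF b]]
  note rmp = tensor_map2_pure[OF Mb(2,1,6,1,6,1) lact_bilinear[OF cu] mult_A[OF b]]
  note did = tensor_map_linear[OF Mb(2,1,6,1) d_linear_maps[OF cu] lin_id]
  note did_pure = tensor_map_pure[OF Mb(2,1,6,1) d_linear_maps[OF cu] lin_id]
  note evb = ev_linear[OF b b b]
  interpret B: module K "A u" by (rule Mb(2))
  have L: "?L \<in> bilinear_maps K (T u \<beta>) (T u \<beta>) Qt"
    using bil_comp[OF rmb lin_id did lift_lam2_linear] by (simp add: id_def)
  have R1: "(\<lambda>X Y. Q.proj (lmul2 u \<beta> (ev \<beta> X) Y)) \<in> bilinear_maps K (T u \<beta>) (T u \<beta>) Qt"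
    using bil_comp[OF lmul2_bilinear[OF cu b] evb lin_id Q.proj_linear] by (simp add: id_def)
  have R2: "(\<lambda>X Y. Q.proj (pt u \<beta> \<one>\<^bsub>A u\<^esub> (\<mu> \<beta> (ev \<beta> X) (ev \<beta> Y))))
      \<in> bilinear_maps K (T u \<beta>) (T u \<beta>) Qt"
    by (rule bil_comp[OF mult_A[OF b] evb evb
          lin_comp[OF bil_right[OF pt_bilinear[OF cu b] one_A_closed[OF cu]] Q.proj_linear]])
  have R: "?R \<in> bilinear_maps K (T u \<beta>) (T u \<beta>) Qt"
    by (rule bilinear_mapsI; rule lin_minus_fun[OF Mb(3) Q.module_Q])
      (erule bil_right[OF R1] bil_right[OF R2] bil_left[OF R1] bil_left[OF R2])+
  show ?thesis
  proof (rule tensor_bilinear_eqI[OF Mb(2,1,2,1) Q.module_Q L R _ XY])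
    fix v w v' w'
    assume v: "v \<in> carrier (A u)" "w \<in> carrier (A \<beta>)" "v' \<in> carrier (A u)" "w' \<in> carrier (A \<beta>)"
    have ww: "\<mu> \<beta> w w' \<in> carrier (A \<beta>)" using v b by simp
    have cl: "\<epsilon> v \<in> carrier K" "\<epsilon> v' \<in> carrier K" using v counit_closed by auto
    have "?L (pt u \<beta> v w) (pt u \<beta> v' w') = lam2 (omega u (pt u u v v')) (\<mu> \<beta> w w')"
      using v ww b lin_closed[OF d_linear_maps[OF cu]] lin_closed[OF omega_linear[OF cu]]
      by (simp add: did_pure rmp lact_d[OF cu] lift_lam2_pure)
    also have "\<dots> = Q.proj (pt u \<beta> (ev u (univ_proj u (pt u u v v'))) (\<mu> \<beta> w w'))"
      unfolding omega_def using v ww by (simp add: lam2_proj)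
    also have "ev u (univ_proj u (pt u u v v')) = \<epsilon> v \<odot>\<^bsub>A u\<^esub> v' \<ominus>\<^bsub>A u\<^esub> (\<epsilon> v \<otimes> \<epsilon> v') \<odot>\<^bsub>A u\<^esub> \<one>\<^bsub>A u\<^esub>"
      using v by (simp add: univ_proj_def lin_minus[OF Mb(4,2) ev_linear[OF cu cu cu]] ev_pure[OF cu cu cu]
          ring_hom_mult[OF counit_hom])
    also have "Q.proj (pt u \<beta> \<dots> (\<mu> \<beta> w w'))
        = Q.proj (pt u \<beta> (\<epsilon> v \<odot>\<^bsub>A u\<^esub> v') (\<mu> \<beta> w w'))
          \<ominus>\<^bsub>Qt\<^esub> Q.proj (pt u \<beta> ((\<epsilon> v \<otimes> \<epsilon> v') \<odot>\<^bsub>A u\<^esub> \<one>\<^bsub>A u\<^esub>) (\<mu> \<beta> w w'))"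
      using v cl ww b
      by (simp add: lin_minus[OF Mb(2,3) bil_left[OF pt_bilinear[OF cu b] ww]]
          lin_minus[OF Mb(3) Q.module_Q Q.proj_linear])
    \<comment> \<open>The scalar \<open>\<epsilon> v\<close> crosses the tensor sign and joins
      \<open>w\<close>, where \<open>\<epsilon> v w\<close> is the evaluation of
      \<open>v \<otimes> w\<close>.\<close>
    also have "pt u \<beta> (\<epsilon> v \<odot>\<^bsub>A u\<^esub> v') (\<mu> \<beta> w w') = lmul2 u \<beta> (ev \<beta> (pt u \<beta> v w)) (pt u \<beta> v' w')"
      using v cl b ww
      by (simp add: ev_pure[OF b b b] lin_smult[OF bil_left[OF pt_bilinear[OF cu b]]]
          lin_smult[OF bil_right[OF pt_bilinear[OF cu b]]] lin_smult[OF bil_left[OF mult_A[OF b]]])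
    also have "pt u \<beta> ((\<epsilon> v \<otimes> \<epsilon> v') \<odot>\<^bsub>A u\<^esub> \<one>\<^bsub>A u\<^esub>) (\<mu> \<beta> w w')
        = pt u \<beta> \<one>\<^bsub>A u\<^esub> (\<mu> \<beta> (ev \<beta> (pt u \<beta> v w)) (ev \<beta> (pt u \<beta> v' w')))"
      using v cl b ww
      by (simp add: ev_pure[OF b b b] lin_smult[OF bil_left[OF pt_bilinear[OF cu b]]]
          lin_smult[OF bil_right[OF pt_bilinear[OF cu b]]] lin_smult[OF bil_left[OF mult_A[OF b]]]
          lin_smult[OF bil_right[OF mult_A[OF b]]] Q.V.smult_assoc1[symmetric] m_comm)
    finally show "?L (pt u \<beta> v w) (pt u \<beta> v' w') = ?R (pt u \<beta> v w) (pt u \<beta> v' w')" .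
  qed
qed

lemma lift_lam2_right_coaction:
  assumes q: "q \<in> carrier (T \<beta> \<beta>)"
  shows "tensor_lift K Qt lam2 (tensor_lift K \<Gamma>1A (right_coaction u \<beta>) q)
    = Q.proj (tm \<beta> q) \<ominus>\<^bsub>Qt\<^esub> Q.proj (pt u \<beta> \<one>\<^bsub>A u\<^esub> (mult_map K (A \<beta>) q))"
proof -
  have ub: "u \<otimes>\<^bsub>G\<^esub> \<beta> = \<beta>" using b by simp
  note rb = right_coaction_bilinear[OF cu b, unfolded ub]
  note MT = module_tensor[OF Mb(6,1)]
  show ?thesis
  proof (rule tensor_A_eqI[OF b b Q.module_Q
        lin_comp[OF tensor_lift_linear[OF Mb(1,1) MT rb] lift_lam2_linear]
        lin_minus_fun[OF Mb(5) Q.module_Q lin_comp[OF t_linear[OF b] Q.proj_linear]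
          lin_comp[OF lin_comp[OF mult_map_linear[OF b] bil_right[OF pt_bilinear[OF cu b] one_A_closed[OF cu]]]
            Q.proj_linear]] _ q])
    fix x y assume xy: "x \<in> carrier (A \<beta>)" "y \<in> carrier (A \<beta>)"
    show "tensor_lift K Qt lam2 (tensor_lift K \<Gamma>1A (right_coaction u \<beta>) (pt \<beta> \<beta> x y))
      = Q.proj (tm \<beta> (pt \<beta> \<beta> x y)) \<ominus>\<^bsub>Qt\<^esub> Q.proj (pt u \<beta> \<one>\<^bsub>A u\<^esub> (mult_map K (A \<beta>) (pt \<beta> \<beta> x y)))"
      using xy b lift_lam2_coaction[of "\<Delta> u \<beta> x" "\<Delta> u \<beta> y"]
      by (simp add: tensor_lift_pure[OF Mb(1,1) MT rb] right_coaction_def[OF cu b] counit_left)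
  qed
qed

lemma ad_invariant_of_right_covariant:
  assumes cov: "right_covariant_fodc K G A \<Delta> \<Gamma> d" and x: "x \<in> R"
  shows "ad K G A \<Delta> \<beta> x \<in> RA"
proof -
  interpret QQ: module K Qt by (rule Q.module_Q)
  have ub: "u \<otimes>\<^bsub>G\<^esub> \<beta> = \<beta>" using b by simp
  define q where "q = ri \<beta> (pt \<beta> u \<one>\<^bsub>A \<beta>\<^esub> x)"
  have N: "q \<in> N \<beta>" unfolding q_def by (rule r_inv_pure_N[OF b one_A_closed[OF b] x])
  then have q: "q \<in> carrier (T \<beta> \<beta>)" using N_iff[OF b] by simp
  have tq: "tm \<beta> q \<in> carrier (T u \<beta>)" by (rule lin_closed[OF t_linear[OF b] q])
  have "tensor_lift K \<Gamma>1A (right_coaction u \<beta>) q = \<zero>\<^bsub>\<Gamma>1A\<^esub>"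
    using right_coaction_sum_covariant[OF cov cu b, unfolded ub] q omega_N[OF b N] by simp
  \<comment> \<open>Since \<open>q\<close> lies in \<open>N \<beta>\<close>, its product is zero, so
    the correction term is the class of \<open>1 \<otimes> 0\<close>.\<close>
  then have "Q.proj (tm \<beta> q) \<ominus>\<^bsub>Qt\<^esub> Q.proj (pt u \<beta> \<one>\<^bsub>A u\<^esub> \<zero>\<^bsub>A \<beta>\<^esub>) = \<zero>\<^bsub>Qt\<^esub>"
    using lift_lam2_right_coaction[OF q] N_mult_map[OF b N]
      lin_zero[OF module_tensor[OF Mb(6,1)] Q.module_Q lift_lam2_linear] by simp
  moreover have 0: "Q.proj (pt u \<beta> \<one>\<^bsub>A u\<^esub> \<zero>\<^bsub>A \<beta>\<^esub>) = \<zero>\<^bsub>Qt\<^esub>"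
    by (rule lin_zero[OF Mb(1) Q.module_Q
          lin_comp[OF bil_right[OF pt_bilinear[OF cu b] one_A_closed[OF cu]] Q.proj_linear]])
  moreover have neg: "\<ominus>\<^bsub>Qt\<^esub> \<zero>\<^bsub>Qt\<^esub> = \<zero>\<^bsub>Qt\<^esub>"
    by (rule QQ.minus_equality) (simp_all only: QQ.l_zero QQ.zero_closed)
  ultimately have "Q.proj (tm \<beta> q) \<oplus>\<^bsub>Qt\<^esub> \<zero>\<^bsub>Qt\<^esub> = \<zero>\<^bsub>Qt\<^esub>"
    unfolding 0 a_minus_def neg by simp
  then have "Q.proj (tm \<beta> q) = \<zero>\<^bsub>Qt\<^esub>"
    unfolding QQ.r_zero[OF Q.proj_closed[OF tq]] .
  then have "tm \<beta> q \<in> RA" using Q.proj_eq_zero_iff[OF tq] by simp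
  then show ?thesis by (simp add: ad_def q_def)
qed

end

end

theorem theorem4p6:
  fixes K :: "('k, 'm) ring_scheme" and G :: "('g, 'n) monoid_scheme"
    and A :: "'g \<Rightarrow> ('k, 'a) module"
    and \<Delta> :: "'g \<Rightarrow> 'g \<Rightarrow> 'a \<Rightarrow> ('k, 'a, 'a) tens"
    and \<epsilon> :: "'a \<Rightarrow> 'k"
    and S :: "'g \<Rightarrow> 'a \<Rightarrow> 'a"
    and R :: "'a set"
  assumes "hopf_group_coalgebra K G A \<Delta> \<epsilon> S"
    and "right_ideal R (A \<one>\<^bsub>G\<^esub>)"
    and "R \<subseteq> a_kernel (A \<one>\<^bsub>G\<^esub>) K \<epsilon>"
  shows "bicovariant_fodc K G A \<Delta> (calculus_bimod K G A \<Delta> R) (calculus_diff K G A \<Delta> R)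
    \<longleftrightarrow> ad_invariant K G A \<Delta> R"
proof -
  interpret hopf_calculus K G A \<Delta> \<epsilon> S R
    by (intro hopf_calculus.intro hopf_calculus_axioms.intro assms)
  show ?thesis
  proof
    assume "bicovariant_fodc K G A \<Delta> \<Gamma> d"
    then have "right_covariant_fodc K G A \<Delta> \<Gamma> d" by (rule bicovariant_fodc.axioms(2))
    then show "ad_invariant K G A \<Delta> R"
      unfolding ad_invariant_def using ad_invariant_of_right_covariant by blast
  next
    assume "ad_invariant K G A \<Delta> R"
    then show "bicovariant_fodc K G A \<Delta> \<Gamma> d"
      by (intro bicovariant_fodc.intro left_covariant_fodc right_covariant_fodc)
  qed
qed

end
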